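(* Let $\alpha>\beta>0$ be constants with $\sqrt{\alpha}-\sqrt{\beta}>\sqrt{2}$, and let $\gamma>0$ be such that $$\frac{(\sqrt{\alpha}-\sqrt{\beta})^2}{2}-\frac{\gamma(\log\alpha-\log\beta)}{2}-1>0.$$ Let $A$ be the adjacency matrix of a random graph generated according to the binary symmetric stochastic block model with parameters $(n,p,q)$ and label $x^*$, where $p=\alpha\log n/n$ and $q=\beta\log n/n$. Let $c_1,c_3,c_4$ be the constants (depending only on $\alpha,\beta$) defined in the context, and suppose that $$n>\max\left\{\exp\left(\frac{16c_1^2}{\min\{(\alpha-\beta)^2,\beta^2\}}\right),\ \exp\left(\frac{5c_3}{\sqrt{2\gamma}}\right),\ \exp\left(\frac{c_4^2}{\gamma^2}\right),\ 6\right\}.$$ Then, with probability at least $1-n^{-\Omega(1)}$, the Algorithm described in the context, run with $N=N_1$, takes at most $N_1$ orthogonal iterations and $N_2$ projected power iterations to find $x^*$ or $-x^*$, where $$N_1=\left\lceil\frac{2\log n+\log\log n+2\log\left(\frac{16\alpha+18\beta}{\beta\cdot\min\{1,c_3\}}\right)}{\log\log n+2\log\left(\frac{\alpha-\beta}{4c_1}\right)}\right\rceil,\qquad N_2=\left\lceil\frac{\log n}{\log\log n+2\log\left(\frac{\gamma}{c_4}\right)}\right\rceil+2.$$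
   Context: **Model.** $n\ge 2$ is an even integer, $\log$ is the natural logarithm, $p,q\in[0,1]$, $p>q$, and $x^*\in\{-1,+1\}^n$ is a label vector with $\mathbf{1}^Tx^*=0$, where $\mathbf{1}$ is the all-one vector. A random graph on vertex set $[n]=\{1,\dots,n\}$ is generated according to the binary symmetric stochastic block model with parameters $(n,p,q)$ and label $x^*$ if the entries $\{a_{ij}\}_{1\le i\le j\le n}$ of its (symmetric) adjacency matrix $A$ are independent with $a_{ij}\sim\mathrm{Bern}(p)$ if $x_i^*x_j^*=1$ and $a_{ij}\sim\mathrm{Bern}(q)$ if $x_i^*x_j^*=-1$ (self-loops allowed). **Constants.** $c_1\ge1$ and $c_2>0$ are constants depending only on $\alpha,\beta$ such that, with $p=\alpha\log n/n$, $q=\beta\log n/n$, $\|A-\mathbb{E}[A]\|\le c_1\sqrt{\log n}$ (spectral norm) holds with probability at least $1-c_2n^{-3}$ (such constants are known to exist). Further $c_3:=2\sqrt2\,c_1/\min\{\beta,(\alpha-\beta)/2\}$ and $c_4:=3c_3(\alpha-\beta)+2c_1$. **Projection.** $\mathcal{F}=\{x\in\mathbb{R}^n:\mathbf{1}^Tx=0,\ x_i\in\{\pm1\}\ \forall i\in[n]\}$, and for $c\in\mathbb{R}^n$, $\mathcal{P}(c)$ denotes the set of minimizers of $\|u-c\|_2^2$ over $u\in\mathcal{F}$. **Algorithm** (input: $A$ and a positive integer $N$). Draw $Y\in\mathbb{R}^{n\times 2}$ with i.i.d. standard normal entries, independent of $A$. Stage 1 (orthogonal iterations with Ritz acceleration):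 set $Q^{(0)}=Y(Y^TY)^{-1/2}$. For $k=1,\dots,N$, compute a QR decomposition $AQ^{(k-1)}=Q^{(k)}R^{(k)}$, where $Q^{(k)}\in\mathbb{R}^{n\times2}$ has orthonormal columns and $R^{(k)}\in\mathbb{R}^{2\times 2}$ is upper triangular (one such step is one orthogonal iteration). Compute an eigendecomposition $Q^{(N)T}AQ^{(N)}=H^{(N)}D^{(N)}H^{(N)T}$ with $H^{(N)}$ orthogonal and $D^{(N)}=\mathrm{diag}(d_1^{(N)},d_2^{(N)})$, $|d_1^{(N)}|\ge|d_2^{(N)}|$; set $\bar Q^{(N)}=Q^{(N)}H^{(N)}$; let $\tilde y$ be the $i^*$-th column of $\bar Q^{(N)}$, where $i^*=\arg\min_{i\in\{1,2\}}d_i^{(N)}$; set $y=\tilde y-(\mathbf{1}^T\tilde y/n)\mathbf{1}$. Stage 2 (projected power iterations): set $x^{(0)}=\sqrt n\,y/\|y\|_2$. For $k=1,2,\dots$, choose $x^{(k)}\in\mathcal{P}(Ax^{(k-1)})$ (one such step is one projected power iteration); if $x^{(k)}=x^{(k-1)}$, terminate and output $x^{(k)}$. **Convention.** "Probability at least $1-n^{-\Omega(1)}$" means probability at least $1-n^{-c}$ for all sufficiently large $n$, for some constant $c>0$ independent of $n$; the probability is over $A$ and the random choices in the Algorithm. *)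

theory Defs
  imports "HOL-Probability.Probability" "Jordan_Normal_Form.Matrix"
begin

text \<open>
  The dimension \<open>n\<close> is quantified inside the theorem, so vectors and matrices are those of
  \<open>Jordan_Normal_Form.Matrix\<close>, which carry their dimension as a value. Vertices, columns and
  eigenvalues are numbered from 0. The clashing syntax of HOL-Analysis is switched off.
\<close>

unbundle no vec_syntax
unbundle no inner_syntax
hide_type (open) Finite_Cartesian_Product.vec
hide_const (open) Finite_Cartesian_Product.vec Finite_Cartesian_Product.mat

definition all_ones :: "nat \<Rightarrow> real vec" where
  "all_ones n = vec n (\<lambda>_. 1)"

definition norm2 :: "real vec \<Rightarrow> real" where
  "norm2 v = sqrt (v \<bullet> v)"

definition spectral_norm :: "real mat \<Rightarrow> real" where
  "spectral_norm M = (SUP v\<in>{v \<in> carrier_vec (dim_col M). norm2 v \<le> 1}. norm2 (M *\<^sub>v v))"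


text \<open>The set \<open>\<F>\<close>, which is also the set of admissible label vectors.\<close>

definition balanced_labels :: "nat \<Rightarrow> real vec set" where
  "balanced_labels n = {x \<in> carrier_vec n. all_ones n \<bullet> x = 0 \<and> (\<forall>i<n. x $ i \<in> {-1, 1})}"

definition proj_balanced :: "nat \<Rightarrow> real vec \<Rightarrow> real vec set" where
  "proj_balanced n c = {u. is_arg_min (\<lambda>u. (norm2 (u - c))\<^sup>2) (\<lambda>u. u \<in> balanced_labels n) u}"


text \<open>
  The edge indicators are drawn independently for the pairs \<open>i \<le> j\<close> (self-loops included) and
  extended symmetrically.
\<close>

definition sbm :: "nat \<Rightarrow> real \<Rightarrow> real \<Rightarrow> real vec \<Rightarrow> real mat pmf" where
  "sbm n p q x =
     map_pmf (\<lambda>a. mat n n (\<lambda>(i, j). of_bool (a (min i j, max i j))))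
       (Pi_pmf {(i, j). i \<le> j \<and> j < n} False
          (\<lambda>(i, j). bernoulli_pmf (if x $ i * x $ j = 1 then p else q)))"

definition expected_adj :: "nat \<Rightarrow> real \<Rightarrow> real \<Rightarrow> real vec \<Rightarrow> real mat" where
  "expected_adj n p q x =
     mat n n (\<lambda>(i, j). measure_pmf.expectation (sbm n p q x) (\<lambda>A. A $$ (i, j)))"

text \<open>
  The defining property of the constants \<open>c\<^sub>1, c\<^sub>2\<close>. The condition \<open>\<alpha> log n / n \<le> 1\<close> says
  that \<open>p\<close> (hence \<open>q < p\<close>) is a probability; \<open>bernoulli_pmf\<close> would clip it silently.
\<close>

definition adj_concentration :: "real \<Rightarrow> real \<Rightarrow> real \<Rightarrow> real \<Rightarrow> bool" where
  "adj_concentration \<alpha> \<beta> c1 c2 \<longleftrightarrow>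
     (\<forall>n x. even n \<and> n \<ge> 2 \<and> \<alpha> * ln (real n) / real n \<le> 1 \<and> x \<in> balanced_labels n \<longrightarrow>
        (let p = \<alpha> * ln (real n) / real n; q = \<beta> * ln (real n) / real n in
           measure_pmf.prob (sbm n p q x)
             {A. spectral_norm (A - expected_adj n p q x) \<le> c1 * sqrt (ln (real n))}
           \<ge> 1 - c2 / real n ^ 3))"

definition gaussian_entries :: "nat \<Rightarrow> (nat \<times> nat \<Rightarrow> real) measure" where
  "gaussian_entries n = (\<Pi>\<^sub>M ij\<in>{..<n} \<times> {..<2}. density lborel std_normal_density)"

text \<open>The joint law of the adjacency matrix and, independent of it, the entries of \<open>Y\<close>.\<close>

definition model_space ::
  "nat \<Rightarrow> real \<Rightarrow> real \<Rightarrow> real vec \<Rightarrow> (real mat \<times> (nat \<times> nat \<Rightarrow> real)) measure" where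
  "model_space n p q x = measure_pmf (sbm n p q x) \<Otimes>\<^sub>M gaussian_entries n"


text \<open>
  \<open>W = M\<^sup>-\<^sup>1\<^sup>/\<^sup>2\<close>, the positive definite inverse square root; there is none if \<open>M\<close> is singular.
\<close>

definition is_inv_sqrt :: "real mat \<Rightarrow> real mat \<Rightarrow> bool" where
  "is_inv_sqrt M W \<longleftrightarrow>
     W \<in> carrier_mat (dim_row M) (dim_row M) \<and> W\<^sup>T = W \<and>
     (\<forall>v \<in> carrier_vec (dim_row M). v \<noteq> 0\<^sub>v (dim_row M) \<longrightarrow> v \<bullet> (W *\<^sub>v v) > 0) \<and>
     inverts_mat (W * W) M"

text \<open>
  The thin QR decomposition with two columns. No sign convention is imposed on \<open>R\<close>, so the
  factors are not unique.
\<close>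

definition qr_decomp :: "nat \<Rightarrow> real mat \<Rightarrow> real mat \<Rightarrow> real mat \<Rightarrow> bool" where
  "qr_decomp n B Q R \<longleftrightarrow>
     Q \<in> carrier_mat n 2 \<and> Q\<^sup>T * Q = 1\<^sub>m 2 \<and>
     R \<in> carrier_mat 2 2 \<and> upper_triangular R \<and> B = Q * R"

text \<open>
  \<open>stage1 n A Y N y\<close>: the vector \<open>y\<close> is a possible result of \<open>N\<close> orthogonal iterations followed
  by the Ritz step. Every choice the algorithm leaves open (the QR factors, the
  eigendecomposition, ties in the argmin) is existentially quantified here, so that
  quantifying universally over \<open>y\<close> covers all of them.
\<close>

definition stage1 :: "nat \<Rightarrow> real mat \<Rightarrow> real mat \<Rightarrow> nat \<Rightarrow> real vec \<Rightarrow> bool" where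
  "stage1 n A Y N y \<longleftrightarrow>
     (\<exists>W Q R H D i.
        is_inv_sqrt (Y\<^sup>T * Y) W \<and> Q 0 = Y * W \<and>
        (\<forall>k\<in>{1..N}. qr_decomp n (A * Q (k - 1)) (Q k) (R k)) \<and>
        H \<in> carrier_mat 2 2 \<and> H\<^sup>T * H = 1\<^sub>m 2 \<and>
        D \<in> carrier_mat 2 2 \<and> diagonal_mat D \<and>
        (Q N)\<^sup>T * A * Q N = H * D * H\<^sup>T \<and>
        \<bar>D $$ (0, 0)\<bar> \<ge> \<bar>D $$ (1, 1)\<bar> \<and>
        is_arg_min (\<lambda>j. D $$ (j, j)) (\<lambda>j. j < 2) i \<and>
        (let y' = col (Q N * H) i in
           y = y' - (all_ones n \<bullet> y' / real n) \<cdot>\<^sub>v all_ones n))"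

text \<open>
  The iterates are continued for ever; termination is read off the sequence by \<open>halts_at\<close>,
  which picks the first \<open>k \<ge> 1\<close> with \<open>x\<^sup>(\<^sup>k\<^sup>) = x\<^sup>(\<^sup>k\<^sup>-\<^sup>1\<^sup>)\<close>. The output is then \<open>x k\<close>.
\<close>

definition ppm_run :: "nat \<Rightarrow> real mat \<Rightarrow> real vec \<Rightarrow> (nat \<Rightarrow> real vec) \<Rightarrow> bool" where
  "ppm_run n A y x \<longleftrightarrow>
     x 0 = (sqrt (real n) / norm2 y) \<cdot>\<^sub>v y \<and>
     (\<forall>k\<ge>1. x k \<in> proj_balanced n (A *\<^sub>v x (k - 1)))"

definition halts_at :: "(nat \<Rightarrow> real vec) \<Rightarrow> nat \<Rightarrow> bool" where
  "halts_at x k \<longleftrightarrow> k \<ge> 1 \<and> x k = x (k - 1) \<and> (\<forall>j\<in>{1..<k}. x j \<noteq> x (j - 1))"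

text \<open>
  The algorithm is well defined (stage 1 can be carried out and \<open>y \<noteq> 0\<close>, so that \<open>x\<^sup>(\<^sup>0\<^sup>)\<close> makes
  sense) and, whatever choices are made, it performs \<open>N\<close> orthogonal iterations, terminates within
  \<open>K\<close> projected power iterations and outputs \<open>x*\<close> or \<open>-x*\<close>. Because of the quantification over
  all choices, measurability of this predicate in \<open>(A, Y)\<close> is not obvious; probability bounds for
  it are therefore stated by way of a measurable subset of \<open>model_space\<close> on which it holds.
\<close>

definition finds_labels ::
  "nat \<Rightarrow> real vec \<Rightarrow> nat \<Rightarrow> nat \<Rightarrow> real mat \<Rightarrow> real mat \<Rightarrow> bool" where
  "finds_labels n xs N K A Y \<longleftrightarrow>
     (\<exists>y. stage1 n A Y N y) \<and>
     (\<forall>y. stage1 n A Y N y \<longrightarrow>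
        y \<noteq> 0\<^sub>v n \<and>
        (\<forall>x. ppm_run n A y x \<longrightarrow> (\<exists>k\<le>K. halts_at x k \<and> x k \<in> {xs, - xs})))"


definition orth_iters :: "real \<Rightarrow> real \<Rightarrow> real \<Rightarrow> real \<Rightarrow> nat \<Rightarrow> nat" where
  "orth_iters \<alpha> \<beta> c1 c3 n =
     nat \<lceil>(2 * ln (real n) + ln (ln (real n))
            + 2 * ln ((16 * \<alpha> + 18 * \<beta>) / (\<beta> * min 1 c3)))
          / (ln (ln (real n)) + 2 * ln ((\<alpha> - \<beta>) / (4 * c1)))\<rceil>"

definition ppm_iters :: "real \<Rightarrow> real \<Rightarrow> nat \<Rightarrow> nat" where
  "ppm_iters \<gamma> c4 n = nat (\<lceil>ln (real n) / (ln (ln (real n)) + 2 * ln (\<gamma> / c4))\<rceil> + 2)"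

end

(*
Condition on a good graph: spectral_norm (A - EA) <= d = c1 sqrt(log n), and every vertex has margin
xs_i (A xs)_i >= gamma log n (a Chernoff bound). As EA has rank two, with orthonormal eigenvectors
1/sqrt n and xs/sqrt n spanning a plane, no spectral theorem for A is needed. Vectors closer to the
plane than to its complement form a cone that A preserves, expanding by at least mu = l2 - sqrt 2 d.
A vector y with A^N y orthogonal to the plane never entered the cone, so A^N y has norm at most
sqrt 2 (sqrt 2 d)^N |y|. Splitting Y b along the span of A^N (1/sqrt n), A^N (xs/sqrt n) and its
orthogonal complement, the first part is an N-fold iterate from the plane itself, and its length is
bounded below by the smallest singular value of a 2 x 2 Gaussian matrix. Hence the range of A^N Y is
close to the plane, and the Ritz step returns a vector close to xs/sqrt n up to sign, because the
eigenvalues of EA are separated by beta log n.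
For u in P(A v) minimality gives (xs - u) . (A v) <= 0, which together with the margins makes
|u - xs| <= theta |v - xs| with theta = c4 / (gamma sqrt(log n)); the iterates are eventually closer
to xs than two distinct label vectors can be.
*)

theory Submission
  imports Defs "Jordan_Normal_Form.Determinant"
begin

section \<open>Euclidean vectors and iterates\<close>

text \<open>Success is claimed for every choice of QR factors, eigenvectors and ties, so only what
  all choices share may be used: the columns of \<open>Q k\<close> lie in the range of
  \<open>A^k Y\<close>, and the Ritz step yields orthonormal, \<open>A\<close>-orthogonal vectors
  there. Conversely a run must exist, so the inverse square root, the QR factors and the
  eigendecomposition are constructed for two columns. The Gaussian estimate needs directions fixed
  before \<open>Y\<close> is drawn. The span of \<open>A^N e1\<close>, \<open>A^N e2\<close> depends
  on \<open>A\<close> alone but varies with \<open>A\<close>; as the graph law has finite support,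
  the good event is a finite union of rectangles, one per graph. For large n each orthogonal
  iteration gains a factor D sqrt(log n), D = (\<alpha> - \<beta>) / (4 c1), and \<open>N_1\<close>
  iterations gain at least n. This pays for the length of \<open>Y b\<close>, about sqrt n up to
  small powers of n, and for the small singular value. Likewise \<open>N_2\<close> lets \<theta>
  turn a distance of order sqrt n into one below 2, with one more iteration to see the
  repeat.\<close>

lemma norm2_nonneg [simp]: "0 \<le> norm2 v"
  unfolding norm2_def by (intro real_sqrt_ge_zero) (simp add: scalar_prod_def sum_nonneg)

lemma scalar_prod_self_nonneg: "0 \<le> (v :: real vec) \<bullet> v"
  by (simp add: scalar_prod_def sum_nonneg)

lemma norm2_power2: "(norm2 v)\<^sup>2 = v \<bullet> v"
  unfolding norm2_def by (simp add: scalar_prod_self_nonneg)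

lemma norm2_L2_set: "norm2 v = L2_set (\<lambda>i. v $ i) {..<dim_vec v}"
  unfolding norm2_def L2_set_def scalar_prod_def
  by (simp add: power2_eq_square atLeast0LessThan)

lemma norm2_smult [simp]: "norm2 (c \<cdot>\<^sub>v v) = \<bar>c\<bar> * norm2 v"
proof -
  have "(c \<cdot>\<^sub>v v) \<bullet> (c \<cdot>\<^sub>v v) = c\<^sup>2 * (v \<bullet> v)"
    by (simp add: scalar_prod_def sum_distrib_left power2_eq_square ac_simps)
  then show ?thesis by (simp add: norm2_def real_sqrt_mult)
qed

lemma scalar_prod_le_norm2:
  assumes "v \<in> carrier_vec n" "w \<in> carrier_vec n"
  shows "\<bar>v \<bullet> w\<bar> \<le> norm2 v * norm2 w"
proof -
  have "\<bar>v \<bullet> w\<bar> \<le> (\<Sum>i<n. \<bar>v $ i\<bar> * \<bar>w $ i\<bar>)"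
    using assms unfolding scalar_prod_def
    by (auto simp: atLeast0LessThan abs_mult[symmetric] intro!: sum_abs)
  also have "\<dots> \<le> norm2 v * norm2 w"
    using assms by (simp add: norm2_L2_set L2_set_mult_ineq)
  finally show ?thesis .
qed

lemma norm2_triangle:
  assumes "v \<in> carrier_vec n" "w \<in> carrier_vec n"
  shows "norm2 (v + w) \<le> norm2 v + norm2 w"
proof -
  have "norm2 (v + w) = L2_set (\<lambda>i. v $ i + w $ i) {..<n}"
    using assms by (auto simp: norm2_L2_set intro!: L2_set_cong)
  then show ?thesis
    using L2_set_triangle_ineq[of "\<lambda>i. v $ i" "\<lambda>i. w $ i" "{..<n}"] assms
    by (simp add: norm2_L2_set)
qed

lemma norm2_zero_vec [simp]: "norm2 (0\<^sub>v n) = 0"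
  by (simp add: norm2_def)

lemma norm2_eq_0_iff:
  assumes "v \<in> carrier_vec n"
  shows "norm2 v = 0 \<longleftrightarrow> v = 0\<^sub>v n"
  using assms by (auto simp: norm2_L2_set L2_set_eq_0_iff)

lemma norm2_minus_commute:
  assumes "v \<in> carrier_vec n" "w \<in> carrier_vec n"
  shows "norm2 (v - w) = norm2 (w - v)"
proof -
  have "v - w = (-1) \<cdot>\<^sub>v (w - v)" using assms by auto
  then show ?thesis by simp
qed

lemma norm2_add_power2:
  assumes "v \<in> carrier_vec n" "w \<in> carrier_vec n"
  shows "(norm2 (v + w))\<^sup>2 = (norm2 v)\<^sup>2 + 2 * (v \<bullet> w) + (norm2 w)\<^sup>2"
  using assms comm_scalar_prod[of w n v]
  by (simp add: norm2_power2 add_scalar_prod_distrib[of _ n] scalar_prod_add_distrib[of _ n])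

lemma norm2_diff_power2:
  assumes "v \<in> carrier_vec n" "w \<in> carrier_vec n"
  shows "(norm2 (v - w))\<^sup>2 = (norm2 v)\<^sup>2 - 2 * (v \<bullet> w) + (norm2 w)\<^sup>2"
  using assms comm_scalar_prod[of w n v]
  by (simp add: norm2_power2 minus_scalar_prod_distrib[of _ n] scalar_prod_minus_distrib[of _ n])

lemma scalar_prod_mult_mat_vec_sym:
  fixes A :: "real mat"
  assumes A: "A \<in> carrier_mat n n" "A\<^sup>T = A" and v: "v \<in> carrier_vec n" and w: "w \<in> carrier_vec n"
  shows "(A *\<^sub>v v) \<bullet> w = v \<bullet> (A *\<^sub>v w)"
  using transpose_vec_mult_scalar[of A n n v w] A v w
  by (metis mult_mat_vec_carrier comm_scalar_prod)

section \<open>Powers of a matrix applied to vectors\<close>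

abbreviation mat_iter :: "real mat \<Rightarrow> nat \<Rightarrow> real vec \<Rightarrow> real vec" where
  "mat_iter A k \<equiv> ((*\<^sub>v) A) ^^ k"

lemma mat_iter_carrier [simp]:
  "A \<in> carrier_mat n n \<Longrightarrow> v \<in> carrier_vec n \<Longrightarrow> mat_iter A k v \<in> carrier_vec n"
  by (induction k) auto

lemma mat_iter_add:
  "A \<in> carrier_mat n n \<Longrightarrow> v \<in> carrier_vec n \<Longrightarrow> w \<in> carrier_vec n \<Longrightarrow>
    mat_iter A k (v + w) = mat_iter A k v + mat_iter A k w"
  by (induction k) (auto simp: mult_add_distrib_mat_vec[of A n n])

lemma mat_iter_smult:
  "A \<in> carrier_mat n n \<Longrightarrow> v \<in> carrier_vec n \<Longrightarrow> mat_iter A k (c \<cdot>\<^sub>v v) = c \<cdot>\<^sub>v mat_iter A k v"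
  by (induction k) (auto simp: mult_mat_vec[of A n n])

text \<open>Self-adjointness passes from \<open>A\<close> to its powers. It is used to see that a
  vector orthogonal to \<open>A^N e1\<close> and \<open>A^N e2\<close> is mapped by
  \<open>A^N\<close> to a vector orthogonal to \<open>e1\<close> and \<open>e2\<close>.\<close>

lemma mat_iter_scalar_prod:
  assumes "A \<in> carrier_mat n n" "A\<^sup>T = A" "v \<in> carrier_vec n" "w \<in> carrier_vec n"
  shows "mat_iter A k v \<bullet> w = v \<bullet> mat_iter A k w"
  using assms(3,4)
proof (induction k arbitrary: w)
  case (Suc k)
  have "mat_iter A (Suc k) v \<bullet> w = mat_iter A k v \<bullet> (A *\<^sub>v w)"
    using Suc.prems assms(1,2) by (simp add: scalar_prod_mult_mat_vec_sym)
  also have "\<dots> = v \<bullet> mat_iter A (Suc k) w"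
    using Suc.IH[OF Suc.prems(1), of "A *\<^sub>v w"] Suc.prems assms(1)
    by (simp add: funpow_swap1)
  finally show ?case .
qed simp

section \<open>A dominant two-dimensional block\<close>

text \<open>Abstracts from the graph: in the application \<open>e1\<close>, \<open>e2\<close> are
  the normalised all-ones and label vectors, and \<open>perturbation\<close> is the spectral norm
  bound on \<open>A - E[A]\<close> read vector by vector. The cone argument concerns the plane as a
  whole, for which \<open>l2 \<le> l1\<close> suffices; a strict gap enters when the Ritz step
  separates the two directions inside the plane.\<close>

locale rank_two_perturbation =
  fixes n :: nat and A :: "real mat" and e1 e2 :: "real vec" and l1 l2 d :: real
  assumes A: "A \<in> carrier_mat n n" and sym: "A\<^sup>T = A"
    and e1: "e1 \<in> carrier_vec n" and e2: "e2 \<in> carrier_vec n"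
    and e11: "e1 \<bullet> e1 = 1" and e22: "e2 \<bullet> e2 = 1" and e12: "e1 \<bullet> e2 = 0"
    and l2_nonneg: "0 \<le> l2" and l2_le_l1: "l2 \<le> l1" and d_nonneg: "0 \<le> d"
    and perturbation: "\<And>v. v \<in> carrier_vec n \<Longrightarrow>
      norm2 (A *\<^sub>v v - ((l1 * (e1 \<bullet> v)) \<cdot>\<^sub>v e1 + (l2 * (e2 \<bullet> v)) \<cdot>\<^sub>v e2)) \<le> d * norm2 v"
begin

definition proj :: "real vec \<Rightarrow> real vec" where
  "proj v = (e1 \<bullet> v) \<cdot>\<^sub>v e1 + (e2 \<bullet> v) \<cdot>\<^sub>v e2"

definition par :: "real vec \<Rightarrow> real" where "par v = norm2 (proj v)"

definition perp :: "real vec \<Rightarrow> real" where "perp v = norm2 (v - proj v)"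

lemma e21: "e2 \<bullet> e1 = 0"
  using e12 comm_scalar_prod[OF e1 e2] by simp

lemma proj_carrier [simp]: "proj v \<in> carrier_vec n"
  unfolding proj_def using e1 e2 by auto

lemma dim_proj [simp]: "dim_vec (proj v) = n"
  using proj_carrier[of v] by (rule carrier_vecD)

lemma combination_scalar_prod:
  assumes "v \<in> carrier_vec n"
  shows "(s \<cdot>\<^sub>v e1 + t \<cdot>\<^sub>v e2) \<bullet> v = s * (e1 \<bullet> v) + t * (e2 \<bullet> v)"
  using assms e1 e2 by (simp add: add_scalar_prod_distrib[of _ n])

lemma scalar_prod_combination:
  shows "e1 \<bullet> (s \<cdot>\<^sub>v e1 + t \<cdot>\<^sub>v e2) = s" "e2 \<bullet> (s \<cdot>\<^sub>v e1 + t \<cdot>\<^sub>v e2) = t"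
  using e1 e2 by (simp_all add: scalar_prod_add_distrib[of _ n] e11 e22 e12 e21)

lemma norm2_combination: "(norm2 (s \<cdot>\<^sub>v e1 + t \<cdot>\<^sub>v e2))\<^sup>2 = s\<^sup>2 + t\<^sup>2"
  unfolding norm2_power2
  using e1 e2 by (simp add: combination_scalar_prod scalar_prod_combination power2_eq_square)

lemma par_power2: "(par v)\<^sup>2 = (e1 \<bullet> v)\<^sup>2 + (e2 \<bullet> v)\<^sup>2"
  unfolding par_def proj_def by (rule norm2_combination)

lemma par_perp_power2:
  assumes "v \<in> carrier_vec n"
  shows "(norm2 v)\<^sup>2 = (par v)\<^sup>2 + (perp v)\<^sup>2"
proof -
  have "v \<bullet> proj v = (par v)\<^sup>2"
    using combination_scalar_prod[OF assms, of "e1 \<bullet> v" "e2 \<bullet> v"] comm_scalar_prod[OF assms proj_carrier[of v]]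
    unfolding par_power2 by (simp add: proj_def power2_eq_square)
  then show ?thesis
    unfolding perp_def using norm2_diff_power2[OF assms proj_carrier[of v]] by (simp add: par_def)
qed

lemma par_nonneg [simp]: "0 \<le> par v" and perp_nonneg [simp]: "0 \<le> perp v"
  by (simp_all add: par_def perp_def)

lemma par_le_norm2: "v \<in> carrier_vec n \<Longrightarrow> par v \<le> norm2 v"
  by (rule power2_le_imp_le) (simp_all add: par_perp_power2)

lemma perp_le_norm2: "v \<in> carrier_vec n \<Longrightarrow> perp v \<le> norm2 v"
  by (rule power2_le_imp_le) (simp_all add: par_perp_power2)

lemma proj_add:
  assumes "v \<in> carrier_vec n" "w \<in> carrier_vec n"
  shows "proj (v + w) = proj v + proj w"
  unfolding proj_def using assms e1 e2
  by (intro eq_vecI) (auto simp: scalar_prod_add_distrib[of _ n] algebra_simps)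

lemma par_triangle:
  assumes "v \<in> carrier_vec n" "w \<in> carrier_vec n"
  shows "par (v + w) \<le> par v + par w"
  unfolding par_def proj_add[OF assms] by (rule norm2_triangle[of _ n]) auto

lemma perp_triangle:
  assumes "v \<in> carrier_vec n" "w \<in> carrier_vec n"
  shows "perp (v + w) \<le> perp v + perp w"
proof -
  have "v + w - proj (v + w) = (v - proj v) + (w - proj w)"
    unfolding proj_add[OF assms]
    using assms by (intro eq_vecI) auto
  then show ?thesis
    unfolding perp_def using norm2_triangle[of "v - proj v" n "w - proj w"] assms by auto
qed

lemma proj_combination: "proj (s \<cdot>\<^sub>v e1 + t \<cdot>\<^sub>v e2) = s \<cdot>\<^sub>v e1 + t \<cdot>\<^sub>v e2"
  by (simp add: proj_def scalar_prod_combination)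

lemma perp_combination [simp]: "perp (s \<cdot>\<^sub>v e1 + t \<cdot>\<^sub>v e2) = 0"
  using e1 e2 by (simp add: perp_def proj_combination minus_cancel_vec[of _ n])

text \<open>The rank-two part \<open>B\<close> takes values in the plane, so whatever leaves the
  plane comes from the error \<open>E\<close>; within the plane \<open>B\<close> stretches every
  direction by at least the smaller eigenvalue \<open>l2\<close>.\<close>

lemma
  assumes v: "v \<in> carrier_vec n"
  shows par_mult_ge: "l2 * par v - d * norm2 v \<le> par (A *\<^sub>v v)"
    and perp_mult_le: "perp (A *\<^sub>v v) \<le> d * norm2 v"
proof -
  define B where "B = (l1 * (e1 \<bullet> v)) \<cdot>\<^sub>v e1 + (l2 * (e2 \<bullet> v)) \<cdot>\<^sub>v e2"
  define E where "E = A *\<^sub>v v - B"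
  have c: "B \<in> carrier_vec n" "E \<in> carrier_vec n" "A *\<^sub>v v \<in> carrier_vec n"
    unfolding B_def E_def using e1 e2 A v by auto
  have dec: "A *\<^sub>v v = B + E"
    using c[THEN carrier_vecD] unfolding E_def by (intro eq_vecI) auto
  have E: "norm2 E \<le> d * norm2 v" unfolding E_def B_def by (rule perturbation[OF v])
  have "perp (A *\<^sub>v v) \<le> perp B + perp E" unfolding dec by (rule perp_triangle) (use c in auto)
  also have "perp B = 0" unfolding B_def by simp
  finally show "perp (A *\<^sub>v v) \<le> d * norm2 v" using perp_le_norm2[OF c(2)] E by linarith
  have "B = (A *\<^sub>v v) + (-1) \<cdot>\<^sub>v E"
    using c[THEN carrier_vecD] unfolding E_def by (intro eq_vecI) auto
  then have "par B \<le> par (A *\<^sub>v v) + par ((-1) \<cdot>\<^sub>v E)" using par_triangle c by simp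
  also have "par ((-1) \<cdot>\<^sub>v E) \<le> norm2 E" using par_le_norm2[of "(-1) \<cdot>\<^sub>v E"] c by simp
  finally have 1: "par B \<le> par (A *\<^sub>v v) + d * norm2 v" using E by linarith
  have "(l2 * par v)\<^sup>2 = (l2 * (e1 \<bullet> v))\<^sup>2 + (l2 * (e2 \<bullet> v))\<^sup>2"
    by (simp add: par_power2 power_mult_distrib algebra_simps)
  also have "\<dots> \<le> (l1 * (e1 \<bullet> v))\<^sup>2 + (l2 * (e2 \<bullet> v))\<^sup>2"
    using l2_nonneg l2_le_l1 by (simp add: power_mult_distrib mult_right_mono power_mono)
  also have "\<dots> = (par B)\<^sup>2" unfolding B_def par_def proj_combination by (rule norm2_combination[symmetric])
  finally have "l2 * par v \<le> par B" by (rule power2_le_imp_le) simp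
  then show "l2 * par v - d * norm2 v \<le> par (A *\<^sub>v v)" using 1 by linarith
qed

end

text \<open>\<open>\<kappa>\<close> bounds the growth per step outside the cone and
  \<open>\<mu>\<close> the expansion inside it. The factor \<open>sqrt 2\<close> is the worst ratio
  of \<open>norm2 v\<close> to the larger of \<open>par v\<close> and \<open>perp v\<close>,
  attained at 45 degrees, the boundary of the cone; \<open>\<kappa> \<le> \<mu>\<close> is what
  makes the cone invariant.\<close>

locale dominant_block = rank_two_perturbation +
  fixes \<kappa> \<mu> :: real
  assumes \<kappa>_def: "\<kappa> = sqrt 2 * d" and \<mu>_def: "\<mu> = l2 - sqrt 2 * d" and \<kappa>_le_\<mu>: "\<kappa> \<le> \<mu>" and \<mu>_pos: "0 < \<mu>"
begin

lemma \<kappa>_nonneg [simp]: "0 \<le> \<kappa>"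
  using d_nonneg by (simp add: \<kappa>_def)

lemma norm2_le_par:
  assumes "v \<in> carrier_vec n" "perp v \<le> par v"
  shows "norm2 v \<le> sqrt 2 * par v"
proof (rule power2_le_imp_le)
  have "(perp v)\<^sup>2 \<le> (par v)\<^sup>2" using assms(2) by (simp add: power_mono)
  then show "(norm2 v)\<^sup>2 \<le> (sqrt 2 * par v)\<^sup>2"
    by (simp add: par_perp_power2[OF assms(1)] power_mult_distrib)
qed simp

lemma norm2_le_perp:
  assumes "v \<in> carrier_vec n" "par v \<le> perp v"
  shows "norm2 v \<le> sqrt 2 * perp v"
proof (rule power2_le_imp_le)
  have "(par v)\<^sup>2 \<le> (perp v)\<^sup>2" using assms(2) by (simp add: power_mono)
  then show "(norm2 v)\<^sup>2 \<le> (sqrt 2 * perp v)\<^sup>2"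
    by (simp add: par_perp_power2[OF assms(1)] power_mult_distrib)
qed simp

text \<open>In the cone the error is at most \<open>d * norm2 v \<le> \<kappa> * par v\<close>. It
  leaves at least \<open>\<mu> * par v\<close> of the expansion in the plane and creates at most
  \<open>\<kappa> * par v\<close> outside it; dividing the two removes \<open>par v\<close>.\<close>

lemma
  assumes v: "v \<in> carrier_vec n" and cone: "perp v \<le> par v"
  shows cone_par_mult: "\<mu> * par v \<le> par (A *\<^sub>v v)"
    and cone_perp_mult: "perp (A *\<^sub>v v) \<le> \<kappa> / \<mu> * par (A *\<^sub>v v)"
    and cone_mult: "perp (A *\<^sub>v v) \<le> par (A *\<^sub>v v)"
proof -
  have "d * norm2 v \<le> \<kappa> * par v"
    using mult_left_mono[OF norm2_le_par[OF v cone] d_nonneg] by (simp add: \<kappa>_def ac_simps)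
  then have 1: "perp (A *\<^sub>v v) \<le> \<kappa> * par v" and 2: "\<mu> * par v \<le> par (A *\<^sub>v v)"
    using par_mult_ge[OF v] perp_mult_le[OF v] by (auto simp: \<kappa>_def \<mu>_def algebra_simps)
  show "\<mu> * par v \<le> par (A *\<^sub>v v)" by fact
  have "par v \<le> par (A *\<^sub>v v) / \<mu>" using 2 \<mu>_pos by (simp add: field_simps)
  then show 3: "perp (A *\<^sub>v v) \<le> \<kappa> / \<mu> * par (A *\<^sub>v v)"
    using 1 mult_left_mono[of "par v" "par (A *\<^sub>v v) / \<mu>" \<kappa>] by simp
  have "\<kappa> / \<mu> \<le> 1" using \<kappa>_le_\<mu> \<mu>_pos by simp
  then show "perp (A *\<^sub>v v) \<le> par (A *\<^sub>v v)"
    using 3 mult_right_mono[of "\<kappa> / \<mu>" 1 "par (A *\<^sub>v v)"] by simp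
qed

lemma
  assumes v: "v \<in> carrier_vec n" and cone: "perp v \<le> par v"
  shows cone_par_iter: "\<mu> ^ k * par v \<le> par (mat_iter A k v)"
    and cone_iter: "perp (mat_iter A k v) \<le> par (mat_iter A k v)"
proof (induction k)
  case (Suc k)
  note c = mat_iter_carrier[OF A v, of k]
  {
    case 1
    then show ?case
      using order_trans[OF mult_left_mono[OF Suc(1), of \<mu>] cone_par_mult[OF c Suc(2)]] \<mu>_pos
      by (simp add: mult.assoc)
  next
    case 2
    then show ?case using cone_mult[OF c Suc(2)] by simp
  }
qed (use cone in simp_all)

text \<open>The bound comes from the last step alone, whence the ratio is
  \<open>\<kappa> / \<mu>\<close> for every positive \<open>k\<close> and not a power of it: each
  multiplication creates a new component outside the plane.\<close>

lemma cone_perp_iter: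
  assumes "v \<in> carrier_vec n" "perp v \<le> par v" "0 < k"
  shows "perp (mat_iter A k v) \<le> \<kappa> / \<mu> * par (mat_iter A k v)"
  using cone_perp_mult[OF mat_iter_carrier[OF A assms(1)] cone_iter[OF assms(1,2)], of "k - 1"] assms(3)
  by (cases k) simp_all

text \<open>A vector that ends orthogonal to both leading directions never entered the cone.\<close>

lemma norm2_iter_le:
  assumes v: "v \<in> carrier_vec n" and 0: "par (mat_iter A m v) = 0"
  shows "norm2 (mat_iter A m v) \<le> sqrt 2 * (\<kappa> ^ m * norm2 v)"
proof -
  have out: "par (mat_iter A k v) \<le> perp (mat_iter A k v)" if "k \<le> m" for k
  proof (rule ccontr)
    assume *: "\<not> ?thesis"
    let ?w = "mat_iter A k v"
    have "\<mu> ^ (m - k) * par ?w \<le> par (mat_iter A (m - k) ?w)"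
      by (rule cone_par_iter) (use * mat_iter_carrier[OF A v] in auto)
    also have "mat_iter A (m - k) ?w = mat_iter A m v"
      using that funpow_add[of "m - k" k "(*\<^sub>v) A"] by simp
    finally have "\<mu> ^ (m - k) * par ?w \<le> 0" using 0 by simp
    moreover have "0 < par ?w" using * perp_nonneg[of ?w] by linarith
    ultimately show False using \<mu>_pos zero_less_power[OF \<mu>_pos, of "m - k"]
      by (simp add: mult_le_0_iff)
  qed
  \<comment> \<open>As long as the iterate is outside the cone, \<open>perp\<close> controls the
    full length up to \<open>sqrt 2\<close>, so each step multiplies it by at most
    \<open>\<kappa> = sqrt 2 * d\<close>.\<close>
  have "perp (mat_iter A k v) \<le> \<kappa> ^ k * norm2 v" if "k \<le> m" for k
    using that
  proof (induction k)
    case (Suc k)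
    let ?w = "mat_iter A k v"
    have c: "?w \<in> carrier_vec n" by (rule mat_iter_carrier[OF A v])
    have "perp (A *\<^sub>v ?w) \<le> d * norm2 ?w" by (rule perp_mult_le[OF c])
    also have "\<dots> \<le> d * (sqrt 2 * perp ?w)"
      by (intro mult_left_mono norm2_le_perp c out d_nonneg) (use Suc in auto)
    also have "\<dots> = \<kappa> * perp ?w" by (simp add: \<kappa>_def)
    also have "\<dots> \<le> \<kappa> * (\<kappa> ^ k * norm2 v)" using Suc by (intro mult_left_mono) auto
    finally show ?case by simp
  qed (use perp_le_norm2[OF v] in simp)
  from this[of m] norm2_le_perp[OF mat_iter_carrier[OF A v] out[of m]]
  show ?thesis by (smt (verit) mult_left_mono real_sqrt_ge_zero order_refl)
qed

end

context dominant_block begin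

text \<open>
  The directions \<open>u1, u2\<close> span \<open>A ^ N\<close> applied to the leading block. A vector splits into its
  projection to that span, which iterates inside the cone, and a rest \<open>y\<close> with \<open>A ^ N y\<close>
  orthogonal to the block, which \<open>norm2_iter_le\<close> controls.
\<close>

lemma iterate_captured:
  assumes N: "0 < N"
  obtains u1 u2 where "u1 \<in> carrier_vec n" "u2 \<in> carrier_vec n"
    "u1 \<bullet> u1 = 1" "u2 \<bullet> u2 = 1" "u1 \<bullet> u2 = 0"
    "\<forall>v\<in>carrier_vec n. \<forall>\<xi>. 0 < (u1 \<bullet> v)\<^sup>2 + (u2 \<bullet> v)\<^sup>2 \<longrightarrow>
       2 * (\<kappa> / \<mu>) ^ N * norm2 v \<le> \<xi> * sqrt ((u1 \<bullet> v)\<^sup>2 + (u2 \<bullet> v)\<^sup>2) \<longrightarrow>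
       mat_iter A N v \<noteq> 0\<^sub>v n \<and> perp (mat_iter A N v) \<le> (\<kappa> / \<mu> + \<xi>) * norm2 (mat_iter A N v)"
proof -
  let ?F = "mat_iter A N"
  have Fc: "?F v \<in> carrier_vec n" if "v \<in> carrier_vec n" for v
    using mat_iter_carrier[OF A that] .
  have cc: "s \<cdot>\<^sub>v e1 + t \<cdot>\<^sub>v e2 \<in> carrier_vec n" for s t using e1 e2 by auto
  have Fcomb: "?F (s \<cdot>\<^sub>v e1 + t \<cdot>\<^sub>v e2) = s \<cdot>\<^sub>v ?F e1 + t \<cdot>\<^sub>v ?F e2" for s t
    using e1 e2 A by (simp add: mat_iter_add[of _ n] mat_iter_smult[of _ n])
  \<comment> \<open>A combination of \<open>e1\<close>, \<open>e2\<close> has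
    \<open>perp = 0\<close>, hence starts in the cone, where \<open>par\<close> is multiplied by at
    least \<open>\<mu>\<close> at each step and cannot vanish. So \<open>A^N e1\<close>,
    \<open>A^N e2\<close> are linearly independent, as the Gram-Schmidt step below requires.\<close>
  have pos: "0 < norm2 (s \<cdot>\<^sub>v ?F e1 + t \<cdot>\<^sub>v ?F e2)" if "s \<noteq> 0 \<or> t \<noteq> 0" for s t
  proof -
    let ?b = "s \<cdot>\<^sub>v e1 + t \<cdot>\<^sub>v e2"
    have "0 < (norm2 ?b)\<^sup>2" using that by (simp add: norm2_combination sum_power2_gt_zero_iff)
    then have "norm2 ?b \<noteq> 0" by (simp only: zero_less_power2 not_False_eq_True)
    then have "0 < norm2 ?b" by (simp only: order_less_le norm2_nonneg not_sym simp_thms)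
    then have "0 < par ?b" by (simp add: par_def proj_combination)
    then have "0 < \<mu> ^ N * par ?b" using \<mu>_pos by simp
    also have "\<dots> \<le> par (?F ?b)" by (rule cone_par_iter[OF cc]) simp
    also have "\<dots> \<le> norm2 (?F ?b)" by (rule par_le_norm2[OF Fc[OF cc]])
    finally show ?thesis by (simp add: Fcomb)
  qed
  define x1 where "x1 = ?F e1"
  define x2 where "x2 = ?F e2"
  have x: "x1 \<in> carrier_vec n" "x2 \<in> carrier_vec n" unfolding x1_def x2_def using Fc e1 e2 by auto
  have n1: "0 < norm2 x1"
  proof -
    have "1 \<cdot>\<^sub>v x1 + 0 \<cdot>\<^sub>v x2 = x1" using x by auto
    then show ?thesis using pos[of 1 0] unfolding x1_def[symmetric] x2_def[symmetric] by simp
  qed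
  define u1 where "u1 = (1 / norm2 x1) \<cdot>\<^sub>v x1"
  have u1: "u1 \<in> carrier_vec n" unfolding u1_def using x by simp
  have u11: "u1 \<bullet> u1 = 1"
    using n1 x by (simp add: u1_def power2_eq_square flip: norm2_power2)
  define c where "c = u1 \<bullet> x2"
  define w where "w = x2 - c \<cdot>\<^sub>v u1"
  have w_alt: "w = (- c / norm2 x1) \<cdot>\<^sub>v x1 + 1 \<cdot>\<^sub>v x2"
    unfolding w_def u1_def using x by (intro eq_vecI) auto
  have w: "w \<in> carrier_vec n" unfolding w_def using x u1 by auto
  have n2: "0 < norm2 w" unfolding w_alt x1_def x2_def by (rule pos) simp
  define u2 where "u2 = (1 / norm2 w) \<cdot>\<^sub>v w"
  have u2: "u2 \<in> carrier_vec n" unfolding u2_def using w by simp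
  have u22: "u2 \<bullet> u2 = 1"
    using n2 w by (simp add: u2_def power2_eq_square flip: norm2_power2)
  have "u1 \<bullet> w = 0" unfolding w_def using x u1 by (simp add: scalar_prod_minus_distrib[of _ n] u11 c_def)
  then have u12: "u1 \<bullet> u2 = 0" unfolding u2_def using u1 w by simp
  have u21: "u2 \<bullet> u1 = 0" using u12 comm_scalar_prod[OF u1 u2] by simp
  have x1_u: "x1 = norm2 x1 \<cdot>\<^sub>v u1"
    unfolding u1_def using n1 by (intro eq_vecI) auto
  have x2_u: "x2 = norm2 w \<cdot>\<^sub>v u2 + c \<cdot>\<^sub>v u1"
  proof -
    have "norm2 w \<cdot>\<^sub>v u2 = w" unfolding u2_def using n2 by (intro eq_vecI) auto
    then show ?thesis unfolding w_def using x u1 by (intro eq_vecI) auto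
  qed
  \<comment> \<open>\<open>v'\<close> below is the projection of \<open>v\<close> to the span of
    \<open>u1\<close>, \<open>u2\<close>, of length \<open>r\<close>. The condition on
    \<open>\<xi>\<close> compares \<open>r\<close> with the length of \<open>v\<close> after the
    decay by \<open>(\<kappa> / \<mu>) ^ N\<close>.\<close>
  have main: "?F v \<noteq> 0\<^sub>v n \<and> perp (?F v) \<le> (\<kappa> / \<mu> + \<xi>) * norm2 (?F v)"
    if v: "v \<in> carrier_vec n" and r_pos: "0 < (u1 \<bullet> v)\<^sup>2 + (u2 \<bullet> v)\<^sup>2"
      and \<xi>: "2 * (\<kappa> / \<mu>) ^ N * norm2 v \<le> \<xi> * sqrt ((u1 \<bullet> v)\<^sup>2 + (u2 \<bullet> v)\<^sup>2)" for v \<xi>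
  proof -
    define r where "r = sqrt ((u1 \<bullet> v)\<^sup>2 + (u2 \<bullet> v)\<^sup>2)"
    define v' where "v' = (u1 \<bullet> v) \<cdot>\<^sub>v u1 + (u2 \<bullet> v) \<cdot>\<^sub>v u2"
    have v': "v' \<in> carrier_vec n" unfolding v'_def using u1 u2 by simp
    define y where "y = v - v'"
    have y: "y \<in> carrier_vec n" unfolding y_def using v v' by simp
    have u1v': "u1 \<bullet> v' = u1 \<bullet> v" and u2v': "u2 \<bullet> v' = u2 \<bullet> v"
      unfolding v'_def using u1 u2 by (simp_all add: scalar_prod_add_distrib[of _ n] u11 u22 u12 u21)
    have u1y: "u1 \<bullet> y = 0" and u2y: "u2 \<bullet> y = 0"
      unfolding y_def using u1 u2 v v' by (simp_all add: scalar_prod_minus_distrib[of _ n] u1v' u2v')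
    have v'z: "v' \<bullet> z = (u1 \<bullet> v) * (u1 \<bullet> z) + (u2 \<bullet> v) * (u2 \<bullet> z)" if "z \<in> carrier_vec n" for z
      unfolding v'_def using u1 u2 that by (simp add: add_scalar_prod_distrib[of _ n])
    have nv': "norm2 v' = r"
      unfolding norm2_def r_def v'z[OF v'] u1v' u2v' by (simp add: power2_eq_square)
    have v_dec: "v = v' + y" unfolding y_def using v v' by (intro eq_vecI) auto
    have "(norm2 v)\<^sup>2 = (norm2 v')\<^sup>2 + 2 * (v' \<bullet> y) + (norm2 y)\<^sup>2"
      unfolding v_dec by (rule norm2_add_power2[OF v' y])
    then have "(norm2 y)\<^sup>2 \<le> (norm2 v)\<^sup>2" using v'z[OF y] by (simp add: u1y u2y)
    then have y_le: "norm2 y \<le> norm2 v" by (rule power2_le_imp_le) simp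
    have "x1 \<bullet> y = 0" "x2 \<bullet> y = 0"
      using u1 u2 y u1y u2y by (subst x1_u x2_u, simp add: add_scalar_prod_distrib[of _ n])+
    then have e1h: "e1 \<bullet> ?F y = 0" and e2h: "e2 \<bullet> ?F y = 0"
      using mat_iter_scalar_prod[OF A sym e1 y] mat_iter_scalar_prod[OF A sym e2 y]
      unfolding x1_def x2_def by simp_all
    then have "(par (?F y))\<^sup>2 = 0" by (simp add: par_power2)
    then have h: "norm2 (?F y) \<le> sqrt 2 * (\<kappa> ^ N * norm2 y)"
      by (intro norm2_iter_le[OF y]) simp
    \<comment> \<open>Undoing Gram-Schmidt writes \<open>v'\<close> as \<open>A^N\<close> of a
      vector of the plane. So \<open>v'\<close> already lies in the cone, and \<open>A^N v'\<close>
      makes another \<open>N\<close> steps inside it.\<close>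
    obtain s t where v'_F: "v' = ?F (s \<cdot>\<^sub>v e1 + t \<cdot>\<^sub>v e2)"
    proof
      define p q m1 m2 where "p = u1 \<bullet> v" and "q = u2 \<bullet> v" and "m1 = norm2 x1" and "m2 = norm2 w"
      have "u1 = (1 / m1) \<cdot>\<^sub>v x1" "u2 = (1 / m2) \<cdot>\<^sub>v ((- c / m1) \<cdot>\<^sub>v x1 + 1 \<cdot>\<^sub>v x2)"
        using u1_def u2_def w_alt by (simp_all add: m1_def m2_def)
      then have "p \<cdot>\<^sub>v u1 + q \<cdot>\<^sub>v u2 = ((p - q * c / m2) / m1) \<cdot>\<^sub>v x1 + (q / m2) \<cdot>\<^sub>v x2"
        using x n1[folded m1_def] n2[folded m2_def] by (intro eq_vecI) (auto simp: field_simps)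
      then show "v' = ?F (((p - q * c / m2) / m1) \<cdot>\<^sub>v e1 + (q / m2) \<cdot>\<^sub>v e2)"
        unfolding Fcomb x1_def[symmetric] x2_def[symmetric] v'_def p_def q_def .
    qed
    have cone: "perp v' \<le> par v'" unfolding v'_F by (rule cone_iter[OF cc]) simp
    have g_ge: "\<mu> ^ N * par v' \<le> par (?F v')" by (rule cone_par_iter[OF v' cone])
    have g_perp: "perp (?F v') \<le> \<kappa> / \<mu> * par (?F v')" by (rule cone_perp_iter[OF v' cone N])
    have r_le: "r \<le> sqrt 2 * par v'" using norm2_le_par[OF v' cone] nv' by simp
    have r_pos': "0 < r" using r_pos unfolding r_def by simp
    have z: "?F v = ?F v' + ?F y"
      by (subst v_dec) (rule mat_iter_add[OF A v' y])
    \<comment> \<open>\<open>A^N y\<close> has no component in the plane, so it cannot cancel any of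
      the plane part of \<open>A^N v'\<close>.\<close>
    have par_z: "par (?F v) = par (?F v')"
    proof -
      have "(par (?F v))\<^sup>2 = (par (?F v'))\<^sup>2"
        unfolding par_power2 z using e1 e2 Fc[OF v'] Fc[OF y]
        by (simp add: scalar_prod_add_distrib[of _ n] e1h e2h)
      then show ?thesis by (simp add: power2_eq_iff_nonneg)
    qed
    have \<xi>0: "0 \<le> \<xi>"
    proof -
      have "0 \<le> 2 * (\<kappa> / \<mu>) ^ N * norm2 v" using \<mu>_pos by simp
      then have "0 \<le> \<xi> * r" using \<xi> unfolding r_def by linarith
      then show ?thesis using r_pos' by (simp add: zero_le_mult_iff)
    qed
    \<comment> \<open>One \<open>sqrt 2\<close> comes from the growth bound for \<open>y\<close>,
      another from \<open>r \<le> sqrt 2 * par v'\<close>; together they are the 2 in the condition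
      on \<open>\<xi>\<close>.\<close>
    have "norm2 (?F y) \<le> sqrt 2 * (\<kappa> ^ N * norm2 v)"
      by (rule order_trans[OF h]) (intro mult_left_mono y_le; simp)
    also have "\<kappa> ^ N * norm2 v = \<mu> ^ N * ((\<kappa> / \<mu>) ^ N * norm2 v)"
      using \<mu>_pos by (simp add: power_divide)
    also have "sqrt 2 * (\<mu> ^ N * ((\<kappa> / \<mu>) ^ N * norm2 v)) \<le> sqrt 2 * (\<mu> ^ N * (\<xi> * r / 2))"
      using \<xi> \<mu>_pos unfolding r_def by (intro mult_left_mono) auto
    also have "\<dots> \<le> sqrt 2 * (\<mu> ^ N * (\<xi> * (sqrt 2 * par v') / 2))"
      using r_le \<mu>_pos \<xi>0 by (intro mult_left_mono divide_right_mono) auto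
    also have "\<dots> = \<xi> * (\<mu> ^ N * par v')" by simp
    also have "\<dots> \<le> \<xi> * par (?F v')" using g_ge \<xi>0 by (rule mult_left_mono)
    finally have hg: "norm2 (?F y) \<le> \<xi> * par (?F v')" .
    have "perp (?F v) \<le> perp (?F v') + perp (?F y)"
      unfolding z by (rule perp_triangle) (use Fc v' y in auto)
    also have "\<dots> \<le> \<kappa> / \<mu> * par (?F v') + \<xi> * par (?F v')"
      using g_perp hg perp_le_norm2[OF Fc[OF y]] by linarith
    also have "\<dots> = (\<kappa> / \<mu> + \<xi>) * par (?F v)" by (simp add: par_z algebra_simps)
    also have "\<dots> \<le> (\<kappa> / \<mu> + \<xi>) * norm2 (?F v)"
      using \<xi>0 \<mu>_pos by (intro mult_left_mono par_le_norm2 Fc v) auto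
    finally have 1: "perp (?F v) \<le> (\<kappa> / \<mu> + \<xi>) * norm2 (?F v)" .
    have "0 < sqrt 2 * par v'" using r_le r_pos' by linarith
    then have "0 < \<mu> ^ N * par v'" using \<mu>_pos by (simp add: zero_less_mult_iff)
    then have "0 < norm2 (?F v)" using g_ge par_z par_le_norm2[OF Fc[OF v]] by linarith
    then have "?F v \<noteq> 0\<^sub>v n" by auto
    with 1 show ?thesis by simp
  qed
  show ?thesis
    by (rule that[OF u1 u2 u11 u22 u12]) (use main in blast)
qed

end

section \<open>The Ritz step\<close>

context rank_two_perturbation begin

lemma bilinear_approx:
  assumes v: "v \<in> carrier_vec n" and w: "w \<in> carrier_vec n"
  shows "\<bar>v \<bullet> (A *\<^sub>v w) - (l1 * ((e1 \<bullet> v) * (e1 \<bullet> w)) + l2 * ((e2 \<bullet> v) * (e2 \<bullet> w)))\<bar>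
    \<le> d * (norm2 v * norm2 w)"
proof -
  let ?B = "(l1 * (e1 \<bullet> w)) \<cdot>\<^sub>v e1 + (l2 * (e2 \<bullet> w)) \<cdot>\<^sub>v e2"
  have c: "?B \<in> carrier_vec n" "A *\<^sub>v w \<in> carrier_vec n" using e1 e2 A w by auto
  have "v \<bullet> ?B = l1 * ((e1 \<bullet> v) * (e1 \<bullet> w)) + l2 * ((e2 \<bullet> v) * (e2 \<bullet> w))"
    using comm_scalar_prod[OF v c(1)] combination_scalar_prod[OF v] by simp
  moreover have "\<bar>v \<bullet> (A *\<^sub>v w - ?B)\<bar> \<le> norm2 v * (d * norm2 w)"
    using scalar_prod_le_norm2[of v n "A *\<^sub>v w - ?B"] c v
      mult_left_mono[OF perturbation[OF w] norm2_nonneg[of v]] by fastforce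
  ultimately show ?thesis
    using v c by (simp add: scalar_prod_minus_distrib[of _ n] ac_simps)
qed

text \<open>The parts inside and outside the plane are orthogonal, so the error is the inner product
  of the two outside parts. It is therefore of second order, which is why
  \<open>\<epsilon>\<^sup>2\<close> and not \<open>\<epsilon>\<close> enters \<open>\<eta>\<close>
  later.\<close>

lemma scalar_prod_approx:
  assumes v: "v \<in> carrier_vec n" and w: "w \<in> carrier_vec n"
  shows "\<bar>v \<bullet> w - ((e1 \<bullet> v) * (e1 \<bullet> w) + (e2 \<bullet> v) * (e2 \<bullet> w))\<bar> \<le> perp v * perp w"
proof -
  have c: "v - proj v \<in> carrier_vec n" "w - proj w \<in> carrier_vec n" using v w by auto
  have z: "e1 \<bullet> (v - proj v) = 0" "e2 \<bullet> (v - proj v) = 0"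
    using e1 e2 v by (simp_all add: scalar_prod_minus_distrib[of _ n] scalar_prod_combination proj_def)
  have "(v - proj v) \<bullet> proj w = 0"
    using comm_scalar_prod[OF c(1) proj_carrier[of w]] combination_scalar_prod[OF c(1)] z
    by (simp add: proj_def)
  then have "(v - proj v) \<bullet> (w - proj w) = (v - proj v) \<bullet> w"
    using c w by (simp add: scalar_prod_minus_distrib[of _ n])
  also have "\<dots> = v \<bullet> w - ((e1 \<bullet> v) * (e1 \<bullet> w) + (e2 \<bullet> v) * (e2 \<bullet> w))"
    using minus_scalar_prod_distrib[OF v proj_carrier w] combination_scalar_prod[OF w]
    by (simp add: proj_def)
  finally show ?thesis using scalar_prod_le_norm2[OF c] by (simp add: perp_def)
qed

text \<open>Write \<open>a0\<close>, \<open>a1\<close> for the components of \<open>f\<close>,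
  \<open>g\<close> along \<open>e1\<close> and \<open>b0\<close>, \<open>b1\<close> for those along
  \<open>e2\<close>. Orthogonality makes \<open>a0 * a1 + b0 * b1\<close> small and
  \<open>A\<close>-orthogonality makes \<open>l1 * (a0 * a1) + l2 * (b0 * b1)\<close> small; as
  \<open>l2 < l1\<close>, the product \<open>a0 * a1\<close> is at most \<open>\<eta>\<close> in
  absolute value. So one of the two vectors is nearly orthogonal to \<open>e1\<close>, and the order
  of the Ritz values makes it \<open>f\<close>: up to \<open>2 * \<eta>\<close>,
  \<open>a0\<^sup>2\<close> is at most \<open>a1\<^sup>2\<close>.\<close>

lemma ritz_vector_approx:
  assumes f: "f \<in> carrier_vec n" "f \<bullet> f = 1" and g: "g \<in> carrier_vec n" "g \<bullet> g = 1"
    and orth: "f \<bullet> g = 0" "f \<bullet> (A *\<^sub>v g) = 0" and le: "f \<bullet> (A *\<^sub>v f) \<le> g \<bullet> (A *\<^sub>v g)"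
    and perp: "perp f \<le> \<epsilon>" "perp g \<le> \<epsilon>"
    and gap: "l2 < l1" and \<eta>: "\<eta> = (l2 * \<epsilon>\<^sup>2 + d) / (l1 - l2)"
  shows "(e1 \<bullet> f)\<^sup>2 \<le> sqrt (\<eta>\<^sup>2 + 2 * \<eta>)"
proof -
  define a0 a1 b0 b1 where "a0 = e1 \<bullet> f" and "a1 = e1 \<bullet> g" and "b0 = e2 \<bullet> f" and "b1 = e2 \<bullet> g"
  have nf: "norm2 f = 1" and ng: "norm2 g = 1" using f g by (simp_all add: norm2_def)
  have \<eta>_mult: "\<eta> * (l1 - l2) = l2 * \<epsilon>\<^sup>2 + d" using gap by (simp add: \<eta>)
  have \<eta>0: "0 \<le> \<eta>" using l2_nonneg d_nonneg gap by (simp add: \<eta>)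
  have sf: "1 = a0\<^sup>2 + b0\<^sup>2 + (perp f)\<^sup>2" and sg: "1 = a1\<^sup>2 + b1\<^sup>2 + (perp g)\<^sup>2"
    using par_perp_power2[OF f(1)] par_perp_power2[OF g(1)]
    by (simp_all add: nf ng par_power2 a0_def a1_def b0_def b1_def)
  have pf: "(perp f)\<^sup>2 \<le> \<epsilon>\<^sup>2" using perp by (simp add: power_mono)
  have "perp f * perp g \<le> \<epsilon>\<^sup>2"
    using mult_mono[OF perp] perp order_trans[OF perp_nonneg perp(1)] by (simp add: power2_eq_square)
  then have 1: "\<bar>a0 * a1 + b0 * b1\<bar> \<le> \<epsilon>\<^sup>2"
    using scalar_prod_approx[OF f(1) g(1)] orth by (simp add: a0_def a1_def b0_def b1_def)
  have 2: "\<bar>l1 * (a0 * a1) + l2 * (b0 * b1)\<bar> \<le> d"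
    using bilinear_approx[OF f(1) g(1)] orth nf ng by (simp add: a0_def a1_def b0_def b1_def)
  have "\<bar>l2 * (a0 * a1 + b0 * b1)\<bar> \<le> l2 * \<epsilon>\<^sup>2"
    using mult_left_mono[OF 1 l2_nonneg] l2_nonneg by (simp add: abs_mult)
  then have "\<bar>(l1 - l2) * (a0 * a1)\<bar> \<le> \<eta> * (l1 - l2)"
    using 2 unfolding \<eta>_mult by (simp add: algebra_simps abs_le_iff)
  then have "\<bar>a0 * a1\<bar> \<le> \<eta>" using gap by (simp add: abs_mult mult.commute)
  then have 3: "(a0 * a1)\<^sup>2 \<le> \<eta>\<^sup>2" by (metis \<eta>0 abs_le_square_iff abs_of_nonneg)
  have "l1 * a0\<^sup>2 + l2 * b0\<^sup>2 - d \<le> f \<bullet> (A *\<^sub>v f)" "g \<bullet> (A *\<^sub>v g) \<le> l1 * a1\<^sup>2 + l2 * b1\<^sup>2 + d"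
    using bilinear_approx[OF f(1) f(1)] bilinear_approx[OF g(1) g(1)] nf ng
    by (simp_all add: a0_def a1_def b0_def b1_def power2_eq_square abs_le_iff)
  then have "l1 * a0\<^sup>2 + l2 * b0\<^sup>2 \<le> l1 * a1\<^sup>2 + l2 * b1\<^sup>2 + 2 * d" using le by linarith
  moreover have "b0\<^sup>2 = 1 - a0\<^sup>2 - (perp f)\<^sup>2" "b1\<^sup>2 = 1 - a1\<^sup>2 - (perp g)\<^sup>2" using sf sg by linarith+
  ultimately have "(l1 - l2) * (a0\<^sup>2 - a1\<^sup>2) \<le> l2 * ((perp f)\<^sup>2 - (perp g)\<^sup>2) + 2 * d"
    by (simp add: algebra_simps)
  also have "\<dots> \<le> l2 * \<epsilon>\<^sup>2 + 2 * d"
    using pf l2_nonneg by (intro add_right_mono mult_left_mono) (auto intro: order_trans[of _ "(perp f)\<^sup>2"])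
  also have "\<dots> \<le> 2 * (\<eta> * (l1 - l2))" unfolding \<eta>_mult using l2_nonneg by simp
  finally have "(l1 - l2) * (a0\<^sup>2 - a1\<^sup>2) \<le> (l1 - l2) * (2 * \<eta>)" by (simp add: ac_simps)
  then have 4: "a0\<^sup>2 - a1\<^sup>2 \<le> 2 * \<eta>" using gap by simp
  \<comment> \<open>The right side is \<open>(a0 * a1)\<^sup>2 + 2 * \<eta> * a0\<^sup>2\<close>,
    where both smallness statements apply; this is the origin of the square root in the
    bound.\<close>
  have "(a0\<^sup>2)\<^sup>2 \<le> a0\<^sup>2 * (a1\<^sup>2 + 2 * \<eta>)"
    unfolding power2_eq_square[of "a0\<^sup>2"] using 4 by (intro mult_left_mono) auto
  also have "\<dots> \<le> \<eta>\<^sup>2 + 2 * \<eta>"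
  proof -
    have "a0\<^sup>2 \<le> 1" using sf by (smt (verit) zero_le_power2)
    then have "a0\<^sup>2 * (2 * \<eta>) \<le> 2 * \<eta>" using \<eta>0 mult_right_mono[of "a0\<^sup>2" 1 "2 * \<eta>"] by simp
    then show ?thesis using 3 by (simp add: distrib_left power_mult_distrib)
  qed
  finally show ?thesis unfolding a0_def by (rule real_le_rsqrt)
qed

text \<open>\<open>(e2 \<bullet> f)\<^sup>2\<close> is what the unit vector \<open>f\<close> has
  left after its \<open>e1\<close> part and its part outside the plane. Subtracting the
  \<open>e1\<close> part keeps \<open>e2 \<bullet> f\<close> and leaves a length of at most 1, so
  normalising does not decrease the absolute cosine with \<open>e2\<close>. The conclusion is put in
  terms of the cosine because \<open>2 * n * (1 - s * (e2 \<bullet> y) / norm2 y)\<close> is the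
  squared distance of \<open>x 0\<close> from \<open>s\<close> times the labels; \<open>s\<close> is
  the sign that cannot be known.\<close>

lemma deflated_vector_approx:
  assumes f: "f \<in> carrier_vec n" "f \<bullet> f = 1" and perp: "perp f \<le> \<epsilon>"
    and small: "2 * ((e1 \<bullet> f)\<^sup>2 + \<epsilon>\<^sup>2) \<le> \<delta>" and \<delta>: "\<delta> < 2"
    and y: "y = f - (e1 \<bullet> f) \<cdot>\<^sub>v e1"
  shows "y \<in> carrier_vec n" "e1 \<bullet> y = 0" "norm2 y > 0"
    "\<exists>s\<in>{1, -1}. 1 - s * (e2 \<bullet> y) / norm2 y \<le> \<delta> / 2"
proof -
  show yc: "y \<in> carrier_vec n" unfolding y using f(1) e1 by simp
  show e1y: "e1 \<bullet> y = 0"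
    unfolding y using f(1) e1 by (simp add: scalar_prod_minus_distrib[of _ n] e11)
  have e2y: "e2 \<bullet> y = e2 \<bullet> f"
    unfolding y using f(1) e1 e2 by (simp add: scalar_prod_minus_distrib[of _ n] e21)
  have nf: "norm2 f = 1" using f by (simp add: norm2_def)
  have "(norm2 y)\<^sup>2 = 1 - (e1 \<bullet> f)\<^sup>2"
  proof -
    have "norm2 e1 = 1" using e11 by (simp add: norm2_def)
    then show ?thesis
      unfolding y norm2_diff_power2[OF f(1) smult_carrier_vec[THEN iffD2, OF e1]]
      using comm_scalar_prod[OF f(1) e1] f(1) e1 by (simp add: nf power2_eq_square)
  qed
  then have "(norm2 y)\<^sup>2 \<le> 1\<^sup>2" by simp
  then have ny1: "norm2 y \<le> 1" by (rule power2_le_imp_le) simp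
  have p: "(perp f)\<^sup>2 \<le> \<epsilon>\<^sup>2" using perp by (simp add: power_mono)
  have b: "1 - \<delta> / 2 \<le> (e2 \<bullet> f)\<^sup>2"
    using par_perp_power2[OF f(1)] small p by (simp add: nf par_power2)
  have le: "\<bar>e2 \<bullet> y\<bar> \<le> norm2 y"
    using scalar_prod_le_norm2[OF e2 yc] e22 by (simp add: norm2_def)
  have "e2 \<bullet> f \<noteq> 0" using b \<delta> by auto
  then show pos: "norm2 y > 0" using le e2y by auto
  have "1 - \<delta> / 2 \<le> \<bar>e2 \<bullet> y\<bar> * \<bar>e2 \<bullet> y\<bar>" using b by (simp add: e2y power2_eq_square abs_mult_self_eq)
  also have "\<dots> \<le> \<bar>e2 \<bullet> y\<bar> * 1" using le ny1 by (intro mult_left_mono) auto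
  also have "\<dots> \<le> \<bar>e2 \<bullet> y\<bar> / norm2 y" using pos ny1 by (simp add: le_divide_eq mult_left_le)
  finally have "1 - \<bar>e2 \<bullet> y\<bar> / norm2 y \<le> \<delta> / 2" by linarith
  moreover have "\<exists>s\<in>{1, -1}. \<bar>e2 \<bullet> y\<bar> = s * (e2 \<bullet> y)" by (cases "e2 \<bullet> y \<ge> 0") auto
  ultimately show "\<exists>s\<in>{1, -1}. 1 - s * (e2 \<bullet> y) / norm2 y \<le> \<delta> / 2" by auto
qed

end

section \<open>Projected power iterations\<close>

lemma balanced_labelsD:
  assumes "x \<in> balanced_labels n"
  shows "x \<in> carrier_vec n" "all_ones n \<bullet> x = 0" "x \<bullet> x = real n"
    "\<And>i. i < n \<Longrightarrow> x $ i = 1 \<or> x $ i = -1"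
proof -
  show *: "x \<in> carrier_vec n" "all_ones n \<bullet> x = 0" "\<And>i. i < n \<Longrightarrow> x $ i = 1 \<or> x $ i = -1"
    using assms unfolding balanced_labels_def by auto
  have "x \<bullet> x = (\<Sum>i = 0..<n. 1)"
    unfolding scalar_prod_def using *(1) *(3) by (intro sum.cong) fastforce+
  then show "x \<bullet> x = real n" by simp
qed

lemma uminus_balanced_labels:
  assumes "x \<in> balanced_labels n"
  shows "- x \<in> balanced_labels n"
  using assms unfolding balanced_labels_def by (auto simp: all_ones_def)

text \<open>All label vectors have norm \<open>sqrt n\<close>, so minimising the distance to
  \<open>c\<close> amounts to maximising the inner product with \<open>c\<close>. This covers every
  minimiser at once, however ties are broken.\<close>

lemma proj_balanced_scalar_prod:
  assumes u: "u \<in> proj_balanced n c" and x: "x \<in> balanced_labels n" and c: "c \<in> carrier_vec n"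
  shows "u \<in> balanced_labels n" "x \<bullet> c \<le> u \<bullet> c"
proof -
  show ub: "u \<in> balanced_labels n" using u by (simp add: proj_balanced_def is_arg_min_def)
  have "(norm2 (u - c))\<^sup>2 \<le> (norm2 (x - c))\<^sup>2"
    using u x unfolding proj_balanced_def is_arg_min_def by (auto simp: not_less)
  then show "x \<bullet> c \<le> u \<bullet> c"
    using balanced_labelsD[OF ub] balanced_labelsD[OF x] c
    by (simp add: norm2_diff_power2[of _ n]) (simp add: norm2_power2)
qed

text \<open>Where the labels differ, \<open>x $ i - u $ i\<close> is \<open>2 * x $ i\<close>: its
  square is 4, while its product with \<open>c $ i\<close> is at least \<open>2 * g\<close>. This is
  the origin of the factor \<open>g / 2\<close>.\<close>

lemma balanced_labels_margin:
  assumes x: "x \<in> balanced_labels n" and u: "u \<in> balanced_labels n" and c: "c \<in> carrier_vec n"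
    and margin: "\<And>i. i < n \<Longrightarrow> g \<le> x $ i * c $ i"
  shows "g / 2 * (norm2 (x - u))\<^sup>2 \<le> (x - u) \<bullet> c"
proof -
  have "g / 2 * (norm2 (x - u))\<^sup>2 = (\<Sum>i = 0..<n. g / 2 * ((x $ i - u $ i) * (x $ i - u $ i)))"
    using balanced_labelsD(1)[OF x] balanced_labelsD(1)[OF u]
    unfolding norm2_power2 scalar_prod_def sum_distrib_left by (intro sum.cong) auto
  also have "\<dots> \<le> (\<Sum>i = 0..<n. (x $ i - u $ i) * c $ i)"
  proof (intro sum_mono)
    fix i assume "i \<in> {0..<n}"
    then show "g / 2 * ((x $ i - u $ i) * (x $ i - u $ i)) \<le> (x $ i - u $ i) * c $ i"
      using balanced_labelsD(4)[OF x, of i] balanced_labelsD(4)[OF u, of i] margin[of i] by auto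
  qed
  also have "\<dots> = (x - u) \<bullet> c"
    using balanced_labelsD(1)[OF x] balanced_labelsD(1)[OF u] c by (simp add: scalar_prod_def)
  finally show ?thesis .
qed

lemma balanced_labels_eqI:
  assumes x: "x \<in> balanced_labels n" and u: "u \<in> balanced_labels n" and less: "norm2 (u - x) < 2"
  shows "u = x"
proof (rule eq_vecI)
  show "dim_vec u = dim_vec x" using balanced_labelsD(1)[OF x] balanced_labelsD(1)[OF u] by simp
  fix i assume "i < dim_vec x"
  then have i: "i < n" using balanced_labelsD(1)[OF x] by simp
  have "\<bar>u $ i - x $ i\<bar> \<le> norm2 (u - x)"
    unfolding norm2_L2_set
    using member_le_L2_set[of "{..<n}" i "\<lambda>i. \<bar>(u - x) $ i\<bar>"] i balanced_labelsD(1)[OF x] balanced_labelsD(1)[OF u]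
    by (simp add: L2_set_def)
  then show "u $ i = x $ i"
    using less balanced_labelsD(4)[OF x i] balanced_labelsD(4)[OF u i] by auto
qed

text \<open>Orthogonality to the all-ones vector removes the \<open>e1\<close> term, leaving one
  leading direction. The locale is used with the labels of either sign for \<open>xs\<close>. The
  squared distance budget is \<open>\<delta> * n\<close>, and \<open>gap\<close> says that the
  second-order loss \<open>l2 * \<delta> / 4\<close> it allows stays below half of the
  margin.\<close>

locale ppm_setting =
  fixes n :: nat and A :: "real mat" and xs :: "real vec" and l2 d g \<delta> \<theta> :: real
  assumes n_pos: "0 < n" and A: "A \<in> carrier_mat n n" and xs: "xs \<in> balanced_labels n"
    and perturbation: "\<And>v. v \<in> carrier_vec n \<Longrightarrow> all_ones n \<bullet> v = 0 \<Longrightarrow>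
      norm2 (A *\<^sub>v v - (l2 * (xs \<bullet> v) / n) \<cdot>\<^sub>v xs) \<le> d * norm2 v"
    and margin: "\<And>i. i < n \<Longrightarrow> g \<le> xs $ i * (A *\<^sub>v xs) $ i"
    and l2_nonneg: "0 \<le> l2" and gap: "l2 * \<delta> / 4 < g / 2"
    and \<theta>: "0 \<le> \<theta>" "\<theta> < 1" "d \<le> \<theta> * (g / 2 - l2 * \<delta> / 4)"
begin

text \<open>With \<open>e = v - xs\<close> and \<open>w = xs - u\<close>, expanding
  \<open>A v\<close> around \<open>A xs\<close> in the minimality inequality leaves three terms. The
  margins contribute at least \<open>g / 2 * (norm2 w)\<^sup>2\<close>, the error at least
  \<open>- (d * norm2 w * norm2 e)\<close>. The leading direction does little harm since equal
  lengths make both of its inner products quadratic (\<open>xe\<close>, \<open>wx\<close>), so that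
  it costs at most \<open>l2 * \<delta> / 4 * (norm2 w)\<^sup>2\<close>. Dividing by
  \<open>norm2 w\<close> gives the contraction.\<close>

lemma ppm_contraction:
  assumes v: "v \<in> carrier_vec n" "all_ones n \<bullet> v = 0" "v \<bullet> v = real n"
    and near: "(norm2 (v - xs))\<^sup>2 \<le> \<delta> * n" and u: "u \<in> proj_balanced n (A *\<^sub>v v)"
  shows "norm2 (u - xs) \<le> \<theta> * norm2 (v - xs)"
proof -
  note xsD = balanced_labelsD[OF xs]
  define e where "e = v - xs"
  have e: "e \<in> carrier_vec n" unfolding e_def using v xsD by simp
  have Ac: "A *\<^sub>v w \<in> carrier_vec n" if "w \<in> carrier_vec n" for w using A that by simp
  note ub = proj_balanced_scalar_prod[OF u xs Ac[OF v(1)]]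
  note uD = balanced_labelsD[OF ub(1)]
  define w where "w = xs - u"
  have w: "w \<in> carrier_vec n" unfolding w_def using xsD uD by simp
  define E where "E = A *\<^sub>v e - (l2 * (xs \<bullet> e) / n) \<cdot>\<^sub>v xs"
  have E: "E \<in> carrier_vec n" unfolding E_def using Ac[OF e] xsD by simp
  have "all_ones n \<in> carrier_vec n" by (simp add: all_ones_def)
  then have "all_ones n \<bullet> e = 0" unfolding e_def using v xsD by (simp add: scalar_prod_minus_distrib[of _ n])
  then have E_le: "norm2 E \<le> d * norm2 e" unfolding E_def by (rule perturbation[OF e])
  have xe: "xs \<bullet> e = - (norm2 e)\<^sup>2 / 2"
    using v xsD norm2_diff_power2[OF v(1) xsD(1)] comm_scalar_prod[OF v(1) xsD(1)]
    by (simp add: e_def scalar_prod_minus_distrib[of _ n]) (simp add: norm2_power2)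
  have wx: "w \<bullet> xs = (norm2 w)\<^sup>2 / 2"
    using uD xsD norm2_diff_power2[OF xsD(1) uD(1)] comm_scalar_prod[OF uD(1) xsD(1)]
    by (simp add: w_def minus_scalar_prod_distrib[of _ n]) (simp add: norm2_power2)
  have dec: "A *\<^sub>v v = A *\<^sub>v xs + ((l2 * (xs \<bullet> e) / n) \<cdot>\<^sub>v xs + E)"
  proof -
    have "v = xs + e" unfolding e_def using v xsD by (intro eq_vecI) auto
    then have "A *\<^sub>v v = A *\<^sub>v xs + A *\<^sub>v e" using A xsD e by (simp add: mult_add_distrib_mat_vec)
    also have "A *\<^sub>v e = (l2 * (xs \<bullet> e) / n) \<cdot>\<^sub>v xs + E"
      unfolding E_def using Ac[OF e] A xsD(1) by (intro eq_vecI) auto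
    finally show ?thesis .
  qed
  have "w \<bullet> (A *\<^sub>v v) \<le> 0"
    unfolding w_def using ub(2) uD xsD Ac[OF v(1)] by (simp add: minus_scalar_prod_distrib[of _ n])
  moreover have "w \<bullet> (A *\<^sub>v v) = w \<bullet> (A *\<^sub>v xs) + (l2 * (xs \<bullet> e) / n) * (w \<bullet> xs) + w \<bullet> E"
    unfolding dec using w xsD E Ac[OF xsD(1)] by (simp add: scalar_prod_add_distrib[of _ n])
  moreover have "g / 2 * (norm2 w)\<^sup>2 \<le> w \<bullet> (A *\<^sub>v xs)"
    unfolding w_def by (rule balanced_labels_margin[OF xs ub(1) Ac[OF xsD(1)] margin])
  moreover have "- (norm2 w * (d * norm2 e)) \<le> w \<bullet> E"
    using scalar_prod_le_norm2[OF w E] mult_left_mono[OF E_le norm2_nonneg[of w]] by linarith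
  moreover have "- (l2 * \<delta> / 4 * (norm2 w)\<^sup>2) \<le> (l2 * (xs \<bullet> e) / n) * (w \<bullet> xs)"
  proof -
    have "(norm2 e)\<^sup>2 / n \<le> \<delta>" using near n_pos unfolding e_def by (simp add: field_simps)
    then have "l2 * ((norm2 e)\<^sup>2 / n) * (norm2 w)\<^sup>2 \<le> l2 * \<delta> * (norm2 w)\<^sup>2"
      using l2_nonneg by (intro mult_right_mono mult_left_mono) auto
    then show ?thesis unfolding xe wx by simp
  qed
  ultimately have "(g / 2 - l2 * \<delta> / 4) * (norm2 w)\<^sup>2 \<le> norm2 w * (d * norm2 e)"
    by (simp add: algebra_simps)
  also have "\<dots> \<le> norm2 w * (\<theta> * (g / 2 - l2 * \<delta> / 4) * norm2 e)"
    using \<theta> by (intro mult_left_mono mult_right_mono) auto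
  finally have "(g / 2 - l2 * \<delta> / 4) * (norm2 w * norm2 w) \<le> (g / 2 - l2 * \<delta> / 4) * (norm2 w * (\<theta> * norm2 e))"
    by (simp add: power2_eq_square ac_simps)
  then have "norm2 w * norm2 w \<le> norm2 w * (\<theta> * norm2 e)" using gap by simp
  then have "norm2 w \<le> \<theta> * norm2 e"
    using \<theta> norm2_nonneg[of w] norm2_nonneg[of e] by (cases "norm2 w = 0") (auto simp: mult_le_cancel_left)
  then show ?thesis
    unfolding w_def e_def using norm2_minus_commute[OF xsD(1) uD(1)] by simp
qed

text \<open>Contraction by \<open>\<theta>\<close> brings the iterate below distance 2, hence onto
  \<open>xs\<close>, after \<open>M\<close> steps, and step \<open>M + 1\<close> repeats it. The run
  may also stop earlier; but at a repeat the distance to \<open>xs\<close> is at most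
  \<open>\<theta> < 1\<close> times itself, so it is 0 and the output is right.\<close>

lemma ppm_terminates:
  assumes x0: "x 0 \<in> carrier_vec n" "all_ones n \<bullet> x 0 = 0" "x 0 \<bullet> x 0 = real n"
    and near: "(norm2 (x 0 - xs))\<^sup>2 \<le> \<delta> * n"
    and step: "\<And>k. 1 \<le> k \<Longrightarrow> x k \<in> proj_balanced n (A *\<^sub>v x (k - 1))"
    and M: "1 \<le> M" "\<theta> ^ M * sqrt (\<delta> * n) < 2"
  shows "\<exists>k\<le>M + 1. halts_at x k \<and> x k = xs"
proof -
  have xk: "x k \<in> carrier_vec n \<and> all_ones n \<bullet> x k = 0 \<and> x k \<bullet> x k = real n"
    and bal: "1 \<le> k \<Longrightarrow> x k \<in> balanced_labels n" for k
  proof -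
    show b: "x k \<in> balanced_labels n" if "1 \<le> k" for k
      using step[OF that] by (simp add: proj_balanced_def is_arg_min_def)
    show "x k \<in> carrier_vec n \<and> all_ones n \<bullet> x k = 0 \<and> x k \<bullet> x k = real n"
      using b[of k] x0 balanced_labelsD[of "x k" n] by (cases "k = 0") auto
  qed
  \<comment> \<open>The middle conjunct carries the distance budget along: the contraction is
    available only within it.\<close>
  have contr: "norm2 (x (Suc k) - xs) \<le> \<theta> * norm2 (x k - xs) \<and> (norm2 (x k - xs))\<^sup>2 \<le> \<delta> * n
    \<and> norm2 (x k - xs) \<le> \<theta> ^ k * norm2 (x 0 - xs)" for k
  proof (induction k)
    case 0
    show ?case using ppm_contraction[OF x0 near] step[of 1] near by simp
  next
    case (Suc k)
    have "norm2 (x (Suc k) - xs) \<le> 1 * norm2 (x k - xs)"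
      using Suc \<theta> by (intro order_trans[OF conjunct1[OF Suc]] mult_right_mono) auto
    then have n: "(norm2 (x (Suc k) - xs))\<^sup>2 \<le> \<delta> * n"
      using conjunct1[OF conjunct2[OF Suc]] power_mono[of "norm2 (x (Suc k) - xs)" "norm2 (x k - xs)" 2] norm2_nonneg[of "x (Suc k) - xs"]
      by linarith
    moreover have "norm2 (x (Suc k) - xs) \<le> \<theta> * (\<theta> ^ k * norm2 (x 0 - xs))"
      using Suc \<theta>(1) by (intro order_trans[OF conjunct1[OF Suc]] mult_left_mono) auto
    ultimately show ?case
      using ppm_contraction[OF _ _ _ n, of "x (Suc (Suc k))"] xk[of "Suc k"] step[of "Suc (Suc k)"] by simp
  qed
  have hit: "x k = xs" if "M \<le> k" for k
  proof (rule balanced_labels_eqI[OF xs bal])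
    have "norm2 (x 0 - xs) \<le> sqrt (\<delta> * n)" using near by (rule real_le_rsqrt)
    then have "\<theta> ^ k * norm2 (x 0 - xs) \<le> \<theta> ^ k * sqrt (\<delta> * n)"
      using \<theta>(1) by (intro mult_left_mono) auto
    then have "norm2 (x k - xs) \<le> \<theta> ^ k * sqrt (\<delta> * n)"
      using contr[of k] by linarith
    also have "\<dots> \<le> \<theta> ^ M * sqrt (\<delta> * n)"
      using \<theta> that near order_trans[OF zero_le_power2 near]
      by (intro mult_right_mono power_decreasing) auto
    finally show "norm2 (x k - xs) < 2" using M by simp
  qed (use that M in simp)
  define k where "k = (LEAST k. 1 \<le> k \<and> x k = x (k - 1))"
  have ex: "1 \<le> M + 1 \<and> x (M + 1) = x (M + 1 - 1)" using hit[of M] hit[of "M + 1"] by simp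
  have k: "1 \<le> k \<and> x k = x (k - 1)" unfolding k_def by (rule LeastI[where P = "\<lambda>k. 1 \<le> k \<and> x k = x (k - 1)", OF ex])
  have "k \<le> M + 1" unfolding k_def by (rule Least_le[where P = "\<lambda>k. 1 \<le> k \<and> x k = x (k - 1)", OF ex])
  moreover have "halts_at x k"
  proof -
    have "x j \<noteq> x (j - 1)" if "j \<in> {1..<k}" for j
      using not_less_Least[of j "\<lambda>k. 1 \<le> k \<and> x k = x (k - 1)", folded k_def] that by auto
    then show ?thesis unfolding halts_at_def using k by blast
  qed
  moreover have "norm2 (x k - xs) \<le> \<theta> * norm2 (x k - xs)"
  proof -
    have "Suc (k - 1) = k" using k by simp
    then show ?thesis using conjunct1[OF contr[of "k - 1"]] conjunct2[OF k] by metis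
  qed
  then have "norm2 (x k - xs) = 0"
  proof -
    assume "norm2 (x k - xs) \<le> \<theta> * norm2 (x k - xs)"
    then have "(1 - \<theta>) * norm2 (x k - xs) \<le> 0" by (simp add: algebra_simps)
    then show ?thesis
      using \<theta>(2) norm2_nonneg[of "x k - xs"] by (simp add: mult_le_0_iff)
  qed
  then have "x k = xs" by (intro balanced_labels_eqI[OF xs bal[OF conjunct1[OF k]]]) simp
  ultimately show ?thesis by auto
qed

end

section \<open>Two-column linear algebra\<close>

lemma mat2_eqI:
  assumes "A \<in> carrier_mat 2 2" "B \<in> carrier_mat 2 2"
    and "A $$ (0, 0) = B $$ (0, 0)" "A $$ (0, Suc 0) = B $$ (0, Suc 0)"
    and "A $$ (Suc 0, 0) = B $$ (Suc 0, 0)" "A $$ (Suc 0, Suc 0) = B $$ (Suc 0, Suc 0)"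
  shows "A = B"
  using assms by (intro eq_matI) (auto simp: less_2_cases_iff)

lemma mat2_mult_index:
  fixes A B :: "real mat"
  assumes "A \<in> carrier_mat 2 2" "B \<in> carrier_mat 2 2" "i < 2" "j < 2"
  shows "(A * B) $$ (i, j) = A $$ (i, 0) * B $$ (0, j) + A $$ (i, Suc 0) * B $$ (Suc 0, j)"
  using assms by (simp add: scalar_prod_def numeral_2_eq_2)

lemma mat2_mult_entries:
  fixes A B :: "real mat"
  assumes "A \<in> carrier_mat 2 2" "B \<in> carrier_mat 2 2"
  shows "(A * B) $$ (0, 0) = A $$ (0, 0) * B $$ (0, 0) + A $$ (0, Suc 0) * B $$ (Suc 0, 0)"
    "(A * B) $$ (0, Suc 0) = A $$ (0, 0) * B $$ (0, Suc 0) + A $$ (0, Suc 0) * B $$ (Suc 0, Suc 0)"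
    "(A * B) $$ (Suc 0, 0) = A $$ (Suc 0, 0) * B $$ (0, 0) + A $$ (Suc 0, Suc 0) * B $$ (Suc 0, 0)"
    "(A * B) $$ (Suc 0, Suc 0) =
      A $$ (Suc 0, 0) * B $$ (0, Suc 0) + A $$ (Suc 0, Suc 0) * B $$ (Suc 0, Suc 0)"
  by (simp_all add: mat2_mult_index[OF assms])

lemma mult_mat_zero_vec:
  fixes B :: "real mat"
  assumes "B \<in> carrier_mat m k"
  shows "B *\<^sub>v 0\<^sub>v k = 0\<^sub>v m"
  using assms by (intro eq_vecI) auto

definition rot_mat :: "real \<Rightarrow> real \<Rightarrow> real mat" where
  "rot_mat c s = mat 2 2 (\<lambda>(i, j). if j = 0 then (if i = 0 then c else s) else (if i = 0 then - s else c))"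

definition diag2 :: "real \<Rightarrow> real \<Rightarrow> real mat" where
  "diag2 a b = mat 2 2 (\<lambda>(i, j). if i = j then (if i = 0 then a else b) else 0)"

lemma rot_mat_carrier [simp]: "rot_mat c s \<in> carrier_mat 2 2"
  and diag2_carrier [simp]: "diag2 a b \<in> carrier_mat 2 2"
  by (simp_all add: rot_mat_def diag2_def)

lemma diag2_diagonal: "diagonal_mat (diag2 a b)"
  by (auto simp: diagonal_mat_def diag2_def)

lemma diag2_transpose: "(diag2 a b)\<^sup>T = diag2 a b"
  by (rule mat2_eqI) (auto simp: diag2_def)

lemma diag2_mult: "diag2 a b * diag2 a' b' = diag2 (a * a') (b * b')"
  by (rule mat2_eqI, simp_all add: mat2_mult_index[OF diag2_carrier diag2_carrier]
      mult_carrier_mat[OF diag2_carrier diag2_carrier]) (simp_all add: diag2_def)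

text \<open>Jacobi rotation: if \<open>t\<close> is the argument of the complex number with real
  part \<open>(p - r) / 2\<close> and imaginary part \<open>q\<close>, rotation by
  \<open>t / 2\<close> annihilates the off-diagonal entry. If the eigenvalues come in the wrong
  order of absolute value, a further quarter turn swaps them.\<close>

lemma sym_mat2_diag:
  assumes M: "M \<in> carrier_mat 2 2" "M\<^sup>T = M"
  obtains H a b where "H \<in> carrier_mat 2 2" "H\<^sup>T * H = 1\<^sub>m 2" "M = H * diag2 a b * H\<^sup>T" "\<bar>b\<bar> \<le> \<bar>a\<bar>"
proof -
  define p q r where "p = M $$ (0, 0)" and "q = M $$ (0, Suc 0)" and "r = M $$ (Suc 0, Suc 0)"
  have q': "M $$ (Suc 0, 0) = q"
    using M index_transpose_mat(1)[of 0 M 1] unfolding q_def by auto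
  have dec: "(rot_mat c s)\<^sup>T * rot_mat c s = 1\<^sub>m 2"
    "M = rot_mat c s * diag2 (p * c\<^sup>2 + 2 * q * c * s + r * s\<^sup>2) (p * s\<^sup>2 - 2 * q * c * s + r * c\<^sup>2) * (rot_mat c s)\<^sup>T"
    if cs: "c\<^sup>2 + s\<^sup>2 = 1" "q * (c\<^sup>2 - s\<^sup>2) = (p - r) * s * c" for c s
  proof -
    let ?D = "diag2 (p * c\<^sup>2 + 2 * q * c * s + r * s\<^sup>2) (p * s\<^sup>2 - 2 * q * c * s + r * c\<^sup>2)"
    have cR: "rot_mat c s \<in> carrier_mat 2 2" "(rot_mat c s)\<^sup>T \<in> carrier_mat 2 2" by simp_all
    note cRD = mult_carrier_mat[OF cR(1) diag2_carrier]
    have R: "rot_mat c s $$ (0,0) = c" "rot_mat c s $$ (0,Suc 0) = -s" "rot_mat c s $$ (Suc 0,0) = s" "rot_mat c s $$ (Suc 0,Suc 0) = c"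
      by (simp_all add: rot_mat_def)
    have RT: "(rot_mat c s)\<^sup>T $$ (0,0) = c" "(rot_mat c s)\<^sup>T $$ (0,Suc 0) = s" "(rot_mat c s)\<^sup>T $$ (Suc 0,0) = -s"
      "(rot_mat c s)\<^sup>T $$ (Suc 0,Suc 0) = c"
      by (simp_all add: rot_mat_def)
    have D: "diag2 x y $$ (0,0) = x" "diag2 x y $$ (0,Suc 0) = 0" "diag2 x y $$ (Suc 0,0) = 0" "diag2 x y $$ (Suc 0,Suc 0) = y" for x y
      by (simp_all add: diag2_def)
    show "(rot_mat c s)\<^sup>T * rot_mat c s = 1\<^sub>m 2"
      using cs(1) mult_carrier_mat[OF cR(2,1)]
      by (intro mat2_eqI) (simp_all add: mat2_mult_index[OF cR(2,1)] R RT power2_eq_square algebra_simps)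
    define D0 D1 where "D0 = p * c\<^sup>2 + 2 * q * c * s + r * s\<^sup>2" and "D1 = p * s\<^sup>2 - 2 * q * c * s + r * c\<^sup>2"
    \<comment> \<open>\<open>z\<close> measures the failure of the condition on the angle. With
      \<open>z\<close> kept as a symbol the four entries are polynomial identities in
      \<open>c\<close> and \<open>s\<close>; only afterwards are \<open>z = 0\<close> and
      \<open>c\<^sup>2 + s\<^sup>2 = 1\<close> inserted.\<close>
    define z where "z = q * (c\<^sup>2 - s\<^sup>2) - (p - r) * s * c"
    have z: "z = 0" using cs(2) by (simp add: z_def)
    have eqs: "c * D0 * c + s * D1 * s = p * (c\<^sup>2 + s\<^sup>2)\<^sup>2 + 2 * c * s * z"
      "c * D0 * s - s * D1 * c = q * (c\<^sup>2 + s\<^sup>2)\<^sup>2 - (c\<^sup>2 - s\<^sup>2) * z"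
      "s * D0 * c - c * D1 * s = q * (c\<^sup>2 + s\<^sup>2)\<^sup>2 - (c\<^sup>2 - s\<^sup>2) * z"
      "s * D0 * s + c * D1 * c = r * (c\<^sup>2 + s\<^sup>2)\<^sup>2 - 2 * c * s * z"
      unfolding D0_def D1_def z_def by (simp_all add: power2_eq_square algebra_simps)
    note eqs' = eqs[unfolded z cs(1), simplified]
    have "M = rot_mat c s * diag2 D0 D1 * (rot_mat c s)\<^sup>T"
      using eqs'
      by (intro mat2_eqI[OF M(1) mult_carrier_mat[OF cRD cR(2)]])
        (simp_all add: mat2_mult_entries[OF cRD cR(2)] mat2_mult_entries[OF cR(1) diag2_carrier] R RT D
          p_def[symmetric] q_def[symmetric] r_def[symmetric] q'[simplified] q_def[symmetric, simplified]
          r_def[symmetric, simplified] del: index_mult_mat index_transpose_mat)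
    then show "M = rot_mat c s * ?D * (rot_mat c s)\<^sup>T" unfolding D0_def D1_def .
  qed
  obtain t where t: "(p - r) / 2 = cmod (Complex ((p - r) / 2) q) * cos t" "q = cmod (Complex ((p - r) / 2) q) * sin t"
    using rcis_cmod_Arg[of "Complex ((p - r) / 2) q"] by (metis Re_rcis Im_rcis complex.sel)
  define c s where "c = cos (t / 2)" and "s = sin (t / 2)"
  have cs1: "c\<^sup>2 + s\<^sup>2 = 1" by (simp add: c_def s_def)
  have "cos t = c\<^sup>2 - s\<^sup>2" "sin t = 2 * s * c"
    using cos_double[of "t / 2"] sin_double[of "t / 2"] by (simp_all add: c_def s_def)
  moreover obtain m where "(p - r) / 2 = m * cos t" "q = m * sin t" using t by blast
  then have "q * cos t = (p - r) / 2 * sin t" by simp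
  ultimately have cs2: "q * (c\<^sup>2 - s\<^sup>2) = (p - r) * s * c" by simp
  show ?thesis
  proof (cases "\<bar>p * s\<^sup>2 - 2 * q * c * s + r * c\<^sup>2\<bar> \<le> \<bar>p * c\<^sup>2 + 2 * q * c * s + r * s\<^sup>2\<bar>")
    case True
    show ?thesis by (rule that[OF rot_mat_carrier dec[OF cs1 cs2] True])
  next
    case False
    \<comment> \<open>The pair \<open>(- s, c)\<close> is the quarter turn of \<open>(c, s)\<close>;
      it meets the same two conditions and exchanges the diagonal entries.\<close>
    have "(- s)\<^sup>2 + c\<^sup>2 = 1" using cs1 by simp
    moreover have "q * ((- s)\<^sup>2 - c\<^sup>2) = (p - r) * c * (- s)" using cs2 by (simp add: algebra_simps)
    moreover have "p * (- s)\<^sup>2 + 2 * q * (- s) * c + r * c\<^sup>2 = p * s\<^sup>2 - 2 * q * c * s + r * c\<^sup>2"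
      "p * c\<^sup>2 - 2 * q * (- s) * c + r * (- s)\<^sup>2 = p * c\<^sup>2 + 2 * q * c * s + r * s\<^sup>2"
      by simp_all
    ultimately show ?thesis using False that[OF rot_mat_carrier dec[of "- s" c]]
      by (simp add: mult.assoc mult.commute[of c s])
  qed
qed

lemma mat2_orthogonal_swap:
  fixes H :: "real mat"
  assumes "H \<in> carrier_mat 2 2" "H\<^sup>T * H = 1\<^sub>m 2"
  shows "H * H\<^sup>T = 1\<^sub>m 2"
  using mat_mult_left_right_inverse[of "H\<^sup>T" 2 H] assms by simp

lemma diag2_quadratic:
  assumes "u \<in> carrier_vec 2"
  shows "u \<bullet> (diag2 a b *\<^sub>v u) = a * (u $ 0)\<^sup>2 + b * (u $ 1)\<^sup>2"
  using assms by (simp add: scalar_prod_def numeral_2_eq_2 diag2_def power2_eq_square)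

text \<open>With \<open>M = H D H^T\<close> the inverse square root is
  \<open>H D^(-1/2) H^T\<close>; testing \<open>M\<close> on the columns of \<open>H\<close> shows
  the eigenvalues to be positive. It provides stage 1 with a starting matrix.\<close>

lemma inv_sqrt_exists:
  assumes M: "M \<in> carrier_mat 2 2" "M\<^sup>T = M"
    and pos: "\<And>v. v \<in> carrier_vec 2 \<Longrightarrow> v \<noteq> 0\<^sub>v 2 \<Longrightarrow> 0 < v \<bullet> (M *\<^sub>v v)"
  shows "\<exists>W. is_inv_sqrt M W"
proof -
  obtain H a b where H: "H \<in> carrier_mat 2 2" "H\<^sup>T * H = 1\<^sub>m 2" and MH: "M = H * diag2 a b * H\<^sup>T"
    using sym_mat2_diag[OF M] by metis
  note HH = mat2_orthogonal_swap[OF H]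
  have HT: "H\<^sup>T \<in> carrier_mat 2 2" using H by simp
  have quad: "v \<bullet> ((H * diag2 s t * H\<^sup>T) *\<^sub>v v) = s * ((H\<^sup>T *\<^sub>v v) $ 0)\<^sup>2 + t * ((H\<^sup>T *\<^sub>v v) $ 1)\<^sup>2"
    if v: "v \<in> carrier_vec 2" for v s t
  proof -
    let ?u = "H\<^sup>T *\<^sub>v v"
    have u: "?u \<in> carrier_vec 2" using HT v by simp
    have "(H * diag2 s t * H\<^sup>T) *\<^sub>v v = H *\<^sub>v (diag2 s t *\<^sub>v ?u)"
      using H HT v u by (simp add: assoc_mult_mat_vec[of _ 2 2 _ 2])
    moreover have "v \<bullet> (H *\<^sub>v (diag2 s t *\<^sub>v ?u)) = ?u \<bullet> (diag2 s t *\<^sub>v ?u)"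
      using transpose_vec_mult_scalar[OF H(1) mult_mat_vec_carrier[OF diag2_carrier u, of s t] v]
        comm_scalar_prod[of v 2] H v u by simp
    ultimately show ?thesis using diag2_quadratic[OF u] by simp
  qed
  have "0 < a" "0 < b"
  proof -
    have "0 < (if j = 0 then a else b)" if j: "j < 2" for j :: nat
    proof -
      have uc: "unit_vec 2 j \<in> carrier_vec 2" by simp
      let ?v = "H *\<^sub>v unit_vec 2 j"
      have v: "?v \<in> carrier_vec 2" using H by simp
      have Hv: "H\<^sup>T *\<^sub>v ?v = unit_vec 2 j"
        using assoc_mult_mat_vec[OF HT H(1) uc] H(2) by simp
      have "?v \<noteq> 0\<^sub>v 2"
      proof
        assume "?v = 0\<^sub>v 2"
        then have "unit_vec 2 j = (0\<^sub>v 2 :: real vec)" using Hv mult_mat_zero_vec[OF HT] by simp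
        then show False using j by (auto dest!: arg_cong[of _ _ "\<lambda>v. v $ j"])
      qed
      then have "0 < ?v \<bullet> (M *\<^sub>v ?v)" by (rule pos[OF v])
      then show ?thesis
        unfolding MH quad[OF v] Hv using j by (auto simp: less_2_cases_iff)
    qed
    from this[of 0] this[of 1] show "0 < a" "0 < b" by simp_all
  qed
  define K where "K = diag2 (1 / sqrt a) (1 / sqrt b)"
  have K: "K \<in> carrier_mat 2 2" unfolding K_def by simp
  define W where "W = H * K * H\<^sup>T"
  have W: "W \<in> carrier_mat 2 2" unfolding W_def using H K by simp
  have WT: "W\<^sup>T = W"
    using transpose_mult[OF mult_carrier_mat[OF H(1) K] HT] transpose_mult[OF H(1) K] H K HT
    unfolding W_def by (simp add: K_def diag2_transpose assoc_mult_mat[of _ 2 2 _ 2 _ 2])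
  have Wpos: "0 < v \<bullet> (W *\<^sub>v v)" if v: "v \<in> carrier_vec 2" "v \<noteq> 0\<^sub>v 2" for v
  proof -
    let ?u = "H\<^sup>T *\<^sub>v v"
    have u: "?u \<in> carrier_vec 2" using HT v by simp
    have Hu: "H *\<^sub>v ?u = v" using assoc_mult_mat_vec[OF H(1) HT v(1)] HH v by simp
    have "?u $ 0 \<noteq> 0 \<or> ?u $ 1 \<noteq> 0"
    proof (rule ccontr)
      assume "\<not> ?thesis"
      then have "?u = 0\<^sub>v 2" using u H(1) by (intro eq_vecI) (auto simp: less_2_cases_iff)
      then show False using Hu v mult_mat_zero_vec[OF H(1)] by simp
    qed
    then have "0 < 1 / sqrt a * (?u $ 0)\<^sup>2 + 1 / sqrt b * (?u $ 1)\<^sup>2"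
    proof
      assume "?u $ 0 \<noteq> 0"
      then show ?thesis using \<open>0 < a\<close> \<open>0 < b\<close> by (intro add_pos_nonneg) simp_all
    next
      assume "?u $ 1 \<noteq> 0"
      then show ?thesis using \<open>0 < a\<close> \<open>0 < b\<close> by (intro add_nonneg_pos) simp_all
    qed
    then show ?thesis unfolding W_def K_def quad[OF v(1)] .
  qed
  have KK: "K * K * diag2 a b = 1\<^sub>m 2"
  proof -
    have "K * K * diag2 a b = diag2 1 1"
      unfolding K_def diag2_mult using \<open>0 < a\<close> \<open>0 < b\<close> by simp
    also have "\<dots> = 1\<^sub>m 2" by (rule mat2_eqI) (auto simp: diag2_def)
    finally show ?thesis .
  qed
  have cancel: "H\<^sup>T * (H * X) = X" if X: "X \<in> carrier_mat 2 2" for X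
    using assoc_mult_mat[OF HT H(1) X] H(2) X by simp
  let ?D = "diag2 a b"
  have c: "?D * H\<^sup>T \<in> carrier_mat 2 2" "K * (?D * H\<^sup>T) \<in> carrier_mat 2 2" "K * K \<in> carrier_mat 2 2"
    by (intro mult_carrier_mat[of _ 2 2] K HT diag2_carrier)+
  have WX: "W * (H * X) = H * (K * X)" if X: "X \<in> carrier_mat 2 2" for X
  proof -
    have HX: "H * X \<in> carrier_mat 2 2" using H(1) X by simp
    have "W * (H * X) = (H * K) * (H\<^sup>T * (H * X))"
      unfolding W_def by (rule assoc_mult_mat[OF mult_carrier_mat[OF H(1) K] HT HX])
    then show ?thesis unfolding cancel[OF X] using assoc_mult_mat[OF H(1) K X] by simp
  qed
  have "W * W * M = W * (W * (H * (?D * H\<^sup>T)))"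
    unfolding assoc_mult_mat[OF W W M(1)] by (simp only: MH assoc_mult_mat[OF H(1) diag2_carrier HT])
  also have "\<dots> = H * (K * (K * (?D * H\<^sup>T)))" unfolding WX[OF c(1)] by (rule WX[OF c(2)])
  also have "K * (K * (?D * H\<^sup>T)) = K * K * ?D * H\<^sup>T"
    using assoc_mult_mat[OF K K c(1)] assoc_mult_mat[OF c(3) diag2_carrier HT, of a b] by simp
  also have "H * (K * K * ?D * H\<^sup>T) = 1\<^sub>m 2" unfolding KK using HT HH by simp
  finally have "inverts_mat (W * W) M" unfolding inverts_mat_def using W by simp
  then have "is_inv_sqrt M W" unfolding is_inv_sqrt_def using M W WT Wpos by auto
  then show ?thesis by blast
qed

section \<open>Thin QR factors and the range of the orthogonal iterates\<close>

lemma mat_cols2_mult_vec: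
  fixes B :: "real mat"
  assumes "B \<in> carrier_mat n 2" "v \<in> carrier_vec 2"
  shows "B *\<^sub>v v = v $ 0 \<cdot>\<^sub>v col B 0 + v $ 1 \<cdot>\<^sub>v col B 1"
  using assms by (intro eq_vecI) (auto simp: scalar_prod_def numeral_2_eq_2)

text \<open>Gram-Schmidt on the two columns. By injectivity no nontrivial combination of them
  vanishes, so neither normalisation divides by 0.\<close>

lemma qr_exists:
  assumes B: "B \<in> carrier_mat n 2" and inj: "\<And>v. v \<in> carrier_vec 2 \<Longrightarrow> B *\<^sub>v v = 0\<^sub>v n \<Longrightarrow> v = 0\<^sub>v 2"
  shows "\<exists>Q R. qr_decomp n B Q R"
proof -
  have nz: "norm2 (s \<cdot>\<^sub>v col B 0 + t \<cdot>\<^sub>v col B 1) \<noteq> 0" if st: "s \<noteq> 0 \<or> t \<noteq> 0" for s t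
  proof
    assume *: "norm2 (s \<cdot>\<^sub>v col B 0 + t \<cdot>\<^sub>v col B 1) = 0"
    let ?v = "vec 2 (\<lambda>i. if i = 0 then s else t)"
    have "B *\<^sub>v ?v = s \<cdot>\<^sub>v col B 0 + t \<cdot>\<^sub>v col B 1" using mat_cols2_mult_vec[OF B, of ?v] by simp
    then have "B *\<^sub>v ?v = 0\<^sub>v n" using * B norm2_eq_0_iff[of "B *\<^sub>v ?v" n] mult_mat_vec_carrier[OF B, of ?v] by simp
    then have "?v = 0\<^sub>v 2" by (intro inj) simp
    then show False using st by (auto simp: vec_eq_iff dest: spec[of _ 0] spec[of _ 1])
  qed
  define b0 b1 where "b0 = col B 0" and "b1 = col B 1"
  have b: "b0 \<in> carrier_vec n" "b1 \<in> carrier_vec n" unfolding b0_def b1_def using B by (auto simp: col_dim)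
  have "1 \<cdot>\<^sub>v b0 + 0 \<cdot>\<^sub>v b1 = b0" using b by (intro eq_vecI) auto
  then have n0: "norm2 b0 \<noteq> 0" using nz[of 1 0, folded b0_def b1_def] by simp
  define q0 where "q0 = (1 / norm2 b0) \<cdot>\<^sub>v b0"
  define c where "c = q0 \<bullet> b1"
  define w where "w = (- c / norm2 b0) \<cdot>\<^sub>v b0 + 1 \<cdot>\<^sub>v b1"
  have n1: "norm2 w \<noteq> 0" unfolding w_def by (rule nz[folded b0_def b1_def]) simp
  define q1 where "q1 = (1 / norm2 w) \<cdot>\<^sub>v w"
  have q: "q0 \<in> carrier_vec n" "q1 \<in> carrier_vec n" "w \<in> carrier_vec n" unfolding q0_def q1_def w_def using b by auto
  have q00: "q0 \<bullet> q0 = 1" using n0 b by (simp add: q0_def power2_eq_square flip: norm2_power2)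
  have q11: "q1 \<bullet> q1 = 1" using n1 q by (simp add: q1_def power2_eq_square flip: norm2_power2)
  have "w = b1 - c \<cdot>\<^sub>v q0" unfolding w_def q0_def using b by (intro eq_vecI) auto
  then have "q0 \<bullet> w = 0" using q b q00 by (simp add: scalar_prod_minus_distrib[of _ n] c_def)
  then have q01: "q0 \<bullet> q1 = 0" unfolding q1_def using q by simp
  have q10: "q1 \<bullet> q0 = 0" using comm_scalar_prod[OF q(1,2)] q01 by simp
  define Q where "Q = mat n 2 (\<lambda>(i, j). if j = 0 then q0 $ i else q1 $ i)"
  define R where "R = mat 2 2 (\<lambda>(i, j). if j = 0 then (if i = 0 then norm2 b0 else 0) else (if i = 0 then c else norm2 w))"
  have cQ: "col Q 0 = q0" "col Q 1 = q1" unfolding Q_def using q by (auto intro!: eq_vecI)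
  have Qc: "Q \<in> carrier_mat n 2" and Rc: "R \<in> carrier_mat 2 2" unfolding Q_def R_def by simp_all
  have entry: "(Q\<^sup>T * Q) $$ (i, j) = col Q i \<bullet> col Q j" if "i < 2" "j < 2" for i j
    using Qc that by simp
  have "Q\<^sup>T * Q \<in> carrier_mat 2 2" using Qc by simp
  then have "Q\<^sup>T * Q = 1\<^sub>m 2"
    by (intro mat2_eqI) (simp_all only: entry cQ q00 q01 q10 q11 zero_less_numeral Suc_1[symmetric] lessI One_nat_def[symmetric] one_carrier_mat, simp_all)
  moreover have "upper_triangular R" unfolding upper_triangular_def R_def by (auto simp: less_2_cases_iff)
  moreover have "B = Q * R"
  proof (rule eq_matI)
    fix i j assume "i < dim_row (Q * R)" "j < dim_col (Q * R)"
    then have ij: "i < n" "j < 2" using Qc Rc by auto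
    have "B $$ (i, 0) = b0 $ i" "B $$ (i, 1) = b1 $ i" unfolding b0_def b1_def using B ij by auto
    moreover have "(Q * R) $$ (i, j) = q0 $ i * R $$ (0, j) + q1 $ i * R $$ (1, j)"
      using Qc Rc ij by (simp add: scalar_prod_def numeral_2_eq_2) (simp add: Q_def)
    ultimately show "B $$ (i, j) = (Q * R) $$ (i, j)"
      using ij n0 n1 b q unfolding R_def q1_def w_def[symmetric]
      by (auto simp: less_2_cases_iff q0_def) (simp add: w_def field_simps)
  qed (use B Qc Rc in auto)
  ultimately show ?thesis unfolding qr_decomp_def using Qc Rc by blast
qed

text \<open>The invariant that all choices of QR factors share. Only an inclusion is recorded:
  vectors in the range of \<open>Q\<close> are \<open>k\<close>-fold iterates of vectors in the
  range of \<open>Y\<close>. The last clause makes nonzero \<open>a\<close> come from nonzero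
  \<open>b\<close>, so that injectivity of \<open>A^(k+1) Y\<close> passes to
  \<open>A * Q\<close>.\<close>

definition iter_range :: "nat \<Rightarrow> real mat \<Rightarrow> real mat \<Rightarrow> nat \<Rightarrow> real mat \<Rightarrow> bool" where
  "iter_range n A Y k Q \<longleftrightarrow> Q \<in> carrier_mat n 2 \<and>
     (\<forall>a\<in>carrier_vec 2. \<exists>b\<in>carrier_vec 2. Q *\<^sub>v a = mat_iter A k (Y *\<^sub>v b) \<and> (b = 0\<^sub>v 2 \<longrightarrow> a = 0\<^sub>v 2))"

lemma iter_range_mult_inj:
  assumes A: "A \<in> carrier_mat n n" and Q: "iter_range n A Y k Q"
    and inj: "\<And>b. b \<in> carrier_vec 2 \<Longrightarrow> mat_iter A (Suc k) (Y *\<^sub>v b) = 0\<^sub>v n \<Longrightarrow> b = 0\<^sub>v 2"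
    and v: "v \<in> carrier_vec 2" "(A * Q) *\<^sub>v v = 0\<^sub>v n"
  shows "v = 0\<^sub>v 2"
proof -
  from Q v(1) obtain b where b: "b \<in> carrier_vec 2" "Q *\<^sub>v v = mat_iter A k (Y *\<^sub>v b)" "b = 0\<^sub>v 2 \<longrightarrow> v = 0\<^sub>v 2"
    unfolding iter_range_def by blast
  have "(A * Q) *\<^sub>v v = A *\<^sub>v (Q *\<^sub>v v)"
    using A Q v by (simp add: assoc_mult_mat_vec[of _ n n _ 2] iter_range_def)
  then show ?thesis using inj[OF b(1)] b v by simp
qed

text \<open>A QR step only changes the basis: since \<open>A * Q\<close> is injective,
  \<open>R\<close> is invertible, and \<open>Q' a = A Q (R' a)\<close> with the inverse
  \<open>R'\<close> of \<open>R\<close>. This holds for any admissible \<open>R\<close>, whatever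
  its signs.\<close>

lemma iter_range_step:
  assumes A: "A \<in> carrier_mat n n" and Q: "iter_range n A Y k Q" and qr: "qr_decomp n (A * Q) Q' R"
    and Y: "Y \<in> carrier_mat n 2"
    and inj: "\<And>b. b \<in> carrier_vec 2 \<Longrightarrow> mat_iter A (Suc k) (Y *\<^sub>v b) = 0\<^sub>v n \<Longrightarrow> b = 0\<^sub>v 2"
  shows "iter_range n A Y (Suc k) Q'"
proof -
  have Q': "Q' \<in> carrier_mat n 2" "Q'\<^sup>T * Q' = 1\<^sub>m 2" and R: "R \<in> carrier_mat 2 2" and AQ: "A * Q = Q' * R"
    using qr unfolding qr_decomp_def by auto
  have mult: "(A * Q) *\<^sub>v v = Q' *\<^sub>v (R *\<^sub>v v)" if "v \<in> carrier_vec 2" for v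
    unfolding AQ using Q' R that by (simp add: assoc_mult_mat_vec[of _ n 2 _ 2])
  have "v = 0\<^sub>v 2" if v: "v \<in> carrier_vec 2" "R *\<^sub>v v = 0\<^sub>v 2" for v
  proof -
    have "(A * Q) *\<^sub>v v = 0\<^sub>v n" using mult[OF v(1)] v(2) mult_mat_zero_vec[OF Q'(1)] by simp
    then show ?thesis using iter_range_mult_inj[OF A Q inj v(1)] by blast
  qed
  then have "det R \<noteq> 0" using det_0_iff_vec_prod_zero[OF R] by blast
  then have "R \<in> Units (ring_mat TYPE(real) 2 undefined)" by (rule det_non_zero_imp_unit[OF R])
  then obtain R' where R': "R' \<in> carrier_mat 2 2" "R * R' = 1\<^sub>m 2"
    unfolding Units_def ring_mat_def by auto
  have "\<exists>b\<in>carrier_vec 2. Q' *\<^sub>v a = mat_iter A (Suc k) (Y *\<^sub>v b) \<and> (b = 0\<^sub>v 2 \<longrightarrow> a = 0\<^sub>v 2)"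
    if a: "a \<in> carrier_vec 2" for a
  proof -
    have R'a: "R' *\<^sub>v a \<in> carrier_vec 2" using R' a by simp
    obtain b where b: "b \<in> carrier_vec 2" "Q *\<^sub>v (R' *\<^sub>v a) = mat_iter A k (Y *\<^sub>v b)"
      using Q R'a unfolding iter_range_def by blast
    have "R *\<^sub>v (R' *\<^sub>v a) = a" using assoc_mult_mat_vec[OF R R'(1) a] R'(2) a by simp
    then have "Q' *\<^sub>v a = (A * Q) *\<^sub>v (R' *\<^sub>v a)" using mult[OF R'a] by simp
    also have "\<dots> = A *\<^sub>v (Q *\<^sub>v (R' *\<^sub>v a))"
      using A Q R'a by (simp add: assoc_mult_mat_vec[of _ n n _ 2] iter_range_def)
    finally have eq: "Q' *\<^sub>v a = mat_iter A (Suc k) (Y *\<^sub>v b)" using b by simp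
    moreover have "a = 0\<^sub>v 2" if "b = 0\<^sub>v 2"
    proof -
      have "Y *\<^sub>v b = 0\<^sub>v n" using mult_mat_zero_vec[OF Y] that by simp
      moreover have "mat_iter A j (0\<^sub>v n) = 0\<^sub>v n" for j by (induction j) (simp_all add: mult_mat_zero_vec[OF A])
      ultimately have "Q' *\<^sub>v a = 0\<^sub>v n" using eq mult_mat_zero_vec[OF A] by simp
      then have "(Q'\<^sup>T * Q') *\<^sub>v a = 0\<^sub>v 2"
        using Q'(1) a mult_mat_zero_vec[of "Q'\<^sup>T" 2 n] by (simp add: assoc_mult_mat_vec[of _ 2 n _ 2])
      then show ?thesis using Q' a by simp
    qed
    ultimately show ?thesis using b by blast
  qed
  then show ?thesis unfolding iter_range_def using Q' by blast
qed

section \<open>Correctness of the algorithm on a good graph\<close>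

lemma mat_iter_zero:
  assumes "A \<in> carrier_mat n n"
  shows "mat_iter A k (0\<^sub>v n) = 0\<^sub>v n"
  by (induction k) (simp_all add: mult_mat_zero_vec[OF assms])

lemma mat_iter_eq_zero_mono:
  assumes A: "A \<in> carrier_mat n n" and "k \<le> N" and "mat_iter A k v = 0\<^sub>v n"
  shows "mat_iter A N v = 0\<^sub>v n"
proof -
  have "mat_iter A N v = mat_iter A (N - k) (mat_iter A k v)"
    using assms(2) funpow_add[of "N - k" k "(*\<^sub>v) A"] by simp
  then show ?thesis using assms(3) mat_iter_zero[OF A] by simp
qed

context
  fixes n N :: nat and A Y :: "real mat"
  assumes A: "A \<in> carrier_mat n n" and sym: "A\<^sup>T = A" and Y: "Y \<in> carrier_mat n 2" and N: "0 < N"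
    and inj: "\<And>b. b \<in> carrier_vec 2 \<Longrightarrow> mat_iter A N (Y *\<^sub>v b) = 0\<^sub>v n \<Longrightarrow> b = 0\<^sub>v 2"
begin

text \<open>A vector killed by \<open>A^k\<close> is killed by \<open>A^N\<close> for
  \<open>k \<le> N\<close>, so injectivity of the last iterate entails that of all earlier
  ones.\<close>

lemma iterates_injective: "k \<le> N \<Longrightarrow> b \<in> carrier_vec 2 \<Longrightarrow> mat_iter A k (Y *\<^sub>v b) = 0\<^sub>v n \<Longrightarrow> b = 0\<^sub>v 2"
  using inj mat_iter_eq_zero_mono[OF A] by blast

lemma iter_range_0:
  assumes W: "is_inv_sqrt (Y\<^sup>T * Y) W"
  shows "iter_range n A Y 0 (Y * W)"
proof -
  have Wc: "W \<in> carrier_mat 2 2" and pos: "\<And>v. v \<in> carrier_vec 2 \<Longrightarrow> v \<noteq> 0\<^sub>v 2 \<Longrightarrow> 0 < v \<bullet> (W *\<^sub>v v)"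
    using W Y unfolding is_inv_sqrt_def by auto
  have "\<exists>b\<in>carrier_vec 2. (Y * W) *\<^sub>v a = mat_iter A 0 (Y *\<^sub>v b) \<and> (b = 0\<^sub>v 2 \<longrightarrow> a = 0\<^sub>v 2)"
    if a: "a \<in> carrier_vec 2" for a
  proof (intro bexI[of _ "W *\<^sub>v a"] conjI impI)
    show "(Y * W) *\<^sub>v a = mat_iter A 0 (Y *\<^sub>v (W *\<^sub>v a))"
      using Y Wc a by (simp add: assoc_mult_mat_vec[of _ n 2 _ 2])
    show "a = 0\<^sub>v 2" if "W *\<^sub>v a = 0\<^sub>v 2"
      using pos[OF a] that a by auto
  qed (use Wc a in simp)
  then show ?thesis unfolding iter_range_def using Y Wc by simp
qed

text \<open>Stated for a run of \<open>m \<le> N\<close> steps because the existence proof for stage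
  1 builds the run one step at a time and uses the invariant of the unfinished run.\<close>

lemma iter_range_run:
  assumes W: "is_inv_sqrt (Y\<^sup>T * Y) W" and Q0: "Q 0 = Y * W"
    and qr: "\<And>k. k \<in> {1..m} \<Longrightarrow> qr_decomp n (A * Q (k - 1)) (Q k) (R k)" and m: "m \<le> N" and k: "k \<le> m"
  shows "iter_range n A Y k (Q k)"
  using k
proof (induction k)
  case 0
  then show ?case using iter_range_0[OF W] Q0 by simp
next
  case (Suc k)
  then show ?case
    using qr[of "Suc k"] m iterates_injective[of "Suc k"] by (intro iter_range_step[OF A _ _ Y]) auto
qed

text \<open>The claim about all results of stage 1 would be empty if there were none. Injectivity of
  the iterates keeps every step defined: \<open>Y^T Y\<close> is positive definite and each
  \<open>A * Q k\<close> that has to be factored has independent columns.\<close>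

lemma stage1_exists: "\<exists>y. stage1 n A Y N y"
proof -
  have YY: "Y\<^sup>T * Y \<in> carrier_mat 2 2" "(Y\<^sup>T * Y)\<^sup>T = Y\<^sup>T * Y"
    using Y transpose_mult[of "Y\<^sup>T" 2 n Y 2] by auto
  have "0 < v \<bullet> ((Y\<^sup>T * Y) *\<^sub>v v)" if v: "v \<in> carrier_vec 2" "v \<noteq> 0\<^sub>v 2" for v
  proof -
    have c: "Y *\<^sub>v v \<in> carrier_vec n" using Y v by simp
    have "v \<bullet> ((Y\<^sup>T * Y) *\<^sub>v v) = (Y\<^sup>T *\<^sub>v (Y *\<^sub>v v)) \<bullet> v"
      using Y v c comm_scalar_prod[of v 2] by (simp add: assoc_mult_mat_vec[of _ 2 n _ 2])
    also have "\<dots> = (norm2 (Y *\<^sub>v v))\<^sup>2"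
      using transpose_vec_mult_scalar[OF Y v(1) c] norm2_power2 by simp
    finally have eq: "v \<bullet> ((Y\<^sup>T * Y) *\<^sub>v v) = (norm2 (Y *\<^sub>v v))\<^sup>2" .
    have "Y *\<^sub>v v \<noteq> 0\<^sub>v n" using iterates_injective[of 0 v] v by auto
    then have "norm2 (Y *\<^sub>v v) \<noteq> 0" using norm2_eq_0_iff[OF c] by simp
    then show ?thesis unfolding eq by simp
  qed
  then obtain W where W: "is_inv_sqrt (Y\<^sup>T * Y) W" using inv_sqrt_exists[OF YY] by blast
  have "\<exists>Q R. Q 0 = Y * W \<and> (\<forall>k\<in>{1..m}. qr_decomp n (A * Q (k - 1)) (Q k) (R k))" if "m \<le> N" for m
    using that
  proof (induction m)
    case 0
    show ?case by (rule exI[of _ "\<lambda>_. Y * W"]) simp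
  next
    case (Suc m)
    then obtain Q R where QR: "Q 0 = Y * W" "\<forall>k\<in>{1..m}. qr_decomp n (A * Q (k - 1)) (Q k) (R k)"
      by auto
    have J: "iter_range n A Y m (Q m)"
      by (rule iter_range_run[where Q = Q and R = R and m = m and k = m, OF W QR(1)]) (use QR Suc.prems in auto)
    have "A * Q m \<in> carrier_mat n 2" using A J unfolding iter_range_def by simp
    then obtain Q' R' where qr: "qr_decomp n (A * Q m) Q' R'"
      using qr_exists[of "A * Q m" n] iter_range_mult_inj[OF A J iterates_injective[OF Suc.prems]] by blast
    have "qr_decomp n (A * (Q(Suc m := Q')) (k - 1)) ((Q(Suc m := Q')) k) ((R(Suc m := R')) k)"
      if "k \<in> {1..Suc m}" for k
      using that QR(2) qr by (cases "k = Suc m") auto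
    then show ?case using QR(1) by (intro exI[of _ "Q(Suc m := Q')"] exI[of _ "R(Suc m := R')"]) auto
  qed
  from this[OF order_refl] obtain Q R where Q0: "Q 0 = Y * W"
    and qr: "\<And>k. k \<in> {1..N} \<Longrightarrow> qr_decomp n (A * Q (k - 1)) (Q k) (R k)"
    by blast
  have QN: "Q N \<in> carrier_mat n 2"
    using iter_range_run[where Q = Q and R = R and m = N and k = N, OF W Q0] qr unfolding iter_range_def by simp
  let ?M = "(Q N)\<^sup>T * A * Q N"
  have M: "?M \<in> carrier_mat 2 2" using QN A by simp
  have "?M\<^sup>T = ?M"
    using QN A transpose_mult[of "(Q N)\<^sup>T * A" 2 n "Q N" 2] transpose_mult[of "(Q N)\<^sup>T" 2 n A n] sym
    by (simp add: assoc_mult_mat[of _ 2 n _ n _ 2])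
  then obtain H a b where H: "H \<in> carrier_mat 2 2" "H\<^sup>T * H = 1\<^sub>m 2" "?M = H * diag2 a b * H\<^sup>T" "\<bar>b\<bar> \<le> \<bar>a\<bar>"
    using sym_mat2_diag[OF M] by metis
  have two: "finite {..<2 :: nat}" "{..<2 :: nat} \<noteq> {}" by (simp_all add: lessThan_empty_iff)
  have "\<exists>i. is_arg_min (\<lambda>j. diag2 a b $$ (j, j)) (\<lambda>j. j < 2) i"
    using ex_is_arg_min_if_finite[OF two, of "\<lambda>j. diag2 a b $$ (j, j)"]
    by (simp only: lessThan_iff)
  then obtain i where i: "is_arg_min (\<lambda>j. diag2 a b $$ (j, j)) (\<lambda>j. j < 2) i" by blast
  have ball: "\<forall>k\<in>{1..N}. qr_decomp n (A * Q (k - 1)) (Q k) (R k)" using qr by blast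
  have le: "\<bar>diag2 a b $$ (1, 1)\<bar> \<le> \<bar>diag2 a b $$ (0, 0)\<bar>" using H(4) by (simp add: diag2_def)
  let ?v = "col (Q N * H) i"
  have "stage1 n A Y N (?v - (all_ones n \<bullet> ?v / real n) \<cdot>\<^sub>v all_ones n)"
    unfolding stage1_def Let_def
    by (rule exI[of _ W], rule exI[of _ Q], rule exI[of _ R], rule exI[of _ H],
        rule exI[of _ "diag2 a b"], rule exI[of _ i])
      (intro conjI W Q0 ball H(1-3) diag2_carrier diag2_diagonal le i refl)
  then show ?thesis by blast
qed

text \<open>All that the Ritz step leaves open is a choice of orthonormal \<open>f, g\<close> in the iterated range.\<close>

lemma stage1_ritz:
  assumes "stage1 n A Y N y"
  obtains f g b c where "b \<in> carrier_vec 2" "f = mat_iter A N (Y *\<^sub>v b)"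
    "c \<in> carrier_vec 2" "g = mat_iter A N (Y *\<^sub>v c)"
    "f \<bullet> f = 1" "g \<bullet> g = 1" "f \<bullet> g = 0" "f \<bullet> (A *\<^sub>v g) = 0" "f \<bullet> (A *\<^sub>v f) \<le> g \<bullet> (A *\<^sub>v g)"
    "y = f - (all_ones n \<bullet> f / real n) \<cdot>\<^sub>v all_ones n"
proof -
  obtain W Q R H D i where W: "is_inv_sqrt (Y\<^sup>T * Y) W" and Q0: "Q 0 = Y * W"
    and qr: "\<And>k. k \<in> {1..N} \<Longrightarrow> qr_decomp n (A * Q (k - 1)) (Q k) (R k)"
    and H: "H \<in> carrier_mat 2 2" "H\<^sup>T * H = 1\<^sub>m 2" and D: "D \<in> carrier_mat 2 2" "diagonal_mat D"
    and M: "(Q N)\<^sup>T * A * Q N = H * D * H\<^sup>T"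
    and i: "is_arg_min (\<lambda>j. D $$ (j, j)) (\<lambda>j. j < 2) i"
    and y: "y = col (Q N * H) i - (all_ones n \<bullet> col (Q N * H) i / real n) \<cdot>\<^sub>v all_ones n"
    using assms unfolding stage1_def Let_def by blast
  have J: "iter_range n A Y N (Q N)" using iter_range_run[where Q = Q and R = R and m = N and k = N, OF W Q0] qr by simp
  have QN: "Q N \<in> carrier_mat n 2" and QQ: "(Q N)\<^sup>T * Q N = 1\<^sub>m 2"
    using qr[of N] N unfolding qr_decomp_def by auto
  define F where "F = Q N * H"
  have F: "F \<in> carrier_mat n 2" unfolding F_def using QN H by simp
  have HT: "H\<^sup>T \<in> carrier_mat 2 2" and QT: "(Q N)\<^sup>T \<in> carrier_mat 2 n" using H QN by simp_all
  have FT: "F\<^sup>T = H\<^sup>T * (Q N)\<^sup>T" unfolding F_def using QN H by (simp add: transpose_mult[of _ n 2 _ 2])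
  have "F\<^sup>T * F = H\<^sup>T * ((Q N)\<^sup>T * Q N) * H"
    unfolding FT unfolding F_def using QN H HT QT
    by (simp add: assoc_mult_mat[of _ 2 n _ 2 _ 2] assoc_mult_mat[of _ 2 2 _ n _ 2] assoc_mult_mat[of _ 2 2 _ 2 _ 2])
  then have FF: "F\<^sup>T * F = 1\<^sub>m 2" unfolding QQ using H HT by simp
  have "F\<^sup>T * (A * F) = H\<^sup>T * ((Q N)\<^sup>T * A * Q N) * H"
    unfolding FT unfolding F_def using QN H HT QT A
    by (simp add: assoc_mult_mat[of _ 2 n _ 2 _ 2] assoc_mult_mat[of _ 2 2 _ n _ 2] assoc_mult_mat[of _ 2 2 _ 2 _ 2]
      assoc_mult_mat[of _ 2 n _ n _ 2] assoc_mult_mat[of _ n n _ 2 _ 2])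
  also have "\<dots> = (H\<^sup>T * H) * D * (H\<^sup>T * H)"
    unfolding M using H(1) HT D(1) by (simp add: assoc_mult_mat[of _ 2 2 _ 2 _ 2])
  also have "\<dots> = D" unfolding H(2) using D(1) by simp
  finally have FAF: "F\<^sup>T * (A * F) = D" .
  have AF: "A * F \<in> carrier_mat n 2" using A F by simp
  have sp: "col F j \<bullet> col F k = (if j = k then 1 else 0)" if "j < 2" "k < 2" for j k
    using arg_cong[OF FF, of "\<lambda>M. M $$ (j, k)"] F that by simp
  have spA: "col F j \<bullet> (A *\<^sub>v col F k) = D $$ (j, k)" if "j < 2" "k < 2" for j k
  proof -
    have "(F\<^sup>T * (A * F)) $$ (j, k) = row (F\<^sup>T) j \<bullet> col (A * F) k"
      using F AF that by simp
    also have "row (F\<^sup>T) j = col F j" using F that by simp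
    also have "col (A * F) k = A *\<^sub>v col F k" using A F that by (intro eq_vecI) auto
    finally show ?thesis unfolding FAF by simp
  qed
  have rng: "\<exists>b\<in>carrier_vec 2. col F j = mat_iter A N (Y *\<^sub>v b)" if j: "j < 2" for j
  proof -
    have "col F j = Q N *\<^sub>v col H j" unfolding F_def using QN H j by (intro eq_vecI) auto
    moreover have "col H j \<in> carrier_vec 2" using H(1) by (intro carrier_vecI) simp
    ultimately show ?thesis using J unfolding iter_range_def by auto
  qed
  \<comment> \<open>Of the indices 0 and 1 the argmin \<open>i\<close> gives \<open>f\<close> and
    the other one, \<open>1 - i\<close>, gives \<open>g\<close>; in a tie either choice satisfies
    the inequality between the Ritz values.\<close>
  have i2: "i < 2" and min: "\<not> D $$ (1 - i, 1 - i) < D $$ (i, i)"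
    using i unfolding is_arg_min_def by auto
  let ?j = "1 - i"
  have j: "?j < 2" "i \<noteq> ?j" using i2 by presburger+
  obtain b where b: "b \<in> carrier_vec 2" "col F i = mat_iter A N (Y *\<^sub>v b)" using rng[OF i2] by blast
  obtain c where c: "c \<in> carrier_vec 2" "col F ?j = mat_iter A N (Y *\<^sub>v c)" using rng[OF j(1)] by blast
  have D0: "D $$ (i, ?j) = 0" using D i2 j unfolding diagonal_mat_def by auto
  show ?thesis
    by (rule that[OF b(1,2) c(1,2)])
      (use sp[OF i2 i2] sp[OF j(1) j(1)] sp[OF i2 j(1)] spA[OF i2 j(1)] spA[OF i2 i2] spA[OF j(1) j(1)] D0 min j(2) y
       in \<open>auto simp flip: F_def\<close>)
qed

end

text \<open>The deterministic half of the argument. What is left to probability is the norm bound of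
  the locale, the vertex margins and \<open>captured\<close>, by which the iterated range of
  \<open>Y\<close> is nondegenerate and close to the plane.\<close>

lemma (in rank_two_perturbation) finds_labelsI:
  assumes xs: "xs \<in> balanced_labels n" and n: "0 < n"
    and e_def: "e1 = (1 / sqrt n) \<cdot>\<^sub>v all_ones n" "e2 = (1 / sqrt n) \<cdot>\<^sub>v xs"
    and Y: "Y \<in> carrier_mat n 2" and N: "0 < N"
    and captured: "\<And>b. b \<in> carrier_vec 2 \<Longrightarrow> b \<noteq> 0\<^sub>v 2 \<Longrightarrow>
      mat_iter A N (Y *\<^sub>v b) \<noteq> 0\<^sub>v n \<and> perp (mat_iter A N (Y *\<^sub>v b)) \<le> \<epsilon> * norm2 (mat_iter A N (Y *\<^sub>v b))"
    and gap: "l2 < l1" and \<eta>: "\<eta> = (l2 * \<epsilon>\<^sup>2 + d) / (l1 - l2)"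
    and small: "2 * (sqrt (\<eta>\<^sup>2 + 2 * \<eta>) + \<epsilon>\<^sup>2) \<le> \<delta>" and \<delta>: "\<delta> < 2"
    and margin: "\<And>i. i < n \<Longrightarrow> g \<le> xs $ i * (A *\<^sub>v xs) $ i"
    and ppm_gap: "l2 * \<delta> / 4 < g / 2"
    and \<theta>: "0 \<le> \<theta>" "\<theta> < 1" "d \<le> \<theta> * (g / 2 - l2 * \<delta> / 4)"
    and M: "1 \<le> M" "\<theta> ^ M * sqrt (\<delta> * n) < 2" "M + 1 \<le> K"
  shows "finds_labels n xs N K A Y"
proof -
  have inj: "b = 0\<^sub>v 2" if "b \<in> carrier_vec 2" "mat_iter A N (Y *\<^sub>v b) = 0\<^sub>v n" for b
    using captured that by blast
  note xsD = balanced_labelsD[OF xs]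
  have main: "y \<noteq> 0\<^sub>v n \<and> (\<forall>x. ppm_run n A y x \<longrightarrow> (\<exists>k\<le>K. halts_at x k \<and> x k \<in> {xs, - xs}))"
    if y: "stage1 n A Y N y" for y
  proof -
    obtain f h b c where b: "b \<in> carrier_vec 2" "f = mat_iter A N (Y *\<^sub>v b)"
      and c: "c \<in> carrier_vec 2" "h = mat_iter A N (Y *\<^sub>v c)"
      and fh: "f \<bullet> f = 1" "h \<bullet> h = 1" "f \<bullet> h = 0" "f \<bullet> (A *\<^sub>v h) = 0" "f \<bullet> (A *\<^sub>v f) \<le> h \<bullet> (A *\<^sub>v h)"
      and y_eq: "y = f - (all_ones n \<bullet> f / real n) \<cdot>\<^sub>v all_ones n"
      by (rule stage1_ritz[OF A sym Y N inj y])
    have fc: "f \<in> carrier_vec n" and hc: "h \<in> carrier_vec n"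
      unfolding b(2) c(2) using A Y b(1) c(1) by (auto intro!: mat_iter_carrier)
    \<comment> \<open>The relative bound of \<open>captured\<close> becomes absolute for unit
      vectors; a unit vector cannot come from \<open>b = 0\<close>.\<close>
    have perp_le: "perp w \<le> \<epsilon>" if w: "w = mat_iter A N (Y *\<^sub>v b)" "b \<in> carrier_vec 2" "w \<bullet> w = 1" for w b
    proof -
      have "mat_iter A N (Y *\<^sub>v 0\<^sub>v 2) = 0\<^sub>v n"
        using mat_iter_zero[OF A] mult_mat_zero_vec[OF Y] by simp
      then have "b \<noteq> 0\<^sub>v 2" using w by auto
      moreover have "norm2 w = 1" using w(3) by (simp add: norm2_def)
      ultimately show ?thesis using captured[OF w(2)] w(1) by simp
    qed
    have pf: "perp f \<le> \<epsilon>" and ph: "perp h \<le> \<epsilon>" using perp_le b c fh by blast+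
    have a: "(e1 \<bullet> f)\<^sup>2 \<le> sqrt (\<eta>\<^sup>2 + 2 * \<eta>)"
      by (rule ritz_vector_approx[OF fc fh(1) hc fh(2) fh(3-5) pf ph gap \<eta>])
    have sm: "2 * ((e1 \<bullet> f)\<^sup>2 + \<epsilon>\<^sup>2) \<le> \<delta>"
      by (rule order_trans[OF _ small]) (use a in simp)
    have nn: "sqrt n * sqrt n = real n" by simp
    have one: "all_ones n \<in> carrier_vec n" by (simp add: all_ones_def)
    have y_e: "y = f - (e1 \<bullet> f) \<cdot>\<^sub>v e1"
    proof -
      have "(e1 \<bullet> f) \<cdot>\<^sub>v e1 = (all_ones n \<bullet> f / real n) \<cdot>\<^sub>v all_ones n"
        unfolding e_def using one fc by (simp add: smult_smult_assoc)
      then show ?thesis using y_eq by simp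
    qed
    note dv = deflated_vector_approx[OF fc fh(1) pf sm \<delta> y_e]
    have yc: "y \<in> carrier_vec n" by (rule dv(1))
    obtain s where s: "s \<in> {1, -1}" "1 - s * (e2 \<bullet> y) / norm2 y \<le> \<delta> / 2" using dv(4) by blast
    \<comment> \<open>The target of the power iterations is the label vector of the sign picked up
      by stage 1. Since \<open>s * s = 1\<close>, the margins and the leading rank-one term are the
      same as for \<open>xs\<close>.\<close>
    define x' where "x' = s \<cdot>\<^sub>v xs"
    have x'_cases: "x' = xs \<or> x' = - xs" using s(1) unfolding x'_def by auto
    have x'b: "x' \<in> balanced_labels n" using x'_cases uminus_balanced_labels[OF xs] xs by auto
    note x'D = balanced_labelsD[OF x'b]
    have ss: "s * s = 1" using s(1) by auto
    have Ax': "A *\<^sub>v x' = s \<cdot>\<^sub>v (A *\<^sub>v xs)" unfolding x'_def using A xsD(1) by (simp add: mult_mat_vec)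
    have setting: "ppm_setting n A x' l2 d g \<delta> \<theta>"
    proof
      show "g \<le> x' $ i * (A *\<^sub>v x') $ i" if i: "i < n" for i
      proof -
        have "x' $ i * (A *\<^sub>v x') $ i = (s * s) * (xs $ i * (A *\<^sub>v xs) $ i)"
          unfolding Ax' unfolding x'_def using i xsD(1) A by simp
        then show ?thesis using margin[OF i] ss by simp
      qed
      fix v assume v: "v \<in> carrier_vec n" "all_ones n \<bullet> v = 0"
      have "(l1 * (e1 \<bullet> v)) \<cdot>\<^sub>v e1 + (l2 * (e2 \<bullet> v)) \<cdot>\<^sub>v e2 = (l2 * (x' \<bullet> v) / n) \<cdot>\<^sub>v x'"
      proof (rule eq_vecI)
        fix i assume "i < dim_vec ((l2 * (x' \<bullet> v) / n) \<cdot>\<^sub>v x')"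
        then have i: "i < n" using x'D(1) by simp
        have "((l1 * (e1 \<bullet> v)) \<cdot>\<^sub>v e1 + (l2 * (e2 \<bullet> v)) \<cdot>\<^sub>v e2) $ i = l2 * (xs \<bullet> v) / (sqrt n * sqrt n) * xs $ i"
          unfolding e_def using one xsD(1) v i by simp
        also have "\<dots> = (s * s) * (l2 * (xs \<bullet> v) / n * xs $ i)" unfolding nn ss by simp
        also have "\<dots> = ((l2 * (x' \<bullet> v) / n) \<cdot>\<^sub>v x') $ i" unfolding x'_def using xsD(1) v i by simp
        finally show "((l1 * (e1 \<bullet> v)) \<cdot>\<^sub>v e1 + (l2 * (e2 \<bullet> v)) \<cdot>\<^sub>v e2) $ i = ((l2 * (x' \<bullet> v) / n) \<cdot>\<^sub>v x') $ i" .
      qed (use e1 e2 x'D(1) in auto)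
      then show "norm2 (A *\<^sub>v v - (l2 * (x' \<bullet> v) / n) \<cdot>\<^sub>v x') \<le> d * norm2 v"
        using perturbation[OF v(1)] by simp
    qed (use n A x'b l2_nonneg ppm_gap \<theta> in auto)
    have "\<exists>k\<le>K. halts_at x k \<and> x k \<in> {xs, - xs}" if run: "ppm_run n A y x" for x
    proof -
      have x0: "x 0 = (sqrt n / norm2 y) \<cdot>\<^sub>v y"
        and step: "\<And>k. 1 \<le> k \<Longrightarrow> x k \<in> proj_balanced n (A *\<^sub>v x (k - 1))"
        using run unfolding ppm_run_def by auto
      have x0c: "x 0 \<in> carrier_vec n" unfolding x0 using yc by simp
      have "all_ones n \<bullet> y = 0" using dv(2) n one yc unfolding e_def by simp
      then have x01: "all_ones n \<bullet> x 0 = 0" unfolding x0 using one yc by simp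
      have "norm2 (x 0) = sqrt n" unfolding x0 using dv(3) by simp
      then have nx0: "x 0 \<bullet> x 0 = real n" using norm2_power2[of "x 0"] by simp
      have "x' \<bullet> x 0 = s * (sqrt n / norm2 y * (xs \<bullet> y))"
        unfolding x'_def x0 using xsD(1) yc by simp
      also have "xs \<bullet> y = sqrt n * (e2 \<bullet> y)" unfolding e_def using xsD(1) yc n by simp
      also have "s * (sqrt n / norm2 y * (sqrt n * (e2 \<bullet> y))) = (sqrt n * sqrt n) * (s * (e2 \<bullet> y) / norm2 y)" by simp
      finally have ip: "x' \<bullet> x 0 = n * (s * (e2 \<bullet> y) / norm2 y)" unfolding nn .
      have "(norm2 (x 0 - x'))\<^sup>2 = 2 * n - 2 * (x' \<bullet> x 0)"
        using norm2_diff_power2[OF x0c x'D(1)] nx0 x'D(3) comm_scalar_prod[OF x0c x'D(1)]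
        by (simp add: norm2_power2[of "x 0"] norm2_power2[of x'])
      also have "\<dots> = 2 * n * (1 - s * (e2 \<bullet> y) / norm2 y)" unfolding ip by (simp add: algebra_simps)
      also have "\<dots> \<le> 2 * n * (\<delta> / 2)" by (intro mult_left_mono s(2)) simp
      finally have near: "(norm2 (x 0 - x'))\<^sup>2 \<le> \<delta> * n" by (simp add: mult.commute)
      from ppm_setting.ppm_terminates[OF setting x0c x01 nx0 near step M(1,2)]
      obtain k where "k \<le> M + 1" "halts_at x k" "x k = x'" by blast
      then show ?thesis using M(3) x'_cases by (intro exI[of _ k]) auto
    qed
    moreover have "y \<noteq> 0\<^sub>v n" using dv(3) by auto
    ultimately show ?thesis by blast
  qed
  show ?thesis
    unfolding finds_labels_def using main stage1_exists[OF A sym Y N inj] by blast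
qed

section \<open>The stochastic block model\<close>

text \<open>A real supremum is meaningful only for a bounded set; by Cauchy-Schwarz the sum of the
  row norms bounds the image of the unit ball. The rest is scaling to that ball.\<close>

lemma norm2_mult_le_spectral_norm:
  assumes M: "M \<in> carrier_mat m n" and v: "v \<in> carrier_vec n"
  shows "norm2 (M *\<^sub>v v) \<le> spectral_norm M * norm2 v"
proof (cases "norm2 v = 0")
  case True
  then have "v = 0\<^sub>v n" using norm2_eq_0_iff[OF v] by simp
  then have "M *\<^sub>v v = 0\<^sub>v m" using M by (intro eq_vecI) auto
  then show ?thesis using True by simp
next
  case False
  then have pos: "0 < norm2 v" by (simp add: order_less_le)
  let ?S = "{v \<in> carrier_vec (dim_col M). norm2 v \<le> 1}"
  have bdd: "bdd_above ((\<lambda>v. norm2 (M *\<^sub>v v)) ` ?S)"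
  proof (rule bdd_aboveI2)
    fix w assume "w \<in> ?S"
    then have w: "w \<in> carrier_vec n" "norm2 w \<le> 1" using M by auto
    have "norm2 (M *\<^sub>v w) \<le> (\<Sum>i<m. \<bar>row M i \<bullet> w\<bar>)"
      unfolding norm2_L2_set using M L2_set_le_sum_abs[of "\<lambda>i. (M *\<^sub>v w) $ i" "{..<m}"] by simp
    also have "\<dots> \<le> (\<Sum>i<m. norm2 (row M i) * 1)"
    proof (rule sum_mono)
      fix i assume "i \<in> {..<m}"
      then have "row M i \<in> carrier_vec n" using M by auto
      then show "\<bar>row M i \<bullet> w\<bar> \<le> norm2 (row M i) * 1"
        using scalar_prod_le_norm2[of "row M i" n w] w mult_left_mono[OF w(2) norm2_nonneg[of "row M i"]] by linarith
    qed
    finally show "norm2 (M *\<^sub>v w) \<le> (\<Sum>i<m. norm2 (row M i) * 1)" .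
  qed
  let ?w = "(1 / norm2 v) \<cdot>\<^sub>v v"
  have "?w \<in> ?S" using M v pos by simp
  then have "norm2 (M *\<^sub>v ?w) \<le> spectral_norm M"
    unfolding spectral_norm_def by (rule cSUP_upper[OF _ bdd])
  moreover have "M *\<^sub>v ?w = (1 / norm2 v) \<cdot>\<^sub>v (M *\<^sub>v v)" using M v by (simp add: mult_mat_vec)
  ultimately show ?thesis using pos by (simp add: field_simps)
qed

definition edge_set :: "nat \<Rightarrow> (nat \<times> nat) set" where
  "edge_set n = {(i, j). i \<le> j \<and> j < n}"

lemma finite_edge_set [simp]: "finite (edge_set n)"
  by (rule finite_subset[of _ "{..<n} \<times> {..<n}"]) (auto simp: edge_set_def)

context
  fixes n :: nat and p q :: real and x :: "real vec"
  assumes p: "0 \<le> p" "p \<le> 1" and q: "0 \<le> q" "q \<le> 1" and x: "x \<in> balanced_labels n"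
begin

abbreviation "edge_prob \<equiv> \<lambda>e. if x $ fst e * x $ snd e = 1 then p else q"

abbreviation "edges_pmf \<equiv> Pi_pmf (edge_set n) False (\<lambda>e. bernoulli_pmf (edge_prob e))"

abbreviation "adj_of \<equiv> \<lambda>a. mat n n (\<lambda>(i, j). of_bool (a (min i j, max i j)) :: real)"

lemma sbm_alt: "sbm n p q x = map_pmf adj_of edges_pmf"
  unfolding sbm_def edge_set_def by (simp add: case_prod_unfold)

lemma sbm_symmetric:
  assumes "A \<in> set_pmf (sbm n p q x)"
  shows "A \<in> carrier_mat n n" "A\<^sup>T = A"
  using assms unfolding sbm_alt by (auto intro!: eq_matI simp: min.commute max.commute)

lemma finite_set_edges_pmf: "finite (set_pmf edges_pmf)"
  by (rule finite_subset[OF set_Pi_pmf_subset']) (auto intro!: finite_PiE_dflt)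

lemma finite_set_sbm: "finite (set_pmf (sbm n p q x))"
  unfolding sbm_alt using finite_set_edges_pmf by simp

lemma label_product:
  assumes "i < n" "j < n"
  shows "x $ i * x $ j = 1 \<or> x $ i * x $ j = -1"
  using balanced_labelsD(4)[OF x assms(1)] balanced_labelsD(4)[OF x assms(2)] by auto

text \<open>The affine function \<open>(p + q) / 2 + (p - q) / 2 * s\<close> takes the values
  \<open>p\<close> at \<open>s = 1\<close> and \<open>q\<close> at \<open>s = -1\<close>. In this
  form the expectation is visibly of rank at most two, diagonal included, since self-loops follow
  the same law as other edges within a class.\<close>

lemma expected_adj_index:
  assumes "i < n" "j < n"
  shows "expected_adj n p q x $$ (i, j) = (p + q) / 2 + (p - q) / 2 * (x $ i * x $ j)"
proof -
  let ?e = "(min i j, max i j)"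
  have e: "?e \<in> edge_set n" using assms by (auto simp: edge_set_def)
  have pe: "0 \<le> edge_prob ?e" "edge_prob ?e \<le> 1" using p q by auto
  have "expected_adj n p q x $$ (i, j) = measure_pmf.expectation edges_pmf (\<lambda>a. of_bool (a ?e))"
    unfolding expected_adj_def sbm_alt using assms by simp
  also have "\<dots> = measure_pmf.expectation (map_pmf (\<lambda>a. a ?e) edges_pmf) of_bool" by simp
  also have "\<dots> = edge_prob ?e"
    using e pe by (simp add: Pi_pmf_component del: integral_map_pmf)
  also have "\<dots> = (if x $ i * x $ j = 1 then p else q)"
    by (simp add: min_def max_def mult.commute)
  also have "\<dots> = (p + q) / 2 + (p - q) / 2 * (x $ i * x $ j)"
  proof -
    have "(if s = 1 then p else q) = (p + q) / 2 + (p - q) / 2 * s" if "s = 1 \<or> s = -1" for s :: real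
      using that by (auto simp: field_simps)
    then show ?thesis using label_product[OF assms] .
  qed
  finally show ?thesis .
qed

section \<open>Chernoff bound for the vertex margins\<close>

lemma sum_label_products:
  assumes "i < n"
  shows "(\<Sum>j<n. x $ i * x $ j) = 0"
proof -
  have "all_ones n \<bullet> x = (\<Sum>j<n. x $ j)"
    unfolding scalar_prod_def all_ones_def using balanced_labelsD(1)[OF x]
    by (auto simp: atLeast0LessThan)
  then show ?thesis using balanced_labelsD(2)[OF x] by (simp flip: sum_distrib_left)
qed

text \<open>Chernoff bound: the indicator of \<open>X a < g\<close> is at most
  \<open>exp (t * (g - X a))\<close>, whose expectation factors over the independent edges at vertex
  \<open>i\<close>; then \<open>1 + z \<le> exp z\<close>. The balance of the labels gives
  \<open>n / 2\<close> factors of each kind.\<close>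

lemma margin_tail_single:
  assumes i: "i < n" and t: "0 \<le> t"
  shows "measure_pmf.prob (sbm n p q x) {A. x $ i * (A *\<^sub>v x) $ i < g}
    \<le> exp (t * g + real n / 2 * (p * (exp (- t) - 1) + q * (exp t - 1)))"
proof -
  \<comment> \<open>\<open>row j\<close> is the edge between \<open>i\<close> and \<open>j\<close>,
    ordered as in the index set. It is injective in \<open>j\<close>, so the entries met by vertex
    \<open>i\<close> are independent.\<close>
  define row where "row = (\<lambda>j. (min i j, max i j))"
  have inj: "inj_on row {..<n}"
    unfolding row_def inj_on_def by (auto simp: min_def max_def split: if_splits)
  have row: "row ` {..<n} \<subseteq> edge_set n" using i by (auto simp: row_def edge_set_def)
  have row_prod: "x $ fst (row j) * x $ snd (row j) = x $ i * x $ j" for j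
    by (simp add: row_def min_def max_def mult.commute)
  define X where "X = (\<lambda>a. \<Sum>j<n. x $ i * x $ j * of_bool (a (row j)) :: real)"
  have X: "x $ i * (adj_of a *\<^sub>v x) $ i = X a" for a
    using i carrier_vecD[OF balanced_labelsD(1)[OF x]]
    by (simp add: X_def row_def scalar_prod_def sum_distrib_left atLeast0LessThan ac_simps
      del: sum_mult_of_bool_eq sum_of_bool_mult_eq)
  \<comment> \<open>Edges not at vertex \<open>i\<close> get the factor 1, which extends the product
    to all edges, where independence is available.\<close>
  define f where "f = (\<lambda>e b. if e \<in> row ` {..<n} then exp (- t * (x $ fst e * x $ snd e) * of_bool b) else (1 :: real))"
  have Z: "exp (t * (g - X a)) = exp (t * g) * (\<Prod>e\<in>edge_set n. f e (a e))" for a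
  proof -
    have "(\<Prod>e\<in>edge_set n. f e (a e)) = (\<Prod>e\<in>row ` {..<n}. f e (a e))"
      by (rule prod.mono_neutral_right) (use row in \<open>auto simp: f_def\<close>)
    also have "\<dots> = (\<Prod>j<n. f (row j) (a (row j)))" by (simp add: prod.reindex[OF inj])
    also have "\<dots> = (\<Prod>j<n. exp (- t * (x $ i * x $ j * of_bool (a (row j)))))"
      by (intro prod.cong refl) (auto simp: f_def row_prod mult.assoc)
    also have "\<dots> = exp (- t * X a)"
      by (simp add: exp_sum X_def sum_distrib_left sum_negf[symmetric]
        del: sum_mult_of_bool_eq sum_of_bool_mult_eq sum_negf)
    finally show ?thesis by (simp add: exp_add[symmetric] algebra_simps)
  qed
  have int: "integrable (measure_pmf edges_pmf) h" for h :: "_ \<Rightarrow> real"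
    by (rule integrable_measure_pmf_finite[OF finite_set_edges_pmf])
  have "measure_pmf.prob (sbm n p q x) {A. x $ i * (A *\<^sub>v x) $ i < g} = measure_pmf.prob edges_pmf {a. X a < g}"
    unfolding sbm_alt by (simp add: X vimage_def)
  also have "\<dots> = measure_pmf.expectation edges_pmf (indicator {a. X a < g})" by simp
  also have "\<dots> \<le> measure_pmf.expectation edges_pmf (\<lambda>a. exp (t * (g - X a)))"
    by (rule integral_mono[OF int int]) (use t in \<open>auto split: split_indicator\<close>)
  also have "\<dots> = exp (t * g) * measure_pmf.expectation edges_pmf (\<lambda>a. \<Prod>e\<in>edge_set n. f e (a e))"
    unfolding Z by simp
  also have "measure_pmf.expectation edges_pmf (\<lambda>a. \<Prod>e\<in>edge_set n. f e (a e))
      = (\<Prod>e\<in>edge_set n. measure_pmf.expectation (bernoulli_pmf (edge_prob e)) (f e))"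
    by (rule expectation_prod_Pi_pmf) (auto simp: f_def intro!: integrable_measure_pmf_finite)
  also have "\<dots> = (\<Prod>e\<in>row ` {..<n}. measure_pmf.expectation (bernoulli_pmf (edge_prob e)) (f e))"
  proof (rule prod.mono_neutral_right)
    show "\<forall>e\<in>edge_set n - row ` {..<n}. measure_pmf.expectation (bernoulli_pmf (edge_prob e)) (f e) = 1"
    proof
      fix e assume "e \<in> edge_set n - row ` {..<n}"
      then have "f e = (\<lambda>_. 1)" by (auto simp: f_def)
      then show "measure_pmf.expectation (bernoulli_pmf (edge_prob e)) (f e) = 1" by simp
    qed
  qed (use row in auto)
  also have "\<dots> = (\<Prod>j<n. measure_pmf.expectation (bernoulli_pmf (edge_prob (row j))) (f (row j)))"
    by (simp add: prod.reindex[OF inj])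
  \<comment> \<open>The exponent is affine in the label product, so its sum over \<open>j\<close>
    follows from the label products adding up to 0, without counting the two classes.\<close>
  also have "\<dots> \<le> (\<Prod>j<n. exp ((p * (exp (- t) - 1) + q * (exp t - 1)) / 2
      + (p * (exp (- t) - 1) - q * (exp t - 1)) / 2 * (x $ i * x $ j)))"
  proof (rule prod_mono)
    fix j assume "j \<in> {..<n}"
    then have j: "j < n" by simp
    let ?s = "x $ i * x $ j"
    have pe: "0 \<le> edge_prob (row j)" "edge_prob (row j) \<le> 1" using p q by auto
    have E: "measure_pmf.expectation (bernoulli_pmf (edge_prob (row j))) (f (row j))
      = 1 + edge_prob (row j) * (exp (- t * ?s) - 1)"
      using pe j by (simp add: f_def row_prod algebra_simps)
    have "edge_prob (row j) * (exp (- t * ?s) - 1) = (p * (exp (- t) - 1) + q * (exp t - 1)) / 2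
      + (p * (exp (- t) - 1) - q * (exp t - 1)) / 2 * ?s"
    proof -
      have "(if s = 1 then p else q) * (exp (- t * s) - 1) = (p * (exp (- t) - 1) + q * (exp t - 1)) / 2
        + (p * (exp (- t) - 1) - q * (exp t - 1)) / 2 * s" if "s = 1 \<or> s = -1" for s :: real
        using that by (auto simp: field_simps)
      then show ?thesis using label_product[OF i j] unfolding row_prod .
    qed
    moreover have "0 \<le> 1 + edge_prob (row j) * (exp (- t * ?s) - 1)"
    proof -
      have "0 \<le> (1 - edge_prob (row j)) + edge_prob (row j) * exp (- t * ?s)"
        using pe by (intro add_nonneg_nonneg mult_nonneg_nonneg) auto
      then show ?thesis by (simp add: algebra_simps)
    qed
    ultimately show "0 \<le> measure_pmf.expectation (bernoulli_pmf (edge_prob (row j))) (f (row j)) \<and>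
      measure_pmf.expectation (bernoulli_pmf (edge_prob (row j))) (f (row j))
      \<le> exp ((p * (exp (- t) - 1) + q * (exp t - 1)) / 2
      + (p * (exp (- t) - 1) - q * (exp t - 1)) / 2 * ?s)"
      unfolding E using exp_ge_add_one_self[of "edge_prob (row j) * (exp (- t * ?s) - 1)"] by simp
  qed
  also have "\<dots> = exp (real n / 2 * (p * (exp (- t) - 1) + q * (exp t - 1)))"
  proof -
    have "(\<Sum>j<n. c + d * (x $ i * x $ j)) = real n * c" for c d :: real
      using sum_label_products[OF i] by (simp add: sum.distrib flip: sum_distrib_left)
    then show ?thesis by (simp add: exp_sum[OF finite_lessThan, symmetric] del: times_divide_eq_left)
  qed
  finally show ?thesis by (simp add: exp_add)
qed

lemma margin_tail:
  assumes t: "0 \<le> t"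
  shows "measure_pmf.prob (sbm n p q x) {A. \<exists>i<n. x $ i * (A *\<^sub>v x) $ i < g}
    \<le> real n * exp (t * g + real n / 2 * (p * (exp (- t) - 1) + q * (exp t - 1)))"
proof -
  have "{A. \<exists>i<n. x $ i * (A *\<^sub>v x) $ i < g} = (\<Union>i<n. {A. x $ i * (A *\<^sub>v x) $ i < g})" by auto
  then have "measure_pmf.prob (sbm n p q x) {A. \<exists>i<n. x $ i * (A *\<^sub>v x) $ i < g}
    \<le> (\<Sum>i<n. measure_pmf.prob (sbm n p q x) {A. x $ i * (A *\<^sub>v x) $ i < g})"
    using measure_pmf.finite_measure_subadditive_finite[of "{..<n}" "\<lambda>i. {A. x $ i * (A *\<^sub>v x) $ i < g}" "sbm n p q x"]
    by simp
  also have "\<dots> \<le> (\<Sum>i<n. exp (t * g + real n / 2 * (p * (exp (- t) - 1) + q * (exp t - 1))))"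
    by (intro sum_mono margin_tail_single t) auto
  finally show ?thesis by simp
qed

lemma rank_two_perturbation_sbm:
  assumes n: "0 < n" and qp: "q \<le> p" and A: "A \<in> set_pmf (sbm n p q x)"
    and d: "spectral_norm (A - expected_adj n p q x) \<le> d" "0 \<le> d"
  shows "rank_two_perturbation n A ((1 / sqrt n) \<cdot>\<^sub>v all_ones n) ((1 / sqrt n) \<cdot>\<^sub>v x)
    (n * (p + q) / 2) (n * (p - q) / 2) d"
proof -
  let ?E = "expected_adj n p q x"
  have Ac: "A \<in> carrier_mat n n" "A\<^sup>T = A" using sbm_symmetric[OF A] .
  have Ec: "?E \<in> carrier_mat n n" unfolding expected_adj_def by simp
  have 1: "all_ones n \<in> carrier_vec n" unfolding all_ones_def by simp
  note xD = balanced_labelsD[OF x]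
  have nn: "sqrt n * sqrt n = n" by simp
  define r where "r = 1 / sqrt n"
  have E_mult: "?E *\<^sub>v v = (n * (p + q) / 2 * (((1 / sqrt n) \<cdot>\<^sub>v all_ones n) \<bullet> v)) \<cdot>\<^sub>v ((1 / sqrt n) \<cdot>\<^sub>v all_ones n)
      + (n * (p - q) / 2 * (((1 / sqrt n) \<cdot>\<^sub>v x) \<bullet> v)) \<cdot>\<^sub>v ((1 / sqrt n) \<cdot>\<^sub>v x)"
    if v: "v \<in> carrier_vec n" for v
  proof (rule eq_vecI)
    fix i assume "i < dim_vec ((n * (p + q) / 2 * (((1 / sqrt n) \<cdot>\<^sub>v all_ones n) \<bullet> v)) \<cdot>\<^sub>v ((1 / sqrt n) \<cdot>\<^sub>v all_ones n)
      + (n * (p - q) / 2 * (((1 / sqrt n) \<cdot>\<^sub>v x) \<bullet> v)) \<cdot>\<^sub>v ((1 / sqrt n) \<cdot>\<^sub>v x))"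
    then have i: "i < n" using xD by simp
    have "(?E *\<^sub>v v) $ i = (\<Sum>j = 0..<n. ((p + q) / 2 + (p - q) / 2 * (x $ i * x $ j)) * v $ j)"
      using Ec v i by (auto simp: scalar_prod_def expected_adj_index intro!: sum.cong)
    also have "\<dots> = (p + q) / 2 * (all_ones n \<bullet> v) + (p - q) / 2 * x $ i * (x \<bullet> v)"
      using v by (simp add: scalar_prod_def all_ones_def distrib_right sum.distrib sum_distrib_left mult.assoc)
    \<comment> \<open>The factor \<open>r * r * n = 1\<close> supplies the \<open>n\<close> of the
      eigenvalues and the normalisations of the vectors.\<close>
    also have "\<dots> = (r * r * n) * ((p + q) / 2 * (all_ones n \<bullet> v)) + (r * r * n) * ((p - q) / 2 * x $ i * (x \<bullet> v))"
      using n nn by (simp add: r_def)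
    finally show "(?E *\<^sub>v v) $ i = ((n * (p + q) / 2 * (((1 / sqrt n) \<cdot>\<^sub>v all_ones n) \<bullet> v)) \<cdot>\<^sub>v ((1 / sqrt n) \<cdot>\<^sub>v all_ones n)
      + (n * (p - q) / 2 * (((1 / sqrt n) \<cdot>\<^sub>v x) \<bullet> v)) \<cdot>\<^sub>v ((1 / sqrt n) \<cdot>\<^sub>v x)) $ i"
      using i carrier_vecD[OF 1] carrier_vecD[OF xD(1)] v 1 xD(1)
      unfolding r_def[symmetric] by (simp add: all_ones_def[of n, THEN arg_cong[where f = "\<lambda>v. v $ i"]] algebra_simps)
  qed (use Ec xD in auto)
  have pert: "norm2 (A *\<^sub>v v - ?E *\<^sub>v v) \<le> d * norm2 v" if v: "v \<in> carrier_vec n" for v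
  proof -
    have "A *\<^sub>v v - ?E *\<^sub>v v = (A - ?E) *\<^sub>v v"
      using minus_mult_distrib_mat_vec[OF Ac(1) Ec v] by simp
    then have "norm2 (A *\<^sub>v v - ?E *\<^sub>v v) \<le> spectral_norm (A - ?E) * norm2 v"
      using norm2_mult_le_spectral_norm[OF minus_carrier_mat[OF Ec, of A] v] by simp
    also have "\<dots> \<le> d * norm2 v" using d by (intro mult_right_mono) auto
    finally show ?thesis .
  qed
  have "all_ones n \<bullet> all_ones n = real n" by (simp add: all_ones_def scalar_prod_def)
  then show ?thesis
    using Ac 1 xD nn n p q qp d pert E_mult
    by unfold_locales (auto simp: divide_simps)
qed

end

section \<open>The Gaussian starting matrix\<close>

abbreviation std_gauss :: "real measure" where
  "std_gauss \<equiv> density lborel std_normal_density"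

abbreviation gauss_vec :: "'i set \<Rightarrow> ('i \<Rightarrow> real) measure" where
  "gauss_vec I \<equiv> \<Pi>\<^sub>M i\<in>I. std_gauss"

lemma prob_space_std_gauss: "prob_space std_gauss"
  by (simp add: prob_space_normal_density)

lemma prob_space_gauss_vec: "prob_space (gauss_vec I)"
  by (intro prob_space_PiM prob_space_std_gauss)

lemma sets_gauss_vec: "sets (gauss_vec I) = sets (\<Pi>\<^sub>M i\<in>I. borel)"
  by (intro sets_PiM_cong) simp_all

lemma linear_form_measurable [measurable]: "(\<lambda>w. \<Sum>i\<in>I. v i * w i) \<in> borel_measurable (gauss_vec I)"
proof -
  have "(\<lambda>w. \<Sum>i\<in>I. v i * w i) \<in> borel_measurable (\<Pi>\<^sub>M i\<in>I. borel)"
    by (intro borel_measurable_sum borel_measurable_times borel_measurable_const) simp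
  then show ?thesis by (simp cong: measurable_cong_sets add: sets_gauss_vec)
qed

lemma indep_vars_gauss_vec:
  assumes "I \<noteq> {}"
  shows "prob_space.indep_vars (gauss_vec I) (\<lambda>_. borel) (\<lambda>i w. w i) I"
proof -
  interpret prob_space "gauss_vec I" by (rule prob_space_gauss_vec)
  have "indep_vars (\<lambda>_. std_gauss) (\<lambda>i w. w i) I"
  proof (subst indep_vars_iff_distr_eq_PiM'[OF assms])
    show "(\<lambda>w. w i) \<in> measurable (gauss_vec I) std_gauss" if "i \<in> I" for i
      using that by (rule measurable_component_singleton)
    have "distr (gauss_vec I) (gauss_vec I) (\<lambda>x. \<lambda>i\<in>I. x i) = distr (gauss_vec I) (gauss_vec I) (\<lambda>x. x)"
      by (intro distr_cong) (auto simp: space_PiM)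
    also have "\<dots> = gauss_vec I" by (rule distr_id)
    also have "\<dots> = (\<Pi>\<^sub>M i\<in>I. distr (gauss_vec I) std_gauss (\<lambda>w. w i))"
      by (intro PiM_cong refl) (simp add: distr_PiM_component[OF prob_space_std_gauss])
    finally show "distr (gauss_vec I) (gauss_vec I) (\<lambda>x. \<lambda>i\<in>I. x i) = \<dots>" .
  qed
  then have "indep_vars (\<lambda>_. borel) (\<lambda>i w. (\<lambda>x. x) (w i)) I"
    by (rule indep_vars_compose2) simp
  then show ?thesis by simp
qed

lemma distributed_coordinate:
  assumes "i \<in> I"
  shows "distributed (gauss_vec I) lborel (\<lambda>w. w i) std_normal_density"
proof -
  have m: "(\<lambda>w. w i) \<in> measurable (gauss_vec I) std_gauss"
    using assms by (rule measurable_component_singleton)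
  have "distr (gauss_vec I) lborel (\<lambda>w. w i) = distr (gauss_vec I) std_gauss (\<lambda>w. w i)"
    by (intro distr_cong) simp_all
  also have "\<dots> = std_gauss" using assms by (simp add: distr_PiM_component[OF prob_space_std_gauss])
  finally show ?thesis unfolding distributed_def using m by simp
qed

text \<open>The sum rule for independent normals asks for positive standard deviations, so vanishing
  coefficients are discarded first; the remaining set \<open>J\<close> is nonempty because
  \<open>\<sigma>\<close> is positive.\<close>

lemma distributed_linear_form:
  assumes I: "finite I" and \<sigma>: "(\<Sum>i\<in>I. (v i)\<^sup>2) = \<sigma>\<^sup>2" "0 < \<sigma>"
  shows "distributed (gauss_vec I) lborel (\<lambda>w. \<Sum>i\<in>I. v i * w i) (normal_density 0 \<sigma>)"
proof -
  interpret prob_space "gauss_vec I" by (rule prob_space_gauss_vec)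
  define J where "J = {i \<in> I. v i \<noteq> 0}"
  have J: "finite J" "J \<subseteq> I" unfolding J_def using I by auto
  have sumJ: "(\<Sum>i\<in>J. (v i)\<^sup>2) = \<sigma>\<^sup>2"
    unfolding \<sigma>(1)[symmetric] by (rule sum.mono_neutral_left) (use I in \<open>auto simp: J_def\<close>)
  then have "J \<noteq> {}" using \<sigma>(2) by auto
  then have "I \<noteq> {}" using J by auto
  have "indep_vars (\<lambda>_. borel) (\<lambda>i w. (\<lambda>x. v i * x) (w i)) I"
    by (rule indep_vars_compose2[OF indep_vars_gauss_vec[OF \<open>I \<noteq> {}\<close>]]) simp
  then have ind: "indep_vars (\<lambda>_. borel) (\<lambda>i w. v i * w i) J"
    using J(2) by (rule indep_vars_subset)
  have "distributed (gauss_vec I) lborel (\<lambda>w. v i * w i) (normal_density 0 \<bar>v i\<bar>)" if "i \<in> J" for i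
    using normal_density_affine[OF distributed_coordinate[of i I], of "v i" 0] that
    by (simp add: J_def)
  then have "distributed (gauss_vec I) lborel (\<lambda>w. \<Sum>i\<in>J. v i * w i)
      (normal_density (\<Sum>i\<in>J. 0) (sqrt (\<Sum>i\<in>J. \<bar>v i\<bar>\<^sup>2)))"
    by (intro sum_indep_normal J \<open>J \<noteq> {}\<close> ind) (auto simp: J_def)
  also have "(\<lambda>w. \<Sum>i\<in>J. v i * w i) = (\<lambda>w. \<Sum>i\<in>I. v i * w i)"
    by (intro ext sum.mono_neutral_left) (use I in \<open>auto simp: J_def\<close>)
  finally show ?thesis using \<sigma>(2) by (simp add: sumJ)
qed

text \<open>The density is at most \<open>1 / (2 * \<sigma>)\<close>, since
  \<open>sqrt (2 * pi)\<close> is at least 2, and the interval has length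
  \<open>2 * s\<close>.\<close>

lemma normal_anticoncentration:
  assumes D: "distributed M lborel X (normal_density 0 \<sigma>)" and \<sigma>: "0 < \<sigma>" and s: "0 \<le> s"
  shows "emeasure M {w \<in> space M. \<bar>X w\<bar> < s} \<le> ennreal (s / \<sigma>)"
proof -
  have "{w \<in> space M. \<bar>X w\<bar> < s} = X -` {- s<..<s} \<inter> space M" by auto
  then have "emeasure M {w \<in> space M. \<bar>X w\<bar> < s} = (\<integral>\<^sup>+x. ennreal (normal_density 0 \<sigma> x) * indicator {- s<..<s} x \<partial>lborel)"
    using distributed_emeasure[OF D, of "{- s<..<s}"] by simp
  also have "\<dots> \<le> (\<integral>\<^sup>+x. ennreal (1 / (2 * \<sigma>)) * indicator {- s<..<s} x \<partial>lborel)"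
  proof (intro nn_integral_mono mult_right_mono ennreal_leI)
    fix x :: real
    have "2 * \<sigma> \<le> sqrt (2 * pi * \<sigma>\<^sup>2)"
      using pi_gt3 \<sigma> by (intro real_le_rsqrt) (simp add: power_mult_distrib)
    then have "1 / sqrt (2 * pi * \<sigma>\<^sup>2) \<le> 1 / (2 * \<sigma>)" using \<sigma> by (intro divide_left_mono) auto
    moreover have "exp (- (x - 0)\<^sup>2 / (2 * \<sigma>\<^sup>2)) \<le> 1" by simp
    ultimately show "normal_density 0 \<sigma> x \<le> 1 / (2 * \<sigma>)"
      unfolding normal_density_def using mult_mono[of "1 / sqrt (2 * pi * \<sigma>\<^sup>2)" "1 / (2 * \<sigma>)" "exp (- (x - 0)\<^sup>2 / (2 * \<sigma>\<^sup>2))" 1] \<sigma> by simp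
  qed simp
  also have "\<dots> = ennreal (1 / (2 * \<sigma>)) * ennreal (2 * s)"
    using s by (simp add: nn_integral_cmult)
  also have "\<dots> = ennreal (s / \<sigma>)"
    using \<sigma> s by (simp add: ennreal_mult[symmetric])
  finally show ?thesis .
qed

lemma gauss_second_moment:
  assumes D: "distributed M lborel X (normal_density 0 \<sigma>)" and M: "prob_space M" and \<sigma>: "0 < \<sigma>"
  shows "(\<integral>\<^sup>+w. ennreal ((X w)\<^sup>2) \<partial>M) = ennreal (\<sigma>\<^sup>2)"
proof -
  have m: "(\<lambda>x. ennreal (x\<^sup>2)) \<in> borel_measurable lborel" by measurable
  have "(\<integral>\<^sup>+w. ennreal ((X w)\<^sup>2) \<partial>M) = (\<integral>\<^sup>+x. ennreal (normal_density 0 \<sigma> x) * ennreal (x\<^sup>2) \<partial>lborel)"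
    using distributed_nn_integral[OF D m] by simp
  also have "\<dots> = (\<integral>\<^sup>+x. ennreal (normal_density 0 \<sigma> x * (x - 0) ^ (2 * 1)) \<partial>lborel)"
    by (intro nn_integral_cong) (simp add: ennreal_mult normal_density_nonneg)
  also have "\<dots> = ennreal (fact (2 * 1) / ((2 / \<sigma>\<^sup>2) ^ 1 * fact 1))"
    using normal_moment_even[OF \<sigma>, of 0 1]
    by (intro nn_integral_eq_integral[THEN trans])
      (auto simp: has_bochner_integral_iff normal_density_nonneg)
  finally show ?thesis using \<sigma> by (simp add: fact_numeral)
qed

lemma nn_integral_markov_bound:
  assumes X: "X \<in> borel_measurable M" and E: "(\<integral>\<^sup>+w. ennreal (X w) \<partial>M) \<le> ennreal a" and nn: "\<And>w. 0 \<le> X w" and c: "0 < c" "0 \<le> a"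
  shows "emeasure M {w \<in> space M. c \<le> X w} \<le> ennreal (a / c)"
proof -
  have "emeasure M ({w \<in> space M. 1 \<le> ennreal (1 / c) * ennreal (X w)} \<inter> space M) \<le> ennreal (1 / c) * (\<integral>\<^sup>+w. ennreal (X w) * indicator (space M) w \<partial>M)"
    using nn_integral_Markov_inequality[of "\<lambda>w. ennreal (X w)" "space M" M "ennreal (1 / c)"] X
    by (simp add: Int_absorb2 subset_eq)
  also have "{w \<in> space M. 1 \<le> ennreal (1 / c) * ennreal (X w)} \<inter> space M = {w \<in> space M. c \<le> X w}"
    using c nn by (auto simp: ennreal_mult[symmetric] field_simps simp flip: ennreal_1)
  also have "(\<integral>\<^sup>+w. ennreal (X w) * indicator (space M) w \<partial>M) = (\<integral>\<^sup>+w. ennreal (X w) \<partial>M)"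
    by (intro nn_integral_cong) simp
  also have "ennreal (1 / c) * (\<integral>\<^sup>+w. ennreal (X w) \<partial>M) \<le> ennreal (1 / c) * ennreal a"
    using E by (rule mult_left_mono) simp
  also have "\<dots> = ennreal (a / c)" using c by (simp add: ennreal_mult[symmetric])
  finally show ?thesis .
qed

text \<open>
  Conditionally on the first coordinates \<open>x\<close>, the determinant is a linear form in the second ones,
  with coefficient vector of length at least \<open>\<bar>\<Sum>i. a i * x i\<bar>\<close>.
\<close>

lemma determinant_anticoncentration:
  fixes a b :: "nat \<Rightarrow> real" and n :: nat
  defines "I0 \<equiv> {..<n} \<times> {0 :: nat}" and "I1 \<equiv> {..<n} \<times> {1 :: nat}"
  assumes a: "(\<Sum>i<n. (a i)\<^sup>2) = 1" and b: "(\<Sum>i<n. (b i)\<^sup>2) = 1" and ab: "(\<Sum>i<n. a i * b i) = 0"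
    and s: "0 < s" and \<tau>: "0 \<le> \<tau>"
  shows "emeasure (gauss_vec (I0 \<union> I1)) {w \<in> space (gauss_vec (I0 \<union> I1)).
      \<bar>(\<Sum>i<n. a i * w (i, 0)) * (\<Sum>i<n. b i * w (i, 1)) - (\<Sum>i<n. b i * w (i, 0)) * (\<Sum>i<n. a i * w (i, 1))\<bar> < \<tau>}
    \<le> ennreal (s + \<tau> / s)"
proof -
  interpret product_sigma_finite "\<lambda>_ :: nat \<times> nat. std_gauss"
    by (intro product_sigma_finite.intro prob_space_imp_sigma_finite prob_space_std_gauss)
  have IJ: "I0 \<inter> I1 = {}" "finite I0" "finite I1" unfolding I0_def I1_def by auto
  have reindex: "(\<Sum>i<n. g i * w (i, k)) = (\<Sum>e\<in>{..<n} \<times> {k}. g (fst e) * w e)" for g and w :: "nat \<times> nat \<Rightarrow> real" and k :: nat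
    by (rule sum.reindex_bij_witness[of _ fst "\<lambda>i. (i, k)"]) auto
  have reindex2: "(\<Sum>e\<in>{..<n} \<times> {k :: nat}. (g (fst e))\<^sup>2) = (\<Sum>i<n. (g i :: real)\<^sup>2)" for g k
    by (rule sum.reindex_bij_witness[of _ "\<lambda>i. (i, k)" fst]) auto
  define det where "det = (\<lambda>w :: nat \<times> nat \<Rightarrow> real. (\<Sum>i<n. a i * w (i, 0)) * (\<Sum>i<n. b i * w (i, 1))
    - (\<Sum>i<n. b i * w (i, 0)) * (\<Sum>i<n. a i * w (i, 1)))"
  define B where "B = {w \<in> space (gauss_vec (I0 \<union> I1)). \<bar>det w\<bar> < \<tau>}"
  have coord [measurable]: "(\<lambda>w. w (i, k)) \<in> borel_measurable (gauss_vec (I0 \<union> I1))" if "i < n" "k < 2" for i k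
  proof -
    have "(i, k) \<in> I0 \<union> I1" using that unfolding I0_def I1_def by auto
    then have "(\<lambda>w. w (i, k)) \<in> measurable (gauss_vec (I0 \<union> I1)) std_gauss"
      by (rule measurable_component_singleton)
    then show ?thesis by simp
  qed
  have det_m [measurable]: "det \<in> borel_measurable (gauss_vec (I0 \<union> I1))"
    unfolding det_def
    by (intro borel_measurable_diff borel_measurable_times borel_measurable_sum borel_measurable_const coord) auto
  have B [measurable]: "B \<in> sets (gauss_vec (I0 \<union> I1))" unfolding B_def by measurable
  define A0 where "A0 = {x \<in> space (gauss_vec I0). \<bar>\<Sum>e\<in>I0. a (fst e) * x e\<bar> < s}"
  have A0 [measurable]: "A0 \<in> sets (gauss_vec I0)" unfolding A0_def by measurable
  \<comment> \<open>For a fixed first column \<open>x\<close>, either \<open>x\<close> lies in the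
    exceptional set \<open>A0\<close>, where 1 is a trivial bound, or its linear form along
    \<open>a\<close> is at least \<open>s\<close> in absolute value and the randomness of the second
    column decides.\<close>
  have inner: "(\<integral>\<^sup>+y. indicator B (merge I0 I1 (x, y)) \<partial>gauss_vec I1) \<le> indicator A0 x + ennreal (\<tau> / s)"
    if x: "x \<in> space (gauss_vec I0)" for x
  proof (cases "x \<in> A0")
    case True
    interpret P1: prob_space "gauss_vec I1" by (rule prob_space_gauss_vec)
    have "(\<integral>\<^sup>+y. indicator B (merge I0 I1 (x, y)) \<partial>gauss_vec I1) \<le> (\<integral>\<^sup>+y. 1 \<partial>gauss_vec I1)"
      by (intro nn_integral_mono) (auto split: split_indicator)
    also have "\<dots> = 1" by (simp add: P1.emeasure_space_1)
    finally show ?thesis using True by (simp add: add_increasing2)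
  next
    case False
    define g0 h0 where "g0 = (\<Sum>i<n. a i * x (i, 0))" and "h0 = (\<Sum>i<n. b i * x (i, 0))"
    \<comment> \<open>Orthonormality of \<open>a\<close> and \<open>b\<close> makes the squared
      length of \<open>v\<close> equal to \<open>g0\<^sup>2 + h0\<^sup>2\<close>, which is at least
      \<open>s\<^sup>2\<close>.\<close>
    define v where "v = (\<lambda>i. g0 * b i - h0 * a i)"
    define \<sigma> where "\<sigma> = sqrt (g0\<^sup>2 + h0\<^sup>2)"
    have g0: "s \<le> \<bar>g0\<bar>"
      using False x unfolding A0_def g0_def reindex I0_def by (simp add: not_less)
    also have "\<bar>g0\<bar> \<le> \<sigma>" unfolding \<sigma>_def by (rule real_le_rsqrt) simp
    finally have \<sigma>: "s \<le> \<sigma>" .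
    have "(\<Sum>i<n. (v i)\<^sup>2) = (\<Sum>i<n. g0\<^sup>2 * (b i)\<^sup>2 - 2 * g0 * h0 * (a i * b i) + h0\<^sup>2 * (a i)\<^sup>2)"
      by (intro sum.cong refl) (simp add: v_def power2_eq_square algebra_simps)
    also have "\<dots> = \<sigma>\<^sup>2"
      unfolding \<sigma>_def by (simp add: sum.distrib sum_subtractf a b ab flip: sum_distrib_left)
    finally have v\<sigma>: "(\<Sum>e\<in>I1. (v (fst e))\<^sup>2) = \<sigma>\<^sup>2" unfolding I1_def reindex2 .
    have det: "det (merge I0 I1 (x, y)) = (\<Sum>e\<in>I1. v (fst e) * y e)" for y
    proof -
      have m0: "merge I0 I1 (x, y) (i, 0) = x (i, 0)" and m1: "merge I0 I1 (x, y) (i, 1) = y (i, 1)" if "i < n" for i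
        using that by (auto simp: merge_def I0_def I1_def)
      have "det (merge I0 I1 (x, y)) = g0 * (\<Sum>i<n. b i * y (i, 1)) - h0 * (\<Sum>i<n. a i * y (i, 1))"
        unfolding det_def g0_def h0_def using m0 m1 by (simp cong: sum.cong_simp)
      also have "\<dots> = (\<Sum>i<n. v i * y (i, 1))"
        by (simp add: v_def sum_distrib_left sum_subtractf algebra_simps)
      finally show ?thesis unfolding I1_def reindex .
    qed
    have "(\<integral>\<^sup>+y. indicator B (merge I0 I1 (x, y)) \<partial>gauss_vec I1)
      \<le> (\<integral>\<^sup>+y. indicator {y \<in> space (gauss_vec I1). \<bar>\<Sum>e\<in>I1. v (fst e) * y e\<bar> < \<tau>} y \<partial>gauss_vec I1)"
      by (intro nn_integral_mono) (auto simp: B_def det split: split_indicator)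
    also have "\<dots> = emeasure (gauss_vec I1) {y \<in> space (gauss_vec I1). \<bar>\<Sum>e\<in>I1. v (fst e) * y e\<bar> < \<tau>}"
      by (intro nn_integral_indicator) measurable
    also have "\<dots> \<le> ennreal (\<tau> / \<sigma>)"
      using \<sigma> s by (intro normal_anticoncentration[OF distributed_linear_form[OF IJ(3) v\<sigma>]] \<tau>) auto
    also have "\<dots> \<le> ennreal (\<tau> / s)" using \<sigma> s \<tau> by (intro ennreal_leI divide_left_mono) auto
    finally show ?thesis by (simp add: add_increasing)
  qed
  have "emeasure (gauss_vec (I0 \<union> I1)) B = (\<integral>\<^sup>+w. indicator B w \<partial>gauss_vec (I0 \<union> I1))" by simp
  also have "\<dots> = (\<integral>\<^sup>+x. \<integral>\<^sup>+y. indicator B (merge I0 I1 (x, y)) \<partial>gauss_vec I1 \<partial>gauss_vec I0)"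
    by (rule product_nn_integral_fold[OF IJ]) simp
  also have "\<dots> \<le> (\<integral>\<^sup>+x. indicator A0 x + ennreal (\<tau> / s) \<partial>gauss_vec I0)"
    by (rule nn_integral_mono) (rule inner)
  also have "\<dots> = emeasure (gauss_vec I0) A0 + ennreal (\<tau> / s)"
    using prob_space.emeasure_space_1[OF prob_space_gauss_vec, of I0]
    by (subst nn_integral_add) simp_all
  also have "\<dots> \<le> ennreal (s / 1) + ennreal (\<tau> / s)"
    unfolding A0_def
    by (intro add_right_mono normal_anticoncentration distributed_linear_form IJ)
      (use s a in \<open>auto simp: I0_def reindex2\<close>)
  also have "\<dots> = ennreal (s + \<tau> / s)" using s \<tau> by (simp add: ennreal_plus[symmetric] del: ennreal_plus)
  finally show ?thesis unfolding B_def det_def .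
qed

text \<open>Cramer's rule: the determinant times \<open>(x, y)\<close> is the adjugate applied to
  the image \<open>(u, v)\<close>, and the adjugate has the same Frobenius norm as the matrix. In
  effect the smallest singular value is at least the absolute determinant over the Frobenius
  norm.\<close>

lemma det2_lower_bound:
  fixes g00 g01 g10 g11 x y \<tau> F :: real
  assumes det: "\<tau> \<le> \<bar>g00 * g11 - g10 * g01\<bar>" "0 \<le> \<tau>" and F: "g00\<^sup>2 + g01\<^sup>2 + g10\<^sup>2 + g11\<^sup>2 \<le> F"
  shows "\<tau>\<^sup>2 * (x\<^sup>2 + y\<^sup>2) \<le> F * ((g00 * x + g01 * y)\<^sup>2 + (g10 * x + g11 * y)\<^sup>2)"
proof -
  define D u v where "D = g00 * g11 - g10 * g01" and "u = g00 * x + g01 * y" and "v = g10 * x + g11 * y"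
  have cs: "(a * u - b * v)\<^sup>2 \<le> (a\<^sup>2 + b\<^sup>2) * (u\<^sup>2 + v\<^sup>2)" for a b
  proof -
    have "(a\<^sup>2 + b\<^sup>2) * (u\<^sup>2 + v\<^sup>2) = (a * u - b * v)\<^sup>2 + (a * v + b * u)\<^sup>2" by (simp add: power2_eq_square algebra_simps)
    then show ?thesis by simp
  qed
  have "D * x = g11 * u - g01 * v" "D * y = g00 * v - g10 * u" unfolding D_def u_def v_def by (simp_all add: power2_eq_square algebra_simps)
  then have "D\<^sup>2 * (x\<^sup>2 + y\<^sup>2) = (g11 * u - g01 * v)\<^sup>2 + (g10 * u - g00 * v)\<^sup>2"
    by (simp add: distrib_left power2_commute[of "g10 * u"] flip: power_mult_distrib)
  also have "\<dots> \<le> (g11\<^sup>2 + g01\<^sup>2) * (u\<^sup>2 + v\<^sup>2) + (g10\<^sup>2 + g00\<^sup>2) * (u\<^sup>2 + v\<^sup>2)"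
    by (intro add_mono cs)
  also have "\<dots> = (g00\<^sup>2 + g01\<^sup>2 + g10\<^sup>2 + g11\<^sup>2) * (u\<^sup>2 + v\<^sup>2)" by (simp add: power2_eq_square algebra_simps)
  also have "\<dots> \<le> F * (u\<^sup>2 + v\<^sup>2)" using F by (intro mult_right_mono) auto
  finally have 1: "D\<^sup>2 * (x\<^sup>2 + y\<^sup>2) \<le> F * (u\<^sup>2 + v\<^sup>2)" .
  have "\<tau>\<^sup>2 \<le> D\<^sup>2" using det unfolding D_def[symmetric] by (simp add: abs_le_square_iff[symmetric])
  then have "\<tau>\<^sup>2 * (x\<^sup>2 + y\<^sup>2) \<le> D\<^sup>2 * (x\<^sup>2 + y\<^sup>2)" by (intro mult_right_mono) auto
  then show ?thesis using 1 unfolding u_def v_def by linarith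
qed

text \<open>Three bad sets are removed: the Frobenius norm of \<open>Y\<close> is large
  (\<open>B1\<close>), that of the 2 x 2 matrix of inner products of \<open>u1\<close>,
  \<open>u2\<close> with the columns of \<open>Y\<close> is large (\<open>B2\<close>), or the
  determinant of the latter is small (\<open>B3\<close>). The squared norms have means
  \<open>2 * n\<close> and 4, so Markov's inequality gives \<open>2 / K\<^sup>2\<close> and
  \<open>1 / K\<^sup>2\<close>; the third set is covered by anticoncentration.\<close>

lemma gaussian_frame_event:
  fixes u1 u2 :: "real vec" and K s \<tau> :: real
  assumes n: "0 < n" and u1: "u1 \<in> carrier_vec n" "u1 \<bullet> u1 = 1" and u2: "u2 \<in> carrier_vec n" "u2 \<bullet> u2 = 1"
    and u12: "u1 \<bullet> u2 = 0" and K: "0 < K" and s: "0 < s" and \<tau>: "0 < \<tau>"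
  obtains S where "S \<in> sets (gaussian_entries n)"
    "1 - (3 / K\<^sup>2 + s + \<tau> / s) \<le> measure (gaussian_entries n) S"
    "\<forall>w\<in>S. \<forall>b\<in>carrier_vec 2. norm2 (mat n 2 w *\<^sub>v b) \<le> sqrt n * K * norm2 b"
    "\<forall>w\<in>S. \<forall>b\<in>carrier_vec 2.
      \<tau> / (2 * K) * norm2 b \<le> sqrt ((u1 \<bullet> (mat n 2 w *\<^sub>v b))\<^sup>2 + (u2 \<bullet> (mat n 2 w *\<^sub>v b))\<^sup>2)"
proof -
  define I where "I = {..<n} \<times> {..<2 :: nat}"
  have I: "finite I" and I_alt: "I = {..<n} \<times> {0} \<union> {..<n} \<times> {1}" unfolding I_def by auto
  let ?M = "gauss_vec I"
  have M: "gaussian_entries n = ?M" unfolding gaussian_entries_def I_def ..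
  interpret prob_space ?M by (rule prob_space_gauss_vec)
  have coord [measurable]: "(\<lambda>w. w e) \<in> borel_measurable ?M" if "e \<in> I" for e
    using measurable_component_singleton[OF that, of "\<lambda>_. std_gauss"] by simp
  have coordE: "(\<integral>\<^sup>+w. ennreal ((w e)\<^sup>2) \<partial>?M) = 1" if "e \<in> I" for e
    using gauss_second_moment[OF distributed_coordinate[OF that] prob_space_axioms] by simp
  define G where "G = (\<lambda>(u :: real vec) c w. \<Sum>i<n. u $ i * w (i, c :: nat) :: real)"
  have G_alt: "G u c w = (\<Sum>e\<in>I. (if snd e = c then u $ fst e else 0) * w e)" if "c < 2" for u c w
  proof -
    have "(\<Sum>e\<in>I. (if snd e = c then u $ fst e else 0) * w e) = (\<Sum>e\<in>{..<n} \<times> {c}. u $ fst e * w e)"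
      by (rule sum.mono_neutral_cong_right) (use that in \<open>auto simp: I_def\<close>)
    also have "\<dots> = G u c w"
      unfolding G_def by (rule sum.reindex_bij_witness[of _ "\<lambda>i. (i, c)" fst]) auto
    finally show ?thesis by simp
  qed
  have G_m [measurable]: "G u c \<in> borel_measurable ?M" if "c < 2" for u c
    unfolding G_alt[OF that] by measurable
  have sq: "(\<Sum>i<n. (u $ i)\<^sup>2) = 1" if "u \<in> carrier_vec n" "u \<bullet> u = 1" for u :: "real vec"
    using that by (simp add: scalar_prod_def power2_eq_square atLeast0LessThan)
  have GE: "(\<integral>\<^sup>+w. ennreal ((G u c w)\<^sup>2) \<partial>?M) = 1" if u: "u \<in> carrier_vec n" "u \<bullet> u = 1" and c: "c < 2" for u c
  proof -
    have "(\<Sum>e\<in>I. (if snd e = c then u $ fst e else 0)\<^sup>2) = (\<Sum>e\<in>{..<n} \<times> {c}. (u $ fst e)\<^sup>2)"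
      by (rule sum.mono_neutral_cong_right) (use c in \<open>auto simp: I_def\<close>)
    also have "\<dots> = (\<Sum>i<n. (u $ i)\<^sup>2)"
      by (rule sum.reindex_bij_witness[of _ "\<lambda>i. (i, c)" fst]) auto
    finally have "(\<Sum>e\<in>I. (if snd e = c then u $ fst e else 0)\<^sup>2) = 1\<^sup>2" using sq[OF u] by simp
    from gauss_second_moment[OF distributed_linear_form[OF I this] prob_space_axioms]
    show ?thesis unfolding G_alt[OF c] by simp
  qed
  define X where "X = (\<lambda>w :: nat \<times> nat \<Rightarrow> real. \<Sum>e\<in>I. (w e)\<^sup>2)"
  define F where "F = (\<lambda>w. (G u1 0 w)\<^sup>2 + (G u1 1 w)\<^sup>2 + (G u2 0 w)\<^sup>2 + (G u2 1 w)\<^sup>2)"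
  define D where "D = (\<lambda>w. G u1 0 w * G u2 1 w - G u2 0 w * G u1 1 w)"
  have X_m [measurable]: "X \<in> borel_measurable ?M" unfolding X_def by measurable
  have G4 [measurable]: "G u 0 \<in> borel_measurable ?M" "G u 1 \<in> borel_measurable ?M" for u by (rule G_m; simp)+
  have F_m [measurable]: "F \<in> borel_measurable ?M" unfolding F_def by measurable
  have D_m [measurable]: "D \<in> borel_measurable ?M" unfolding D_def by measurable
  have X0: "0 \<le> X w" and F0: "0 \<le> F w" for w by (simp_all add: X_def F_def sum_nonneg)
  have XE: "(\<integral>\<^sup>+w. ennreal (X w) \<partial>?M) \<le> ennreal (2 * n)"
  proof -
    have "(\<integral>\<^sup>+w. ennreal (X w) \<partial>?M) = (\<Sum>e\<in>I. \<integral>\<^sup>+w. ennreal ((w e)\<^sup>2) \<partial>?M)"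
      unfolding X_def by (subst nn_integral_sum[symmetric]) (auto intro!: nn_integral_cong simp: sum_ennreal)
    also have "\<dots> = of_nat (card I)" using coordE by simp
    finally show ?thesis by (simp add: I_def ennreal_of_nat_eq_real_of_nat mult.commute)
  qed
  have FE: "(\<integral>\<^sup>+w. ennreal (F w) \<partial>?M) \<le> ennreal 4"
  proof -
    have "(\<integral>\<^sup>+w. ennreal (F w) \<partial>?M) = (\<integral>\<^sup>+w. ennreal ((G u1 0 w)\<^sup>2) + ennreal ((G u1 1 w)\<^sup>2)
        + ennreal ((G u2 0 w)\<^sup>2) + ennreal ((G u2 1 w)\<^sup>2) \<partial>?M)"
      unfolding F_def by (simp add: ennreal_plus[symmetric] del: ennreal_plus)
    also have "\<dots> = 1 + 1 + 1 + 1"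
      using GE[OF u1, of 0] GE[OF u1, of 1] GE[OF u2, of 0] GE[OF u2, of 1]
      by (simp add: nn_integral_add)
    finally show ?thesis by simp
  qed
  define B1 where "B1 = {w \<in> space ?M. n * K\<^sup>2 \<le> X w}"
  define B2 where "B2 = {w \<in> space ?M. 4 * K\<^sup>2 \<le> F w}"
  define B3 where "B3 = {w \<in> space ?M. \<bar>D w\<bar> < \<tau>}"
  have B [measurable]: "B1 \<in> sets ?M" "B2 \<in> sets ?M" "B3 \<in> sets ?M"
    unfolding B1_def B2_def B3_def by measurable
  have to_measure: "measure ?M A \<le> a" if "emeasure ?M A \<le> ennreal a" "0 \<le> a" for A a
    using that by (simp add: emeasure_eq_measure)
  have "emeasure ?M B1 \<le> ennreal (2 * n / (n * K\<^sup>2))"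
    unfolding B1_def by (rule nn_integral_markov_bound[OF X_m XE X0]) (use n K in auto)
  then have P1: "measure ?M B1 \<le> 2 / K\<^sup>2" using n K by (intro to_measure) auto
  have "emeasure ?M B2 \<le> ennreal (4 / (4 * K\<^sup>2))"
    unfolding B2_def by (rule nn_integral_markov_bound[OF F_m FE F0]) (use K in auto)
  then have P2: "measure ?M B2 \<le> 1 / K\<^sup>2" using K by (intro to_measure) auto
  have "emeasure ?M B3 \<le> ennreal (s + \<tau> / s)"
    unfolding B3_def D_def G_def I_alt
    by (rule determinant_anticoncentration) (use sq[OF u1] sq[OF u2] u1 u2 u12 s \<tau> in \<open>auto simp: scalar_prod_def atLeast0LessThan\<close>)
  then have P3: "measure ?M B3 \<le> s + \<tau> / s" using s \<tau> by (intro to_measure) auto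
  define S where "S = space ?M - (B1 \<union> B2 \<union> B3)"
  have S_m: "S \<in> sets ?M" unfolding S_def by measurable
  have "measure ?M (B1 \<union> B2 \<union> B3) \<le> measure ?M B1 + measure ?M B2 + measure ?M B3"
    using measure_Un_le[of "B1 \<union> B2" ?M B3] measure_Un_le[of B1 ?M B2] B by fastforce
  also have "\<dots> \<le> 2 / K\<^sup>2 + 1 / K\<^sup>2 + (s + \<tau> / s)" using P1 P2 P3 by linarith
  finally have "measure ?M (B1 \<union> B2 \<union> B3) \<le> 3 / K\<^sup>2 + s + \<tau> / s" by (simp add: field_simps)
  then have S_prob: "1 - (3 / K\<^sup>2 + s + \<tau> / s) \<le> measure ?M S"
    unfolding S_def using prob_compl[of "B1 \<union> B2 \<union> B3"] B by simp
  have mult: "(mat n 2 w *\<^sub>v b) $ i = w (i, 0) * b $ 0 + w (i, 1) * b $ 1"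
    if "b \<in> carrier_vec 2" "i < n" for w b i
    using that by (simp add: scalar_prod_def numeral_2_eq_2)
  have nb: "(norm2 b)\<^sup>2 = (b $ 0)\<^sup>2 + (b $ 1)\<^sup>2" if "b \<in> carrier_vec 2" for b
    unfolding norm2_power2 using that by (simp add: scalar_prod_def numeral_2_eq_2 power2_eq_square)
  have norm: "norm2 (mat n 2 w *\<^sub>v b) \<le> sqrt n * K * norm2 b" if w: "w \<in> S" and b: "b \<in> carrier_vec 2" for w b
  proof (rule power2_le_imp_le)
    have "(norm2 (mat n 2 w *\<^sub>v b))\<^sup>2 = (\<Sum>i<n. (w (i, 0) * b $ 0 + w (i, 1) * b $ 1)\<^sup>2)"
      unfolding norm2_power2 scalar_prod_def using mult[OF b]
      by (simp add: power2_eq_square atLeast0LessThan del: index_mult_mat_vec)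
    also have "\<dots> \<le> (\<Sum>i<n. ((w (i, 0))\<^sup>2 + (w (i, 1))\<^sup>2) * (norm2 b)\<^sup>2)"
    proof (rule sum_mono)
      fix i
      have "((w (i, 0))\<^sup>2 + (w (i, 1))\<^sup>2) * (norm2 b)\<^sup>2
        = (w (i, 0) * b $ 0 + w (i, 1) * b $ 1)\<^sup>2 + (w (i, 0) * b $ 1 - w (i, 1) * b $ 0)\<^sup>2"
        unfolding nb[OF b] by (simp add: power2_eq_square algebra_simps)
      then show "(w (i, 0) * b $ 0 + w (i, 1) * b $ 1)\<^sup>2 \<le> ((w (i, 0))\<^sup>2 + (w (i, 1))\<^sup>2) * (norm2 b)\<^sup>2" by simp
    qed
    also have "\<dots> = X w * (norm2 b)\<^sup>2"
    proof -
      have "X w = (\<Sum>i<n. \<Sum>k<2. (w (i, k))\<^sup>2)" unfolding X_def I_def by (simp add: sum.cartesian_product)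
      then show ?thesis by (simp add: sum_distrib_right numeral_2_eq_2)
    qed
    also have "\<dots> \<le> (n * K\<^sup>2) * (norm2 b)\<^sup>2"
      using w unfolding S_def B1_def by (intro mult_right_mono) auto
    also have "\<dots> = (sqrt n * K * norm2 b)\<^sup>2" by (simp add: power_mult_distrib)
    finally show "(norm2 (mat n 2 w *\<^sub>v b))\<^sup>2 \<le> (sqrt n * K * norm2 b)\<^sup>2" .
  qed (use K in auto)
  have frame: "\<tau> / (2 * K) * norm2 b \<le> sqrt ((u1 \<bullet> (mat n 2 w *\<^sub>v b))\<^sup>2 + (u2 \<bullet> (mat n 2 w *\<^sub>v b))\<^sup>2)"
    if w: "w \<in> S" and b: "b \<in> carrier_vec 2" for w b
  proof (rule real_le_rsqrt)
    have ip: "u \<bullet> (mat n 2 w *\<^sub>v b) = G u 0 w * b $ 0 + G u 1 w * b $ 1" if "u \<in> carrier_vec n" for u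
      unfolding G_def using that mult[OF b]
      by (simp add: scalar_prod_def[of u] atLeast0LessThan sum_distrib_left sum.distrib distrib_left ac_simps
        del: index_mult_mat_vec)
    have "\<tau>\<^sup>2 * ((b $ 0)\<^sup>2 + (b $ 1)\<^sup>2) \<le> (4 * K\<^sup>2) * ((u1 \<bullet> (mat n 2 w *\<^sub>v b))\<^sup>2 + (u2 \<bullet> (mat n 2 w *\<^sub>v b))\<^sup>2)"
      unfolding ip[OF u1(1)] ip[OF u2(1)]
      by (rule det2_lower_bound) (use w \<tau> in \<open>auto simp: S_def B2_def B3_def D_def F_def not_less not_le less_imp_le\<close>)
    then show "(\<tau> / (2 * K) * norm2 b)\<^sup>2 \<le> (u1 \<bullet> (mat n 2 w *\<^sub>v b))\<^sup>2 + (u2 \<bullet> (mat n 2 w *\<^sub>v b))\<^sup>2"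
      using K unfolding nb[OF b, symmetric] by (simp add: power_mult_distrib power_divide field_simps)
  qed
  show ?thesis
    by (rule that[of S]) (use S_m S_prob norm frame in \<open>auto simp: M\<close>)
qed

text \<open>The event is the union of the rectangles \<open>{A} \<times> S A\<close> over the
  finitely many good \<open>A\<close> in the support. So it is measurable however irregularly
  \<open>S A\<close> depends on \<open>A\<close>.\<close>

lemma pmf_pair_event:
  fixes P :: "'a pmf" and N :: "'b measure"
  assumes N: "prob_space N" and fin: "finite (set_pmf P)"
    and good: "1 - \<epsilon>1 \<le> measure_pmf.prob P Gd"
    and S: "\<And>A. A \<in> set_pmf P \<Longrightarrow> A \<in> Gd \<Longrightarrow> S A \<in> sets N \<and> 1 - \<epsilon>2 \<le> measure N (S A)"
    and \<epsilon>2: "0 \<le> \<epsilon>2"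
  shows "\<exists>E\<in>sets (measure_pmf P \<Otimes>\<^sub>M N). 1 - (\<epsilon>1 + \<epsilon>2) \<le> measure (measure_pmf P \<Otimes>\<^sub>M N) E \<and>
    (\<forall>(A, w)\<in>E. A \<in> set_pmf P \<and> A \<in> Gd \<and> w \<in> S A)"
proof -
  interpret N: prob_space N by (rule N)
  interpret pair_prob_space "measure_pmf P" N ..
  let ?M = "measure_pmf P \<Otimes>\<^sub>M N"
  define T where "T = set_pmf P \<inter> Gd"
  have T: "finite T" unfolding T_def using fin by simp
  define E where "E = (\<Union>A\<in>T. {A} \<times> S A)"
  have sets: "{A} \<times> S A \<in> sets ?M" if "A \<in> T" for A
    using S[of A] that unfolding T_def by (intro pair_measureI) auto
  have "measure ?M E = (\<Sum>A\<in>T. measure ?M ({A} \<times> S A))"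
    unfolding E_def using sets by (intro P.finite_measure_finite_Union T) (auto simp: disjoint_family_on_def)
  also have "\<dots> = (\<Sum>A\<in>T. pmf P A * measure N (S A))"
  proof (rule sum.cong[OF refl])
    fix A assume "A \<in> T"
    then have "S A \<in> sets N" using S[of A] unfolding T_def by simp
    then have "emeasure ?M ({A} \<times> S A) = emeasure (measure_pmf P) {A} * emeasure N (S A)"
      by (intro N.emeasure_pair_measure_Times) auto
    then show "measure ?M ({A} \<times> S A) = pmf P A * measure N (S A)"
      by (simp add: measure_def enn2real_mult pmf.rep_eq)
  qed
  also have "\<dots> \<ge> (\<Sum>A\<in>T. pmf P A * (1 - \<epsilon>2))"
    using S unfolding T_def by (intro sum_mono mult_left_mono) auto
  finally have 1: "(\<Sum>A\<in>T. pmf P A) * (1 - \<epsilon>2) \<le> measure ?M E" by (simp add: sum_distrib_right)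
  have "(\<Sum>A\<in>T. pmf P A) = measure_pmf.prob P T" using T by (simp add: measure_measure_pmf_finite)
  also have "\<dots> = measure_pmf.prob P Gd"
    unfolding T_def by (metis Int_commute measure_Int_set_pmf)
  finally have 2: "(\<Sum>A\<in>T. pmf P A) = measure_pmf.prob P Gd" .
  have "measure_pmf.prob P Gd * \<epsilon>2 \<le> 1 * \<epsilon>2" using \<epsilon>2 by (intro mult_right_mono) auto
  then have "1 - (\<epsilon>1 + \<epsilon>2) \<le> measure ?M E" using 1 good unfolding 2 by (simp add: algebra_simps)
  moreover have "E \<in> sets ?M" unfolding E_def using sets T by auto
  ultimately show ?thesis unfolding E_def T_def by (intro bexI[of _ "\<Union>A\<in>set_pmf P \<inter> Gd. {A} \<times> S A"]) auto
qed

section \<open>The good event\<close>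

text \<open>This \<open>t\<close> minimises \<open>\<alpha> * exp (- t) + \<beta> * exp t\<close>,
  with value \<open>2 * sqrt \<alpha> * sqrt \<beta>\<close>; hence the square of
  \<open>sqrt \<alpha> - sqrt \<beta>\<close>. The margin adds \<open>t * (\<gamma> * L)\<close>,
  the logarithmic term in the condition on \<open>\<gamma>\<close>.\<close>

lemma margin_exponent:
  fixes \<alpha> \<beta> \<gamma> L N :: real
  assumes \<beta>: "0 < \<beta>" "\<beta> < \<alpha>" and N: "0 < N"
  defines "t \<equiv> (ln \<alpha> - ln \<beta>) / 2"
  shows "t * (\<gamma> * L) + N / 2 * (\<alpha> * L / N * (exp (- t) - 1) + \<beta> * L / N * (exp t - 1))
    = - L * ((sqrt \<alpha> - sqrt \<beta>)\<^sup>2 / 2 - \<gamma> * (ln \<alpha> - ln \<beta>) / 2)"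
proof -
  have \<alpha>: "0 < \<alpha>" using \<beta> by simp
  have "t = ln (sqrt \<alpha> / sqrt \<beta>)" unfolding t_def using \<alpha> \<beta> by (simp add: ln_div ln_sqrt field_simps)
  then have e: "exp t = sqrt \<alpha> / sqrt \<beta>" using \<alpha> \<beta> by simp
  have "\<alpha> * exp (- t) = sqrt \<alpha> * sqrt \<beta>"
    using \<alpha> \<beta> real_sqrt_mult_self[of \<alpha>] by (simp add: exp_minus e field_simps)
  moreover have "\<beta> * exp t = sqrt \<alpha> * sqrt \<beta>"
    using \<alpha> \<beta> real_sqrt_mult_self[of \<beta>] by (simp add: e field_simps)
  moreover have "N / 2 * (\<alpha> * L / N * (exp (- t) - 1) + \<beta> * L / N * (exp t - 1))
    = L / 2 * (\<alpha> * exp (- t) - \<alpha> + \<beta> * exp t - \<beta>)"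
    using N by (simp add: field_simps)
  ultimately have "N / 2 * (\<alpha> * L / N * (exp (- t) - 1) + \<beta> * L / N * (exp t - 1))
    = L / 2 * (2 * (sqrt \<alpha> * sqrt \<beta>) - \<alpha> - \<beta>)" by simp
  also have "\<dots> = - L * ((sqrt \<alpha> - sqrt \<beta>)\<^sup>2 / 2)"
    using \<alpha> \<beta> by (simp add: power2_diff field_simps)
  finally show ?thesis by (simp add: t_def field_simps)
qed

text \<open>All requirements on the size of \<open>n\<close> appear as inequalities between numbers,
  so that the asymptotics can be settled separately. The three terms of the failure probability
  belong to the spectral norm, the vertex margins and the Gaussian matrix.\<close>

lemma recovery_event:
  fixes \<alpha> \<beta> \<gamma> c1 c2 p q L d l2 g \<zeta> \<xi> \<epsilon> \<eta> \<delta> \<theta> :: real and n N M K :: nat and xs :: "real vec"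
  assumes L_def: "L = ln (real n)" and d_def: "d = c1 * sqrt L"
    and l2_def: "l2 = (\<alpha> - \<beta>) / 2 * L" and g_def: "g = \<gamma> * L"
    and \<beta>: "0 < \<beta>" "\<beta> < \<alpha>" and c1: "1 \<le> c1" and conc: "adj_concentration \<alpha> \<beta> c1 c2"
    and n: "even n" "2 \<le> n" and xs: "xs \<in> balanced_labels n"
    and p: "p = \<alpha> * ln (real n) / real n" "p \<le> 1" and q: "q = \<beta> * ln (real n) / real n"
    and \<zeta>: "\<zeta> = (sqrt \<alpha> - sqrt \<beta>)\<^sup>2 / 2 - \<gamma> * (ln \<alpha> - ln \<beta>) / 2 - 1"
    and N: "0 < N" and dominant: "2 * (sqrt 2 * d) \<le> l2"
    and decay: "(sqrt 2 * d / (l2 - sqrt 2 * d)) ^ N \<le> 1 / n"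
    and \<xi>: "4 * n powr (- 1 / 4) \<le> \<xi>" and \<epsilon>: "sqrt 2 * d / (l2 - sqrt 2 * d) + \<xi> \<le> \<epsilon>"
    and \<eta>: "\<eta> = (l2 * \<epsilon>\<^sup>2 + d) / (\<beta> * L)"
    and small: "2 * (sqrt (\<eta>\<^sup>2 + 2 * \<eta>) + \<epsilon>\<^sup>2) \<le> \<delta>" "\<delta> < 2"
    and ppm_gap: "l2 * \<delta> / 4 < g / 2"
    and \<theta>: "0 \<le> \<theta>" "\<theta> < 1" "d \<le> \<theta> * (g / 2 - l2 * \<delta> / 4)"
    and M: "1 \<le> M" "\<theta> ^ M * sqrt (\<delta> * n) < 2" "M + 1 \<le> K"
  shows "\<exists>E\<in>sets (model_space n p q xs).
    1 - (c2 / real n ^ 3 + real n powr (- \<zeta>) + 5 * real n powr (- 1 / 16)) \<le> measure (model_space n p q xs) E \<and>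
    (\<forall>(A, w)\<in>E. finds_labels n xs N K A (mat n 2 w))"
proof -
  have n0: "0 < real n" and n1: "1 < real n" using n by auto
  have L: "0 < L" unfolding L_def using n1 by simp
  have d: "0 < d" unfolding d_def using c1 L by simp
  have pq: "0 \<le> p" "p \<le> 1" "0 \<le> q" "q \<le> 1" "q \<le> p"
  proof -
    show "0 \<le> p" "0 \<le> q" unfolding p(1) q using \<beta> n1 by auto
    show "q \<le> p" unfolding p(1) q using \<beta> n1 by (intro divide_right_mono mult_right_mono) auto
    then show "q \<le> 1" "p \<le> 1" using p(2) by auto
  qed
  have eig: "n * (p + q) / 2 = (\<alpha> + \<beta>) / 2 * L" "n * (p - q) / 2 = l2"
    unfolding p(1) q l2_def L_def using n0 by (simp_all add: field_simps)
  let ?P = "sbm n p q xs"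
  define Gd where "Gd = {A. spectral_norm (A - expected_adj n p q xs) \<le> d} - {A. \<exists>i<n. xs $ i * (A *\<^sub>v xs) $ i < g}"
  define t where "t = (ln \<alpha> - ln \<beta>) / 2"
  have good: "1 - (c2 / real n ^ 3 + real n powr (- \<zeta>)) \<le> measure_pmf.prob ?P Gd"
  proof -
    have "1 - c2 / real n ^ 3 \<le> measure_pmf.prob ?P {A. spectral_norm (A - expected_adj n p q xs) \<le> d}"
      using conc n xs p q unfolding adj_concentration_def Let_def d_def L_def by blast
    moreover have "measure_pmf.prob ?P {A. \<exists>i<n. xs $ i * (A *\<^sub>v xs) $ i < g} \<le> real n powr (- \<zeta>)"
    proof -
      have "measure_pmf.prob ?P {A. \<exists>i<n. xs $ i * (A *\<^sub>v xs) $ i < g}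
        \<le> real n * exp (t * g + real n / 2 * (p * (exp (- t) - 1) + q * (exp t - 1)))"
        by (rule margin_tail[OF pq(1-4) xs]) (use \<beta> in \<open>simp add: t_def\<close>)
      \<comment> \<open>The 1 in \<open>\<zeta> + 1\<close> pays for the union bound over the
        \<open>n\<close> vertices.\<close>
      also have "t * g + real n / 2 * (p * (exp (- t) - 1) + q * (exp t - 1)) = - L * (\<zeta> + 1)"
        using margin_exponent[OF \<beta> n0, of \<gamma> L] unfolding p(1) q g_def t_def L_def[symmetric] \<zeta> by simp
      also have "real n * exp (- L * (\<zeta> + 1)) = real n powr (- \<zeta>)"
        using n0 unfolding L_def by (simp add: powr_def exp_add exp_diff exp_minus algebra_simps inverse_eq_divide)
      finally show ?thesis .
    qed
    moreover have "measure_pmf.prob ?P {A. spectral_norm (A - expected_adj n p q xs) \<le> d}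
      \<le> measure_pmf.prob ?P Gd + measure_pmf.prob ?P {A. \<exists>i<n. xs $ i * (A *\<^sub>v xs) $ i < g}"
      by (rule order_trans[OF measure_pmf.finite_measure_mono measure_Un_le]) (auto simp: Gd_def)
    ultimately show ?thesis by linarith
  qed
  define e1 e2 where "e1 = (1 / sqrt n) \<cdot>\<^sub>v all_ones n" and "e2 = (1 / sqrt n) \<cdot>\<^sub>v xs"
  define \<kappa> \<mu> where "\<kappa> = sqrt 2 * d" and "\<mu> = l2 - sqrt 2 * d"
  have ex: "\<exists>S. S \<in> sets (gaussian_entries n) \<and> 1 - 5 * real n powr (- 1 / 16) \<le> measure (gaussian_entries n) S \<and>
      (\<forall>w\<in>S. finds_labels n xs N K A (mat n 2 w))"
    if AP: "A \<in> set_pmf ?P" "A \<in> Gd" for A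
  proof -
    have R: "rank_two_perturbation n A e1 e2 ((\<alpha> + \<beta>) / 2 * L) l2 d"
      using rank_two_perturbation_sbm[OF pq(1-4) xs _ pq(5) AP(1), of d] AP(2) n d
      unfolding Gd_def e1_def e2_def eig by auto
    interpret rank_two_perturbation n A e1 e2 "(\<alpha> + \<beta>) / 2 * L" l2 d by (rule R)
    interpret dominant_block n A e1 e2 "(\<alpha> + \<beta>) / 2 * L" l2 d \<kappa> \<mu>
    proof
      have "0 < sqrt 2 * d" using d by simp
      then show "\<kappa> \<le> \<mu>" "0 < \<mu>" using dominant unfolding \<kappa>_def \<mu>_def by linarith+
    qed (simp_all add: \<kappa>_def \<mu>_def)
    have margin: "g \<le> xs $ i * (A *\<^sub>v xs) $ i" if "i < n" for i
    proof -
      have "\<not> (\<exists>i<n. xs $ i * (A *\<^sub>v xs) $ i < g)" using AP(2) unfolding Gd_def by simp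
      then show ?thesis using that by (meson not_less)
    qed
    obtain u1 u2 where u: "u1 \<in> carrier_vec n" "u2 \<in> carrier_vec n" "u1 \<bullet> u1 = 1" "u2 \<bullet> u2 = 1" "u1 \<bullet> u2 = 0"
      and cap: "\<forall>v\<in>carrier_vec n. \<forall>\<xi>. 0 < (u1 \<bullet> v)\<^sup>2 + (u2 \<bullet> v)\<^sup>2 \<longrightarrow>
       2 * (\<kappa> / \<mu>) ^ N * norm2 v \<le> \<xi> * sqrt ((u1 \<bullet> v)\<^sup>2 + (u2 \<bullet> v)\<^sup>2) \<longrightarrow>
       mat_iter A N v \<noteq> 0\<^sub>v n \<and> perp (mat_iter A N v) \<le> (\<kappa> / \<mu> + \<xi>) * norm2 (mat_iter A N v)"
      by (rule iterate_captured[OF N])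
    \<comment> \<open>With thresholds \<open>k\<close>, \<open>1 / k\<close> and
      \<open>1 / k^2\<close> for norms, linear form and determinant, the Gaussian failure is at most
      \<open>5 / k\<close>. Per unit of \<open>norm2 b\<close>, the decayed length is at most
      \<open>2 / n * sqrt n * k = 2 / k^7\<close> and the captured one at least
      \<open>1 / (2 * k^3)\<close>: a ratio of \<open>4 / k^4 = 4 * n^(-1/4)\<close>, the bound
      assumed for \<open>\<xi>\<close>.\<close>
    define k where "k = real n powr (1 / 16)"
    have k: "0 < k" unfolding k_def using n0 by simp
    have k16: "real n = k ^ 16" and k4: "real n powr (- 1 / 4) = 1 / k ^ 4"
      unfolding k_def using n0 by (simp_all add: powr_power flip: powr_minus_divide)
    have sqrt_n: "sqrt n = k ^ 8"
      by (rule real_sqrt_unique) (use k in \<open>simp_all add: k16 flip: power_mult\<close>)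
    have \<xi>0: "0 \<le> \<xi>" using \<xi> powr_ge_zero[of "real n" "- 1 / 4"] by linarith
    have decay': "(\<kappa> / \<mu>) ^ N \<le> 1 / n" using decay unfolding \<kappa>_def \<mu>_def .
    have n_pos: "0 < n" and k_pos: "0 < 1 / k" "0 < 1 / k\<^sup>2" using n k by simp_all
    obtain S where S: "S \<in> sets (gaussian_entries n)"
      "1 - (3 / k\<^sup>2 + 1 / k + (1 / k\<^sup>2) / (1 / k)) \<le> measure (gaussian_entries n) S"
      and S_norm: "\<forall>w\<in>S. \<forall>b\<in>carrier_vec 2. norm2 (mat n 2 w *\<^sub>v b) \<le> sqrt n * k * norm2 b"
      and S_frame: "\<forall>w\<in>S. \<forall>b\<in>carrier_vec 2.
        (1 / k\<^sup>2) / (2 * k) * norm2 b \<le> sqrt ((u1 \<bullet> (mat n 2 w *\<^sub>v b))\<^sup>2 + (u2 \<bullet> (mat n 2 w *\<^sub>v b))\<^sup>2)"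
      by (rule gaussian_frame_event[OF n_pos u(1,3) u(2,4) u(5) k k_pos])
    have k1: "1 \<le> k" unfolding k_def using n1 by (simp add: ge_one_powr_ge_zero)
    have prob: "1 - 5 * real n powr (- 1 / 16) \<le> measure (gaussian_entries n) S"
    proof -
      have "real n powr (- 1 / 16) = 1 / k" unfolding k_def by (simp add: powr_minus_divide)
      moreover have "3 / k\<^sup>2 \<le> 3 / k" using k1 by (intro divide_left_mono) (auto simp: power2_eq_square)
      moreover have "(1 / k\<^sup>2) / (1 / k) = 1 / k" using k by (simp add: power2_eq_square)
      ultimately show ?thesis using S(2) by (simp add: add_divide_distrib)
    qed
    have "finds_labels n xs N K A (mat n 2 w)" if w: "w \<in> S" for w
    proof (rule finds_labelsI[OF xs _ e1_def e2_def _ N, where g = g and \<epsilon> = \<epsilon> and \<eta> = \<eta> and \<delta> = \<delta> and \<theta> = \<theta> and M = M])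
      fix b :: "real vec" assume b: "b \<in> carrier_vec 2" "b \<noteq> 0\<^sub>v 2"
      let ?v = "mat n 2 w *\<^sub>v b"
      let ?r = "sqrt ((u1 \<bullet> ?v)\<^sup>2 + (u2 \<bullet> ?v)\<^sup>2)"
      have v: "?v \<in> carrier_vec n" by (rule mult_mat_vec_carrier[of _ n 2]) (use b in auto)
      have nb: "0 < norm2 b" using norm2_eq_0_iff[OF b(1)] b(2) by (metis norm2_nonneg order_less_le)
      have "0 < (1 / k\<^sup>2) / (2 * k) * norm2 b" using nb k by simp
      then have "0 < ?r" using S_frame[rule_format, OF w b(1)] by linarith
      then have r: "0 < (u1 \<bullet> ?v)\<^sup>2 + (u2 \<bullet> ?v)\<^sup>2" by (simp only: real_sqrt_gt_0_iff)
      have "2 * (\<kappa> / \<mu>) ^ N * norm2 ?v \<le> 2 * (1 / n) * (sqrt n * k * norm2 b)"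
        using decay' S_norm[rule_format, OF w b(1)] by (intro mult_mono mult_left_mono) auto
      also have "\<dots> = 4 / k ^ 4 * ((1 / k\<^sup>2) / (2 * k) * norm2 b)"
        unfolding sqrt_n unfolding k16 using k by (simp add: field_simps eval_nat_numeral)
      also have "\<dots> \<le> \<xi> * ((1 / k\<^sup>2) / (2 * k) * norm2 b)"
      proof (rule mult_right_mono)
        show "4 / k ^ 4 \<le> \<xi>" using \<xi> unfolding k4 by simp
      qed (use k nb in simp)
      also have "\<dots> \<le> \<xi> * ?r"
        using S_frame[rule_format, OF w b(1)] \<xi>0 by (rule mult_left_mono)
      finally have "2 * (\<kappa> / \<mu>) ^ N * norm2 ?v \<le> \<xi> * ?r" .
      with cap v r have 1: "mat_iter A N ?v \<noteq> 0\<^sub>v n"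
        and 2: "perp (mat_iter A N ?v) \<le> (\<kappa> / \<mu> + \<xi>) * norm2 (mat_iter A N ?v)" by blast+
      have "(\<kappa> / \<mu> + \<xi>) * norm2 (mat_iter A N ?v) \<le> \<epsilon> * norm2 (mat_iter A N ?v)"
        using \<epsilon> unfolding \<kappa>_def \<mu>_def by (intro mult_right_mono) auto
      then show "mat_iter A N ?v \<noteq> 0\<^sub>v n \<and> perp (mat_iter A N ?v) \<le> \<epsilon> * norm2 (mat_iter A N ?v)"
        using 1 2 by linarith
    next
      show "l2 < (\<alpha> + \<beta>) / 2 * L" unfolding l2_def using \<beta> L by (intro mult_strict_right_mono) auto
      have "(\<alpha> + \<beta>) / 2 * L - l2 = \<beta> * L" unfolding l2_def by (simp add: field_simps)
      then show "\<eta> = (l2 * \<epsilon>\<^sup>2 + d) / ((\<alpha> + \<beta>) / 2 * L - l2)" using \<eta> by simp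
    qed (use n margin small ppm_gap \<theta> M in auto)
    then show ?thesis using S(1) prob by blast
  qed
  \<comment> \<open>The frame \<open>u1\<close>, \<open>u2\<close> depends on \<open>A\<close>,
    hence so does the Gaussian event; it is chosen for each graph separately.\<close>
  then obtain S where S: "\<And>A. A \<in> set_pmf ?P \<Longrightarrow> A \<in> Gd \<Longrightarrow> S A \<in> sets (gaussian_entries n) \<and>
      1 - 5 * real n powr (- 1 / 16) \<le> measure (gaussian_entries n) (S A) \<and>
      (\<forall>w\<in>S A. finds_labels n xs N K A (mat n 2 w))"
    by metis
  have ps: "prob_space (gaussian_entries n)"
    unfolding gaussian_entries_def by (rule prob_space_gauss_vec)
  have "\<exists>E\<in>sets (model_space n p q xs). 1 - ((c2 / real n ^ 3 + real n powr (- \<zeta>)) + 5 * real n powr (- 1 / 16))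
      \<le> measure (model_space n p q xs) E \<and> (\<forall>(A, w)\<in>E. A \<in> set_pmf ?P \<and> A \<in> Gd \<and> w \<in> S A)"
    unfolding model_space_def
    by (rule pmf_pair_event[OF ps finite_set_sbm[OF pq(1-4) xs] good]) (use S in auto)
  then show ?thesis using S by fastforce
qed

section \<open>Iteration counts\<close>

lemma nat_ceiling_powr_bound:
  fixes a y :: real
  assumes "1 < y" "0 < a"
  shows "(1 / y) ^ nat \<lceil>a / ln y\<rceil> \<le> exp (- a)"
proof -
  have ly: "0 < ln y" using assms by simp
  have "a / ln y \<le> real (nat \<lceil>a / ln y\<rceil>)" by (rule real_nat_ceiling_ge)
  then have "a \<le> real (nat \<lceil>a / ln y\<rceil>) * ln y" using ly by (simp add: field_simps)
  then have "exp a \<le> exp (real (nat \<lceil>a / ln y\<rceil>) * ln y)" by simp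
  also have "\<dots> = y ^ nat \<lceil>a / ln y\<rceil>"
    unfolding exp_of_nat_mult using assms by simp
  finally have "1 / y ^ nat \<lceil>a / ln y\<rceil> \<le> 1 / exp a"
    using assms by (intro divide_left_mono) simp_all
  then show ?thesis by (simp add: power_one_over exp_minus inverse_eq_divide)
qed

text \<open>The denominator is \<open>2 * ln y\<close> with \<open>y = D * sqrt (ln n)\<close>, so
  halving numerator and denominator makes the count the ceiling of \<open>a / ln y\<close> with
  \<open>a\<close> at least \<open>ln n\<close>. Since \<open>r\<close> is at most
  \<open>1 / y\<close>, that many factors reach \<open>1 / n\<close>.\<close>

lemma orth_iters_decay:
  fixes \<alpha> \<beta> c1 c3 C D :: real
  defines "C \<equiv> (16 * \<alpha> + 18 * \<beta>) / (\<beta> * min 1 c3)" and "D \<equiv> (\<alpha> - \<beta>) / (4 * c1)"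
  assumes pos: "0 < D" "0 < C" "1 < real n" "1 < ln (real n)" and num: "0 \<le> ln (ln (real n)) + 2 * ln C"
    and large: "1 < D * sqrt (ln (real n))" and r: "0 \<le> r" "r \<le> 1 / (D * sqrt (ln (real n)))"
  shows "r ^ orth_iters \<alpha> \<beta> c1 c3 n \<le> 1 / n" "0 < orth_iters \<alpha> \<beta> c1 c3 n"
proof -
  define L where "L = ln (real n)"
  define y where "y = D * sqrt L"
  have L: "1 < L" using pos unfolding L_def by simp
  have y: "1 < y" using large unfolding y_def L_def .
  have ly: "ln L + 2 * ln D = 2 * ln y" unfolding y_def using pos(1) L by (simp add: ln_mult ln_sqrt)
  define a where "a = (2 * L + ln L + 2 * ln C) / 2"
  have a: "L \<le> a" using num unfolding a_def L_def by simp
  then have a0: "0 < a" using L by simp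
  have N: "orth_iters \<alpha> \<beta> c1 c3 n = nat \<lceil>a / ln y\<rceil>"
    unfolding orth_iters_def C_def[symmetric] D_def[symmetric] L_def[symmetric] ly a_def by simp
  have "r ^ nat \<lceil>a / ln y\<rceil> \<le> (1 / y) ^ nat \<lceil>a / ln y\<rceil>"
    using r unfolding y_def L_def by (intro power_mono) auto
  also have "\<dots> \<le> exp (- a)" by (rule nat_ceiling_powr_bound[OF y a0])
  also have "\<dots> \<le> exp (- L)" using a by simp
  also have "\<dots> = 1 / n" unfolding L_def using pos by (simp add: exp_minus divide_inverse)
  finally show "r ^ orth_iters \<alpha> \<beta> c1 c3 n \<le> 1 / n" unfolding N .
  show "0 < orth_iters \<alpha> \<beta> c1 c3 n" unfolding N using a0 y by simp
qed

text \<open>Here \<open>1 / \<theta>\<close> plays the role of \<open>y\<close>, and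
  \<open>m\<close> steps turn \<open>sqrt n\<close> into at most 1. The exponent is one less than
  the count because the last iteration is kept for the repeat that stops the run.\<close>

lemma ppm_iters_decay:
  fixes \<gamma> c4 :: real
  assumes pos: "0 < \<gamma>" "0 < c4" "1 < real n" "1 < ln (real n)" and \<theta>: "\<theta> = c4 / (\<gamma> * sqrt (ln (real n)))" "\<theta> < 1"
  shows "\<theta> ^ (ppm_iters \<gamma> c4 n - 1) * sqrt n < 2" "1 \<le> ppm_iters \<gamma> c4 n - 1"
proof -
  define L where "L = ln (real n)"
  define y where "y = \<gamma> / c4 * sqrt L"
  have L: "1 < L" using pos unfolding L_def by simp
  have \<theta>y: "\<theta> = 1 / y" unfolding \<theta> y_def L_def by simp
  have y0: "0 < y" unfolding y_def using pos L by simp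
  have y: "1 < y" using \<theta>(2) y0 unfolding \<theta>y by simp
  have ly: "ln L + 2 * ln (\<gamma> / c4) = 2 * ln y" unfolding y_def using pos L by (simp add: ln_mult ln_sqrt ln_div)
  define m where "m = nat \<lceil>(L / 2) / ln y\<rceil>"
  have "0 < L / (2 * ln y)" using L y by simp
  then have "0 \<le> \<lceil>L / (2 * ln y)\<rceil>" by linarith
  then have K: "ppm_iters \<gamma> c4 n - 1 = Suc m"
    unfolding ppm_iters_def L_def[symmetric] ly m_def by (simp add: nat_add_distrib)
  then show "1 \<le> ppm_iters \<gamma> c4 n - 1" by simp
  have "\<theta> ^ Suc m * sqrt n \<le> (1 / y) ^ m * sqrt n"
    using \<theta>(2) y0 unfolding \<theta>y by (intro mult_right_mono power_decreasing) auto
  also have "\<dots> \<le> exp (- (L / 2)) * sqrt n"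
    unfolding m_def using L by (intro mult_right_mono nat_ceiling_powr_bound y) auto
  also have "exp (- (L / 2)) = 1 / sqrt n"
  proof -
    have "sqrt n = exp (L / 2)"
      unfolding L_def using pos(3) by (intro real_sqrt_unique) (simp_all add: power2_eq_square flip: exp_add)
    then show ?thesis by (simp add: exp_minus inverse_eq_divide)
  qed
  also have "1 / sqrt n * sqrt n = 1" using pos by simp
  finally show "\<theta> ^ (ppm_iters \<gamma> c4 n - 1) * sqrt n < 2" unfolding K by simp
qed

section \<open>Asymptotics of the numerical conditions\<close>

lemma filterlim_ln_real: "filterlim (\<lambda>n. ln (real n)) at_top sequentially"
  by (rule filterlim_compose[OF ln_at_top filterlim_real_sequentially])

lemma filterlim_sqrt_ln: "filterlim (\<lambda>n. sqrt (ln (real n))) at_top sequentially"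
  by (rule filterlim_compose[OF sqrt_at_top filterlim_ln_real])

lemma tendsto_powr_neg:
  assumes "a < 0"
  shows "(\<lambda>n. real n powr a) \<longlonglongrightarrow> 0"
  by (rule tendsto_neg_powr[OF assms filterlim_real_sequentially])

text \<open>The failure probability has three terms; each of them is given a third of
  \<open>n powr (- c)\<close>.\<close>

lemma eventually_powr_absorb:
  assumes "0 < c" "c < a"
  shows "\<forall>\<^sub>F n in sequentially. C * real n powr (- a) \<le> real n powr (- c) / 3"
proof -
  have "(\<lambda>n. C * real n powr (c - a)) \<longlonglongrightarrow> C * 0"
    using assms by (intro tendsto_mult tendsto_const tendsto_powr_neg) auto
  then have "\<forall>\<^sub>F n in sequentially. C * real n powr (c - a) < 1 / 3"
    by (intro order_tendstoD(2)[of _ "C * 0"]) auto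
  then show ?thesis
    using eventually_gt_at_top[of 0]
  proof eventually_elim
    case (elim n)
    have "C * real n powr (- a) = C * real n powr (c - a) * real n powr (- c)"
      by (simp add: powr_add[symmetric])
    also have "\<dots> \<le> 1 / 3 * real n powr (- c)" using elim by (intro mult_right_mono) auto
    finally show ?case by simp
  qed
qed

text \<open>\<open>S\<close> stands for the square root of \<open>ln n\<close>. For large
  \<open>S\<close> the ratio behaves like
  \<open>2 * sqrt 2 * c1 / ((\<alpha> - \<beta>) * S)\<close>, below the
  \<open>4 * c1 / ((\<alpha> - \<beta>) * S)\<close> on which the iteration count is based, because
  \<open>2 * sqrt 2 < 4\<close>. The threshold is this comparison solved for
  \<open>S\<close>.\<close>

lemma dominant_rate:
  fixes \<alpha> \<beta> c1 S d l2 D :: real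
  assumes "\<beta> < \<alpha>" "1 \<le> c1" and d: "d = c1 * S" and l2: "l2 = (\<alpha> - \<beta>) / 2 * (S * S)" and D: "D = (\<alpha> - \<beta>) / (4 * c1)"
    and S: "0 < S" "4 * sqrt 2 * c1 / ((2 - sqrt 2) * (\<alpha> - \<beta>)) < S"
  shows "2 * (sqrt 2 * d) \<le> l2" "0 \<le> sqrt 2 * d / (l2 - sqrt 2 * d)"
    "sqrt 2 * d / (l2 - sqrt 2 * d) \<le> 1 / (D * S)"
proof -
  have s2: "sqrt 2 < 2" "1 < sqrt 2" by (auto intro: real_less_lsqrt)
  have "0 < (2 - sqrt 2) * (\<alpha> - \<beta>)" using s2 assms(1) by simp
  then have 1: "4 * sqrt 2 * c1 < (2 - sqrt 2) * (\<alpha> - \<beta>) * S"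
    using S(2) by (simp only: pos_divide_less_eq mult.commute)
  have "(2 - sqrt 2) * ((\<alpha> - \<beta>) * S) \<le> 1 * ((\<alpha> - \<beta>) * S)"
    using s2 assms(1) S(1) by (intro mult_right_mono) auto
  then have "4 * sqrt 2 * c1 < (\<alpha> - \<beta>) * S" using 1 by (simp only: mult.assoc mult_1)
  then have "4 * sqrt 2 * c1 * S \<le> (\<alpha> - \<beta>) * S * S" using S(1) by (intro mult_right_mono) auto
  then show dom: "2 * (sqrt 2 * d) \<le> l2" by (simp add: d l2 ac_simps)
  have sd: "0 < sqrt 2 * d" using assms(2) S(1) by (simp add: d)
  then have pos: "0 < l2 - sqrt 2 * d" using dom by linarith
  show "0 \<le> sqrt 2 * d / (l2 - sqrt 2 * d)" using sd pos by simp
  have "sqrt 2 * (\<alpha> - \<beta>) * S \<le> 4 * ((\<alpha> - \<beta>) / 2 * S - sqrt 2 * c1)"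
    using 1 by (simp add: algebra_simps)
  then have "(sqrt 2 * (\<alpha> - \<beta>) * S) * (c1 * S) \<le> (4 * ((\<alpha> - \<beta>) / 2 * S - sqrt 2 * c1)) * (c1 * S)"
    using assms(2) S(1) by (intro mult_right_mono) auto
  moreover have "(sqrt 2 * (\<alpha> - \<beta>) * S) * (c1 * S) = sqrt 2 * d * ((\<alpha> - \<beta>) * S)"
    by (simp add: d ac_simps)
  moreover have "(4 * ((\<alpha> - \<beta>) / 2 * S - sqrt 2 * c1)) * (c1 * S) = 4 * c1 * (l2 - sqrt 2 * d)"
    by (simp add: d l2 algebra_simps)
  ultimately have "sqrt 2 * d * ((\<alpha> - \<beta>) * S) \<le> 4 * c1 * (l2 - sqrt 2 * d)"
    by (simp only:)
  moreover have "0 < (\<alpha> - \<beta>) * S" using assms(1) S(1) by simp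
  ultimately have "sqrt 2 * d / (l2 - sqrt 2 * d) \<le> 4 * c1 / ((\<alpha> - \<beta>) * S)"
    using pos by (simp only: pos_divide_le_eq pos_le_divide_eq times_divide_eq_left)
  then show "sqrt 2 * d / (l2 - sqrt 2 * d) \<le> 1 / (D * S)" by (simp add: D)
qed

text \<open>The origin of \<open>c4\<close> and of the bound on \<open>\<delta>\<close>: by
  \<open>c4 * \<delta> \<le> 12 * c3 * \<gamma>\<close> the second-order loss takes at most
  \<open>3 * c3 * (\<alpha> - \<beta>) / 2\<close> from \<open>c4 / 2\<close>, and what remains is
  at least \<open>c1\<close>, the constant of the noise \<open>d\<close>.\<close>

lemma contraction_margin:
  fixes \<alpha> \<beta> \<gamma> c1 c3 c4 S d l2 \<delta> :: real
  assumes "\<beta> < \<alpha>" "0 < \<gamma>" "0 < c3" "1 \<le> c1" and c4: "c4 = 3 * c3 * (\<alpha> - \<beta>) + 2 * c1"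
    and \<delta>: "0 < \<delta>" "c4 * \<delta> \<le> 12 * c3 * \<gamma>" and S: "0 < S"
    and d: "d = c1 * S" and l2: "l2 = (\<alpha> - \<beta>) / 2 * (S * S)"
  shows "l2 * \<delta> / 4 < \<gamma> * (S * S) / 2" "d \<le> c4 / (\<gamma> * S) * (\<gamma> * (S * S) / 2 - l2 * \<delta> / 4)"
proof -
  have "3 * c3 * (\<alpha> - \<beta>) < c4" using assms(4) c4 by simp
  then have "3 * c3 * (\<alpha> - \<beta>) * \<delta> < c4 * \<delta>" using \<delta>(1) by (rule mult_strict_right_mono)
  also have "\<dots> \<le> 3 * c3 * (4 * \<gamma>)" using \<delta>(2) by simp
  finally have "(3 * c3) * ((\<alpha> - \<beta>) * \<delta>) < (3 * c3) * (4 * \<gamma>)" by (simp only: mult.assoc)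
  then have "(\<alpha> - \<beta>) * \<delta> < 4 * \<gamma>" using assms(3) by (simp only: mult_less_cancel_left_pos zero_less_mult_iff zero_less_numeral simp_thms)
  then have "(\<alpha> - \<beta>) * \<delta> * (S * S / 8) < 4 * \<gamma> * (S * S / 8)" using S by (intro mult_strict_right_mono) auto
  then show "l2 * \<delta> / 4 < \<gamma> * (S * S) / 2" by (simp add: l2 ac_simps)
  have "c4 * \<delta> * (\<alpha> - \<beta>) \<le> 12 * c3 * \<gamma> * (\<alpha> - \<beta>)" using \<delta>(2) assms(1) by (intro mult_right_mono) auto
  also have "12 * c3 * \<gamma> * (\<alpha> - \<beta>) = (c4 - 2 * c1) / 2 * (8 * \<gamma>)" by (simp add: c4)
  finally have "c4 * \<delta> * (\<alpha> - \<beta>) / (8 * \<gamma>) \<le> (c4 - 2 * c1) / 2"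
    using assms(2) by (simp only: pos_divide_le_eq zero_less_mult_iff zero_less_numeral simp_thms)
  then have "c1 \<le> c4 / 2 - c4 * \<delta> * (\<alpha> - \<beta>) / (8 * \<gamma>)" by (simp add: diff_divide_distrib)
  then have "c1 * S \<le> (c4 / 2 - c4 * \<delta> * (\<alpha> - \<beta>) / (8 * \<gamma>)) * S" using S by (intro mult_right_mono) auto
  also have "\<dots> = c4 / (\<gamma> * S) * (\<gamma> * (S * S) / 2 - l2 * \<delta> / 4)"
    using assms(2) S by (simp add: l2 field_simps)
  finally show "d \<le> c4 / (\<gamma> * S) * (\<gamma> * (S * S) / 2 - l2 * \<delta> / 4)" by (simp add: d)
qed

text \<open>\<open>\<delta>\<close> stays fixed while both errors tend to 0: the noise grows like
  \<open>sqrt (ln n)\<close>, and the gap \<open>\<beta> * ln n\<close> by which it is divided grows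
  faster. In the application \<open>a\<close> is \<open>(\<alpha> - \<beta>) / 2\<close> and
  \<open>b\<close> is \<open>\<beta>\<close>.\<close>

lemma ritz_error_vanishes:
  fixes a b c1 D \<delta> :: real
  assumes "0 < \<delta>"
  defines "\<epsilon> \<equiv> \<lambda>n. 1 / (D * sqrt (ln (real n))) + 4 * real n powr (- 1 / 4)"
  defines "\<eta> \<equiv> \<lambda>n. (a * (\<epsilon> n)\<^sup>2 + c1 / sqrt (ln (real n))) / b"
  shows "\<forall>\<^sub>F n in sequentially. 2 * (sqrt ((\<eta> n)\<^sup>2 + 2 * \<eta> n) + (\<epsilon> n)\<^sup>2) < \<delta>"
proof -
  have inv_sqrt: "(\<lambda>n. r / sqrt (ln (real n))) \<longlonglongrightarrow> 0" for r :: real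
    by (rule tendsto_divide_0[OF tendsto_const filterlim_at_top_imp_at_infinity[OF filterlim_sqrt_ln]])
  have "(\<lambda>n. (1 / D) / sqrt (ln (real n)) + 4 * real n powr (- 1 / 4)) \<longlonglongrightarrow> 0 + 4 * 0"
    by (intro tendsto_add inv_sqrt tendsto_mult tendsto_const tendsto_powr_neg) simp
  then have \<epsilon>_lim: "\<epsilon> \<longlonglongrightarrow> 0" unfolding \<epsilon>_def by simp
  have "(\<lambda>n. inverse b * (a * (\<epsilon> n)\<^sup>2 + c1 / sqrt (ln (real n)))) \<longlonglongrightarrow> inverse b * (a * 0\<^sup>2 + 0)"
    by (intro tendsto_mult tendsto_add tendsto_power tendsto_const \<epsilon>_lim inv_sqrt)
  then have \<eta>_lim: "\<eta> \<longlonglongrightarrow> 0" unfolding \<eta>_def by (simp add: divide_inverse mult.commute)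
  have "(\<lambda>n. 2 * (sqrt ((\<eta> n)\<^sup>2 + 2 * \<eta> n) + (\<epsilon> n)\<^sup>2)) \<longlonglongrightarrow> 2 * (sqrt (0\<^sup>2 + 2 * 0) + 0\<^sup>2)"
    by (intro tendsto_mult tendsto_add tendsto_power tendsto_real_sqrt tendsto_const \<epsilon>_lim \<eta>_lim)
  then show ?thesis using assms(1) by (intro order_tendstoD(2)) auto
qed

lemma failure_probability_absorbed:
  fixes \<zeta> c c2 :: real
  assumes c: "0 < c" "c < \<zeta>" "c < 1 / 16"
  shows "\<forall>\<^sub>F n in sequentially.
    c2 / real n ^ 3 + real n powr (- \<zeta>) + 5 * real n powr (- 1 / 16) \<le> real n powr (- c)"
proof -
  have c3: "c < 3" using c(3) by simp
  show ?thesis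
    using eventually_powr_absorb[OF c(1) c3, of c2] eventually_powr_absorb[OF c(1,2), of 1]
      eventually_powr_absorb[OF c(1,3), of 5] eventually_gt_at_top[of 0]
  proof eventually_elim
    case (elim n)
    have "real n powr (- 3) = 1 / real n ^ 3"
      using elim(4) powr_realpow[of "real n" 3] by (simp add: powr_minus_divide)
    then have "c2 / real n ^ 3 \<le> real n powr (- c) / 3" using elim(1) by simp
    moreover have "real n powr (- \<zeta>) \<le> real n powr (- c) / 3" using elim(2) by simp
    moreover have "5 * real n powr (- 1 / 16) \<le> real n powr (- c) / 3" using elim(3) by simp
    ultimately show ?case by linarith
  qed
qed

theorem theorem4:
  fixes \<alpha> \<beta> \<gamma> c1 c2 c3 c4 :: real
  assumes "\<beta> > 0" and "\<alpha> > \<beta>" and "sqrt \<alpha> - sqrt \<beta> > sqrt 2"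
    and "\<gamma> > 0"
    and "(sqrt \<alpha> - sqrt \<beta>)\<^sup>2 / 2 - \<gamma> * (ln \<alpha> - ln \<beta>) / 2 - 1 > 0"
    and "c1 \<ge> 1" and "c2 > 0" and "adj_concentration \<alpha> \<beta> c1 c2"
    and "c3 = 2 * sqrt 2 * c1 / min \<beta> ((\<alpha> - \<beta>) / 2)"
    and "c4 = 3 * c3 * (\<alpha> - \<beta>) + 2 * c1"
  shows "\<exists>c>0. \<forall>\<^sub>F n in sequentially. \<forall>xs p q.
           even n \<and> n \<ge> 2 \<and> xs \<in> balanced_labels n \<and>
           p = \<alpha> * ln (real n) / real n \<and> q = \<beta> * ln (real n) / real n \<and> p \<le> 1 \<and>
           real n > Max {exp (16 * c1\<^sup>2 / min ((\<alpha> - \<beta>)\<^sup>2) (\<beta>\<^sup>2)),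
                         exp (5 * c3 / sqrt (2 * \<gamma>)),
                         exp (c4\<^sup>2 / \<gamma>\<^sup>2), 6} \<longrightarrow>
           (\<exists>E \<in> sets (model_space n p q xs).
              measure (model_space n p q xs) E \<ge> 1 - real n powr (- c) \<and>
              (\<forall>(A, w) \<in> E.
                 finds_labels n xs (orth_iters \<alpha> \<beta> c1 c3 n) (ppm_iters \<gamma> c4 n)
                   A (mat n 2 w)))"
proof -
  define \<zeta> where "\<zeta> = (sqrt \<alpha> - sqrt \<beta>)\<^sup>2 / 2 - \<gamma> * (ln \<alpha> - ln \<beta>) / 2 - 1"
  define C D where "C = (16 * \<alpha> + 18 * \<beta>) / (\<beta> * min 1 c3)" and "D = (\<alpha> - \<beta>) / (4 * c1)"
  \<comment> \<open>The second entry is the budget for which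
    \<open>c4 / (\<gamma> * sqrt (ln n))\<close> is a valid contraction factor; the cap 1 gives
    \<open>\<delta> < 2\<close> and lets \<open>sqrt (\<delta> * n)\<close> be bounded by
    \<open>sqrt n\<close>.\<close>
  define \<delta> where "\<delta> = min 1 (12 * c3 * \<gamma> / c4)"
  \<comment> \<open>Halving leaves room to absorb the constants of the failure terms.\<close>
  define c where "c = min \<zeta> (1 / 16) / 2"
  have \<zeta>: "0 < \<zeta>" using assms(5) by (simp add: \<zeta>_def)
  have c: "0 < c" "c < \<zeta>" "c < 1 / 16" using \<zeta> by (auto simp: c_def)
  have c3: "0 < c3" using assms(1,2,6,9) by simp
  have "0 < 3 * c3 * (\<alpha> - \<beta>)" using c3 assms(2) by simp
  then have c4: "0 < c4" using assms(6,10) by linarith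
  have C: "0 < C" using assms(1,2) c3 by (simp add: C_def)
  have D: "0 < D" using assms(2,6) by (simp add: D_def)
  have \<delta>: "0 < \<delta>" "\<delta> \<le> 1" using c3 c4 assms(4) by (auto simp: \<delta>_def)
  have "\<delta> \<le> 12 * c3 * \<gamma> / c4" by (simp add: \<delta>_def)
  then have \<delta>c4: "c4 * \<delta> \<le> 12 * c3 * \<gamma>" using c4 by (simp add: field_simps)
  define \<epsilon> where "\<epsilon> = (\<lambda>n. 1 / (D * sqrt (ln (real n))) + 4 * real n powr (- 1 / 4))"
  define \<eta> where "\<eta> = (\<lambda>n. ((\<alpha> - \<beta>) / 2 * (\<epsilon> n)\<^sup>2 + c1 / sqrt (ln (real n))) / \<beta>)"
  have ev_small: "\<forall>\<^sub>F n in sequentially. 2 * (sqrt ((\<eta> n)\<^sup>2 + 2 * \<eta> n) + (\<epsilon> n)\<^sup>2) < \<delta>"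
    unfolding \<eta>_def \<epsilon>_def by (rule ritz_error_vanishes[OF \<delta>(1)])
  have ev_sqrt: "\<forall>\<^sub>F n in sequentially. a < sqrt (ln (real n))" for a
    using filterlim_sqrt_ln by (simp add: filterlim_at_top_dense)
  have ev_ln: "\<forall>\<^sub>F n in sequentially. a < ln (real n)" for a
    using filterlim_ln_real by (simp add: filterlim_at_top_dense)
  have ev_lnln: "\<forall>\<^sub>F n in sequentially. - 2 * ln C < ln (ln (real n))"
    using filterlim_compose[OF ln_at_top filterlim_ln_real] by (simp add: filterlim_at_top_dense)
  show ?thesis
  proof (rule exI[of _ c], rule conjI[OF c(1)])
    show "\<forall>\<^sub>F n in sequentially. \<forall>xs p q.
           even n \<and> n \<ge> 2 \<and> xs \<in> balanced_labels n \<and>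
           p = \<alpha> * ln (real n) / real n \<and> q = \<beta> * ln (real n) / real n \<and> p \<le> 1 \<and>
           real n > Max {exp (16 * c1\<^sup>2 / min ((\<alpha> - \<beta>)\<^sup>2) (\<beta>\<^sup>2)),
                         exp (5 * c3 / sqrt (2 * \<gamma>)),
                         exp (c4\<^sup>2 / \<gamma>\<^sup>2), 6} \<longrightarrow>
           (\<exists>E \<in> sets (model_space n p q xs).
              measure (model_space n p q xs) E \<ge> 1 - real n powr (- c) \<and>
              (\<forall>(A, w) \<in> E.
                 finds_labels n xs (orth_iters \<alpha> \<beta> c1 c3 n) (ppm_iters \<gamma> c4 n)
                   A (mat n 2 w)))"
      \<comment> \<open>The three thresholds on \<open>sqrt (ln n)\<close> give, in this order, a
        base above 1 in the count of orthogonal iterations, the dominance of the leading block with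
        its rate, and \<open>\<theta> < 1\<close>.\<close>
      using failure_probability_absorbed[OF c, of c2] ev_small ev_ln[of 1] ev_lnln ev_sqrt[of "1 / D"]
        ev_sqrt[of "4 * sqrt 2 * c1 / ((2 - sqrt 2) * (\<alpha> - \<beta>))"] ev_sqrt[of "c4 / \<gamma>"]
    proof eventually_elim
      case (elim n)
      define S where "S = sqrt (ln (real n))"
      have S: "0 < S" "S * S = ln (real n)" using elim(3) by (simp_all add: S_def)
      have n1: "1 < real n"
      proof (rule ccontr)
        assume "\<not> 1 < real n"
        then have "n = 0 \<or> n = 1" by auto
        then show False using elim(3) by auto
      qed
      define d l2 where "d = c1 * S" and "l2 = (\<alpha> - \<beta>) / 2 * (S * S)"
      have DS: "1 < D * S" using elim(5) D by (simp add: S_def field_simps)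
      note rate = dominant_rate[OF assms(2,6) d_def l2_def D_def S(1) elim(6)[folded S_def]]
      have orth: "(sqrt 2 * d / (l2 - sqrt 2 * d)) ^ orth_iters \<alpha> \<beta> c1 c3 n \<le> 1 / n" "0 < orth_iters \<alpha> \<beta> c1 c3 n"
        using orth_iters_decay[of \<alpha> \<beta> c1 c3 n "sqrt 2 * d / (l2 - sqrt 2 * d)", folded C_def D_def S_def]
          D C n1 elim(3,4) DS rate(2,3) by simp_all
      define \<theta> where "\<theta> = c4 / (\<gamma> * S)"
      have \<theta>: "0 \<le> \<theta>" "\<theta> < 1"
        using c4 assms(4) S(1) elim(7) by (simp_all add: \<theta>_def S_def[symmetric] field_simps)
      have ppm: "\<theta> ^ (ppm_iters \<gamma> c4 n - 1) * sqrt n < 2" "1 \<le> ppm_iters \<gamma> c4 n - 1"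
        using ppm_iters_decay[OF assms(4) c4 n1 elim(3), folded S_def, OF \<theta>_def \<theta>(2)] by simp_all
      have "\<delta> * real n \<le> real n" using mult_right_mono[OF \<delta>(2), of "real n"] by simp
      then have "\<theta> ^ (ppm_iters \<gamma> c4 n - 1) * sqrt (\<delta> * n) \<le> \<theta> ^ (ppm_iters \<gamma> c4 n - 1) * sqrt n"
        using \<theta>(1) by (intro mult_left_mono) auto
      then have ppm': "\<theta> ^ (ppm_iters \<gamma> c4 n - 1) * sqrt (\<delta> * n) < 2" using ppm(1) by linarith
      note contr = contraction_margin[OF assms(2,4) c3 assms(6,10) \<delta>(1) \<delta>c4 S(1) d_def l2_def, folded \<theta>_def]
      have \<eta>: "\<eta> n = (l2 * (\<epsilon> n)\<^sup>2 + d) / (\<beta> * (S * S))"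
        using S(1) assms(1) by (simp add: \<eta>_def l2_def d_def S_def[symmetric] field_simps)
      have \<epsilon>: "sqrt 2 * d / (l2 - sqrt 2 * d) + 4 * real n powr (- 1 / 4) \<le> \<epsilon> n"
        using rate(3) by (simp add: \<epsilon>_def S_def)
      have dS: "d = c1 * sqrt (S * S)" using S(1) by (simp add: d_def)
      have K: "ppm_iters \<gamma> c4 n - 1 + 1 \<le> ppm_iters \<gamma> c4 n" using ppm(2) by simp
      have \<delta>2: "\<delta> < 2" using \<delta>(2) by simp
      show ?case
      proof (intro allI impI, elim conjE)
        fix xs p q
        assume *: "even n" "n \<ge> 2" "xs \<in> balanced_labels n"
          "p = \<alpha> * ln (real n) / real n" "q = \<beta> * ln (real n) / real n" "p \<le> 1"
        from recovery_event[OF S(2) dS l2_def refl assms(1,2,6,8) *(1,2,3,4,6,5) \<zeta>_def orth(2) rate(1) orth(1) order_refl \<epsilon> \<eta>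
            less_imp_le[OF elim(2)] \<delta>2 contr(1) \<theta> contr(2) ppm(2) ppm' K]
        obtain E where E: "E \<in> sets (model_space n p q xs)"
          "1 - (c2 / real n ^ 3 + real n powr (- \<zeta>) + 5 * real n powr (- 1 / 16)) \<le> measure (model_space n p q xs) E"
          "\<forall>(A, w)\<in>E. finds_labels n xs (orth_iters \<alpha> \<beta> c1 c3 n) (ppm_iters \<gamma> c4 n) A (mat n 2 w)"
          by blast
        have "1 - real n powr (- c) \<le> measure (model_space n p q xs) E" using E(2) elim(1) by linarith
        then show "\<exists>E \<in> sets (model_space n p q xs).
              measure (model_space n p q xs) E \<ge> 1 - real n powr (- c) \<and>
              (\<forall>(A, w) \<in> E.
                 finds_labels n xs (orth_iters \<alpha> \<beta> c1 c3 n) (ppm_iters \<gamma> c4 n)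
                   A (mat n 2 w))"
          using E(1,3) by blast
      qed
    qed
  qed
qed

end
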